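(* There are absolute constants $c_1, c_2 > 0$ such that for every positive integer $n$ and every $\mathcal{Q} \subseteq 2^{[n]}$, $c_1\,\mathrm{val}_{\mathcal{Q}} \le \mathsf{Q}^{\mathcal{Q}}(\oplus) \le c_2\,\mathrm{val}_{\mathcal{Q}}$ (that is, $\mathsf{Q}^{\mathcal{Q}}(\oplus) = \Theta(\mathrm{val}_{\mathcal{Q}})$), where $$\mathrm{val}_{\mathcal{Q}} := \max_{\substack{f : \{-1,1\}^n \to \mathbb{R}\\ f \text{ is an odd function},\ f\not\equiv 0}} \frac{\|f\|_\infty}{\max\limits_{S \in \mathcal{Q},\ b \in \{-1,1\}^{\bar{S}}}\sqrt{\mathrm{Var}(f_{S|b})}}.$$
   Context: $[n]=\{1,\dots,n\}$ and $\bar S = [n]\setminus S$. A function $f:\{-1,1\}^n\to\mathbb{R}$ is odd if $f(-x)=-f(x)$ for all $x$. $\|f\|_\infty=\max_x|f(x)|$. For $S\subseteq[n]$ and $b\in\{-1,1\}^{\bar S}$, $f_{S|b}:\{-1,1\}^S\to\mathbb{R}$ is the restriction of $f$ obtained by fixing the coordinates in $\bar S$ to $b$ (so the free coordinates are exactly $S$). $\mathrm{Var}(g)$ is the variance of $g(\mathbf{x})$ for $\mathbf{x}$ uniform on the domain of $g$. $\oplus:\{-1,1\}^n\to\{-1,1\}$ is parity, $\oplus(x)=\prod_{i=1}^n x_i$. Query model: for $\mathcal{Q}\subseteq 2^{[n]}$, a query is a pair $(S,b)$ with $S\in\mathcal{Q}$, $b\in\{-1,1\}^S$; its answer on hidden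 input $x\in\{-1,1\}^n$ is $\mathbb{I}[x_S=b]\in\{0,1\}$, where $x_S$ is the restriction of $x$ to the coordinates in $S$. A quantum algorithm making $T$ queries prepares $U_TO_xU_{T-1}\cdots U_1O_xU_0|\psi_0\rangle$ on a finite-dimensional space (query register, answer qubit, workspace), where $|\psi_0\rangle$ and the unitaries $U_i$ do not depend on $x$ and $O_x:|S,b\rangle|a\rangle|w\rangle\mapsto|S,b\rangle|a+\mathbb{I}[x_S=b] \bmod 2\rangle|w\rangle$; it then measures to produce an output. For a function $F:\{-1,1\}^n\to E$, $\mathsf{Q}^{\mathcal{Q}}(F)$ is the least $T$ for which some such algorithm outputs $F(x)$ with probability at least $2/3$ for every $x$. Conventions: in $\mathrm{val}_{\mathcal{Q}}$, a ratio with positive numerator and zero denominator is $+\infty$, a maximum over an empty set of nonnegative quantities is $0$, and $\mathsf{Q}^{\mathcal{Q}}(F)=\infty$ if no algorithm computes $F$. *)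

theory Defs
  imports "HOL-Probability.Probability"
begin

text \<open>A point of \<open>{-1,1}\<^sup>I\<close> is a function on \<open>nat\<close> that is \<open>undefined\<close> outside \<open>I\<close>, so the
  projection \<open>x\<^sub>S\<close> is \<open>restrict x S\<close>.  Functions on a cube are total HOL functions; only their
  values on the cube are ever used.\<close>

definition cube :: "nat set \<Rightarrow> (nat \<Rightarrow> real) set" where
  "cube I = I \<rightarrow>\<^sub>E {-1, 1}"

definition parity :: "nat \<Rightarrow> (nat \<Rightarrow> real) \<Rightarrow> real" where
  "parity n x = (\<Prod>i\<in>{1..n}. x i)"

definition odd_on_cube :: "nat \<Rightarrow> ((nat \<Rightarrow> real) \<Rightarrow> real) \<Rightarrow> bool" where
  "odd_on_cube n f \<longleftrightarrow> (\<forall>x\<in>cube {1..n}. f (\<lambda>i\<in>{1..n}. - x i) = - f x)"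

definition sup_norm :: "nat \<Rightarrow> ((nat \<Rightarrow> real) \<Rightarrow> real) \<Rightarrow> real" where
  "sup_norm n f = Max ((\<lambda>x. \<bar>f x\<bar>) ` cube {1..n})"

definition subfunction ::
  "nat \<Rightarrow> ((nat \<Rightarrow> real) \<Rightarrow> real) \<Rightarrow> nat set \<Rightarrow> (nat \<Rightarrow> real) \<Rightarrow> (nat \<Rightarrow> real) \<Rightarrow> real" where
  "subfunction n f S b = (\<lambda>y. f (\<lambda>i\<in>{1..n}. if i \<in> S then y i else b i))"

definition cube_variance :: "nat set \<Rightarrow> ((nat \<Rightarrow> real) \<Rightarrow> real) \<Rightarrow> real" where
  "cube_variance S g = measure_pmf.variance (pmf_of_set (cube S)) g"

text \<open>In \<open>ennreal\<close> a positive number divided by \<open>0\<close> is \<open>\<infinity>\<close> and the supremum of the empty set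
  is \<open>0\<close>.  The inner supremum is over a finite set.  The outer one is a maximum because the
  ratio is invariant under scaling of \<open>f\<close> and the odd functions with \<open>\<parallel>f\<parallel>\<^sub>\<infinity> = 1\<close> form
  a compact set.\<close>

definition max_sd :: "nat \<Rightarrow> nat set set \<Rightarrow> ((nat \<Rightarrow> real) \<Rightarrow> real) \<Rightarrow> ennreal" where
  "max_sd n Q f =
     (SUP S\<in>Q. SUP b\<in>cube ({1..n} - S). ennreal (sqrt (cube_variance S (subfunction n f S b))))"

definition val_Q :: "nat \<Rightarrow> nat set set \<Rightarrow> ennreal" where
  "val_Q n Q =
     (SUP f\<in>{f. odd_on_cube n f \<and> (\<exists>x\<in>cube {1..n}. f x \<noteq> 0)}. ennreal (sup_norm n f) / max_sd n Q f)"

text \<open>Vectors and operators on the space with orthonormal basis a finite set \<open>B\<close>; entries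
  with an index outside \<open>B\<close> are irrelevant.\<close>

definition apply_op :: "'i set \<Rightarrow> ('i \<Rightarrow> 'i \<Rightarrow> complex) \<Rightarrow> ('i \<Rightarrow> complex) \<Rightarrow> 'i \<Rightarrow> complex" where
  "apply_op B A v = (\<lambda>i. \<Sum>j\<in>B. A i j * v j)"

definition norm_sq :: "'i set \<Rightarrow> ('i \<Rightarrow> complex) \<Rightarrow> real" where
  "norm_sq B v = (\<Sum>i\<in>B. (cmod (v i))\<^sup>2)"

definition unitary_on :: "'i set \<Rightarrow> ('i \<Rightarrow> 'i \<Rightarrow> complex) \<Rightarrow> bool" where
  "unitary_on B U \<longleftrightarrow>
     (\<forall>i\<in>B. \<forall>j\<in>B. (\<Sum>k\<in>B. cnj (U k i) * U k j) = of_bool (i = j) \<and>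
                  (\<Sum>k\<in>B. U i k * cnj (U j k)) = of_bool (i = j))"

text \<open>A projective measurement with finite outcome set \<open>E\<close>: mutually orthogonal self-adjoint
  projections summing to the identity.\<close>

definition measurement_on :: "'i set \<Rightarrow> 'e set \<Rightarrow> ('e \<Rightarrow> 'i \<Rightarrow> 'i \<Rightarrow> complex) \<Rightarrow> bool" where
  "measurement_on B E P \<longleftrightarrow> finite E \<and>
     (\<forall>e\<in>E. \<forall>i\<in>B. \<forall>j\<in>B. P e i j = cnj (P e j i)) \<and>
     (\<forall>e\<in>E. \<forall>e'\<in>E. \<forall>i\<in>B. \<forall>j\<in>B.
        (\<Sum>k\<in>B. P e i k * P e' k j) = (if e = e' then P e i j else 0)) \<and>
     (\<forall>i\<in>B. \<forall>j\<in>B. (\<Sum>e\<in>E. P e i j) = of_bool (i = j))"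

text \<open>\<open>((S, b), a, w)\<close> stands for the basis state \<open>|S,b\<rangle>|a\<rangle>|w\<rangle>\<close>.\<close>

type_synonym qbasis = "(nat set \<times> (nat \<Rightarrow> real)) \<times> nat \<times> nat"

definition qspace :: "nat set set \<Rightarrow> nat \<Rightarrow> qbasis set" where
  "qspace Q d = (SIGMA S:Q. cube S) \<times> {0, 1} \<times> {..<d}"

fun query_map :: "(nat \<Rightarrow> real) \<Rightarrow> qbasis \<Rightarrow> qbasis" where
  "query_map x ((S, b), a, w) = ((S, b), (a + of_bool (restrict x S = b)) mod 2, w)"

definition query_op :: "(nat \<Rightarrow> real) \<Rightarrow> qbasis \<Rightarrow> qbasis \<Rightarrow> complex" where
  "query_op x i j = of_bool (i = query_map x j)"

primrec query_state ::
  "qbasis set \<Rightarrow> (qbasis \<Rightarrow> complex) \<Rightarrow> (nat \<Rightarrow> qbasis \<Rightarrow> qbasis \<Rightarrow> complex) \<Rightarrow> (nat \<Rightarrow> real)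
     \<Rightarrow> nat \<Rightarrow> qbasis \<Rightarrow> complex" where
  "query_state B \<psi>0 U x 0 = apply_op B (U 0) \<psi>0"
| "query_state B \<psi>0 U x (Suc t) =
     apply_op B (U (Suc t)) (apply_op B (query_op x) (query_state B \<psi>0 U x t))"

text \<open>By the Born rule, outcome \<open>e\<close> on state \<open>\<psi>\<close> has probability \<open>\<parallel>P\<^sub>e \<psi>\<parallel>\<^sup>2\<close>.\<close>

definition quantum_computes ::
  "nat \<Rightarrow> nat set set \<Rightarrow> ((nat \<Rightarrow> real) \<Rightarrow> 'e) \<Rightarrow> nat \<Rightarrow> bool" where
  "quantum_computes n Q F T \<longleftrightarrow>
     (\<exists>d \<psi>0 U E P. let B = qspace Q d in
        norm_sq B \<psi>0 = 1 \<and> (\<forall>t\<le>T. unitary_on B (U t)) \<and> measurement_on B E P \<and>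
        (\<forall>x\<in>cube {1..n}. F x \<in> E \<and>
           norm_sq B (apply_op B (P (F x)) (query_state B \<psi>0 U x T)) \<ge> 2 / 3))"

text \<open>The infimum of the empty set is \<open>\<infinity>\<close> in \<open>enat\<close>.\<close>

definition quantum_query_complexity ::
  "nat \<Rightarrow> nat set set \<Rightarrow> ((nat \<Rightarrow> real) \<Rightarrow> 'e) \<Rightarrow> enat" where
  "quantum_query_complexity n Q F = Inf (enat ` {T. quantum_computes n Q F T})"

end

theory Submission imports Defs
begin

text \<open>Characters of the cube are indexed by points \<open>u\<close> of the cube rather than by subsets.  The quantity \<open>val\<^sub>Q\<close> is the negative-weight adversary bound after symmetrisation:
  the matrix whose \<open>(x, y)\<close> entry is the Fourier coefficient of \<open>f\<close> at \<open>x y\<close> has the values of the odd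
  function \<open>f\<close> as eigenvalues, and restricting it to the pairs separated by the query \<open>(S, b)\<close> leaves a
  matrix whose norm is the largest standard deviation of a restriction \<open>f\<^sub>S\<^sub>|\<^sub>c\<close>.

  Lower bound: put the input in a superposition and pass to the dual variable \<open>u\<close>.  The algorithm starts at a
  single point \<open>u\<^sub>0\<close>, where \<open>|f|\<close> is maximal; a query \<open>(S, b)\<close> only mixes the points of a subcube of direction
  \<open>S\<close> and changes the expectation of \<open>f\<close> by at most twice the standard deviation of \<open>f\<close> on it; a successful run
  makes the state nearly symmetric under \<open>u \<mapsto> -u\<close>, up to a phase, where the expectation of an odd function is
  small.

  Upper bound: by a closest-point argument in a finite-dimensional space, \<open>(\<delta>\<^sub>1 - \<delta>\<^sub>-\<^sub>1) / 2\<close> is a sum of functions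
  \<open>h\<^sub>S\<^sub>,\<^sub>c\<close> that live on subcubes and have sum zero, of total weight \<open>val\<^sub>Q\<close>.  Their transforms give vectors \<open>v\<^sub>x\<close>
  with \<open>\<parallel>v\<^sub>x\<parallel>\<^sup>2 \<le> val\<^sub>Q\<close> for which one query followed by one fixed reflection maps \<open>\<xi> \<oplus> v\<^sub>x\<close> to
  \<open>\<plusminus>\<xi>' \<oplus> v\<^sub>x\<close>, the sign being the parity of \<open>x\<close>.  So \<open>v\<^sub>x\<close> acts as a catalyst: with \<open>K = O(val\<^sub>Q)\<close> copies
  of \<open>\<xi>\<close> in superposition, served one after the other by the same \<open>v\<^sub>x\<close>, its relative weight is so small that
  starting without it costs only a constant error.\<close>


subsection \<open>Characters of the cube\<close>

text \<open>This is the character indexed by the set where \<open>u\<close> is -1. Encoding that set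
  by a sign vector makes the kernel symmetric in \<open>u\<close> and \<open>x\<close> and turns
  complementation of the set into negation of \<open>u\<close>.\<close>

definition walsh :: "nat set \<Rightarrow> (nat \<Rightarrow> real) \<Rightarrow> (nat \<Rightarrow> real) \<Rightarrow> real" where
  "walsh I u x = (\<Prod>i\<in>I. if u i = -1 \<and> x i = -1 then -1 else 1)"

text \<open>The domain of a restriction, kept inside the full cube so that transforms over the whole
  cube can be localised to it; \<open>S\<close> holds the free directions.\<close>

definition subcube :: "nat set \<Rightarrow> nat set \<Rightarrow> (nat \<Rightarrow> real) \<Rightarrow> (nat \<Rightarrow> real) set" where
  "subcube I S c = {u \<in> cube I. restrict u (I - S) = c}"

definition variance_on :: "'a set \<Rightarrow> ('a \<Rightarrow> real) \<Rightarrow> real" where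
  "variance_on C f = (\<Sum>u\<in>C. (f u - (\<Sum>w\<in>C. f w) / card C)\<^sup>2) / card C"

lemma finite_cube [simp]: "finite I \<Longrightarrow> finite (cube I)"
  by (simp add: cube_def finite_PiE)

lemma card_cube: "finite I \<Longrightarrow> card (cube I) = 2 ^ card I"
  by (simp add: cube_def card_PiE numeral_2_eq_2)

lemma cube_nonempty [simp]: "cube I \<noteq> {}"
  by (simp add: cube_def PiE_eq_empty_iff)

lemma cube_values: "x \<in> cube I \<Longrightarrow> i \<in> I \<Longrightarrow> x i = -1 \<or> x i = 1"
  by (force simp: cube_def PiE_iff)

lemma restrict_cube [simp]: "x \<in> cube I \<Longrightarrow> S \<subseteq> I \<Longrightarrow> restrict x S \<in> cube S"
  by (auto simp: cube_def PiE_iff extensional_def)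

lemma uminus_cube [simp]: "x \<in> cube I \<Longrightarrow> (\<lambda>i\<in>I. - x i) \<in> cube I"
  by (fastforce simp: cube_def PiE_iff extensional_def)

lemma one_cube [simp]: "(\<lambda>i\<in>I. 1) \<in> cube I"
  by (auto simp: cube_def PiE_iff extensional_def)

lemma cube_eqI: "x \<in> cube I \<Longrightarrow> y \<in> cube I \<Longrightarrow> (\<And>i. i \<in> I \<Longrightarrow> x i = y i) \<Longrightarrow> x = y"
  unfolding cube_def by (rule PiE_ext)

lemma walsh_commute: "walsh I u x = walsh I x u"
  unfolding walsh_def by (rule prod.cong) auto

lemma walsh_sq [simp]: "walsh I u x * walsh I u x = 1"
  unfolding walsh_def prod.distrib [symmetric] by (rule prod.neutral) auto

lemma walsh_abs [simp]: "\<bar>walsh I u x\<bar> = 1"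
  by (metis walsh_sq abs_square_eq_1 power2_eq_square)

lemma walsh_restrict [simp]: "walsh I (restrict u I) x = walsh I u x" "walsh I u (restrict x I) = walsh I u x"
  unfolding walsh_def by (auto intro: prod.cong)

lemma walsh_split:
  assumes "finite I" "S \<subseteq> I"
  shows "walsh I u x = walsh S u x * walsh (I - S) u x"
  unfolding walsh_def using prod.subset_diff [OF assms(2,1)] by (simp add: mult.commute)

text \<open>The sum factors over the coordinates; a factor is 2 where \<open>x\<close> and
  \<open>y\<close> agree and 0 elsewhere.\<close>

lemma walsh_orthogonal:
  assumes "finite I" "x \<in> cube I" "y \<in> cube I"
  shows "(\<Sum>u\<in>cube I. walsh I u x * walsh I u y) = (if x = y then 2 ^ card I else 0)"
proof -
  let ?g = "\<lambda>i (v::real). (if v = -1 \<and> x i = -1 then -1 else 1) * (if v = -1 \<and> y i = -1 then -1 else 1 :: real)"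
  have "(\<Sum>u\<in>cube I. walsh I u x * walsh I u y) = (\<Sum>u\<in>cube I. \<Prod>i\<in>I. ?g i (u i))"
    by (simp add: walsh_def prod.distrib)
  also have "\<dots> = (\<Prod>i\<in>I. \<Sum>v\<in>{-1,1}. ?g i v)"
    unfolding cube_def using assms(1) by (subst prod_sum_PiE) auto
  also have "\<dots> = (\<Prod>i\<in>I. if x i = y i then 2 else 0)"
    by (rule prod.cong) (use cube_values [OF assms(2)] cube_values [OF assms(3)] in fastforce)+
  also have "\<dots> = (if x = y then 2 ^ card I else 0)"
    using assms cube_eqI [OF assms(2,3)] by (auto intro!: prod_zero)
  finally show ?thesis .
qed

lemma walsh_one [simp]: "walsh I (\<lambda>i\<in>I. 1) x = 1"
  by (simp add: walsh_def)

lemma walsh_minus_one: "x \<in> cube {1..n} \<Longrightarrow> walsh {1..n} (\<lambda>i\<in>{1..n}. -1) x = parity n x"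
  unfolding walsh_def parity_def by (rule prod.cong) (use cube_values in fastforce)+

text \<open>Negating \<open>u\<close> complements the index set of the character, which costs one
  full parity. This is where oddness in \<open>u\<close> meets the parity of
  \<open>x\<close>.\<close>

lemma walsh_uminus:
  assumes "u \<in> cube {1..n}" "x \<in> cube {1..n}"
  shows "walsh {1..n} (\<lambda>i\<in>{1..n}. - u i) x = parity n x * walsh {1..n} u x"
  unfolding walsh_def parity_def prod.distrib [symmetric]
  by (rule prod.cong) (use cube_values [OF assms(1)] cube_values [OF assms(2)] in fastforce)+

lemma parity_values: "x \<in> cube {1..n} \<Longrightarrow> parity n x = 1 \<or> parity n x = -1"
  by (metis abs_if walsh_abs walsh_minus_one minus_equation_iff)

section \<open>Subcubes as domains of restrictions\<close>

lemma bij_betw_subcube: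
  assumes "S \<subseteq> I" "c \<in> cube (I - S)"
  shows "bij_betw (\<lambda>y. \<lambda>i\<in>I. if i \<in> S then y i else c i) (cube S) (subcube I S c)"
proof (rule bij_betw_byWitness [where f' = "\<lambda>u. restrict u S"])
  show "\<forall>y\<in>cube S. restrict (\<lambda>i\<in>I. if i \<in> S then y i else c i) S = y"
    using assms(1) by (auto simp: cube_def PiE_iff extensional_def fun_eq_iff)
  show "\<forall>u\<in>subcube I S c. (\<lambda>i\<in>I. if i \<in> S then restrict u S i else c i) = u"
    using assms by (auto simp: subcube_def cube_def PiE_iff extensional_def fun_eq_iff)
  show "(\<lambda>y. \<lambda>i\<in>I. if i \<in> S then y i else c i) ` cube S \<subseteq> subcube I S c"
    using assms by (fastforce simp: subcube_def cube_def PiE_iff extensional_def fun_eq_iff)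
  show "(\<lambda>u. restrict u S) ` subcube I S c \<subseteq> cube S"
    using assms by (auto simp: subcube_def)
qed

lemma finite_subcube [simp]: "finite I \<Longrightarrow> finite (subcube I S c)"
  by (simp add: subcube_def)

lemma card_subcube:
  assumes "finite I" "S \<subseteq> I" "c \<in> cube (I - S)"
  shows "card (subcube I S c) = 2 ^ card S"
  using bij_betw_same_card [OF bij_betw_subcube [OF assms(2,3)]] card_cube [of S] assms
  by (simp add: finite_subset)

lemma sum_subcube:
  assumes "S \<subseteq> I" "c \<in> cube (I - S)"
  shows "(\<Sum>u\<in>subcube I S c. g u) = (\<Sum>y\<in>cube S. g (\<lambda>i\<in>I. if i \<in> S then y i else c i))"
  using sum.reindex_bij_betw [OF bij_betw_subcube [OF assms]] by metis

lemma sum_cube_split: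
  assumes "finite I" "S \<subseteq> I"
  shows "(\<Sum>c\<in>cube (I - S). \<Sum>u\<in>subcube I S c. g u) = (\<Sum>u\<in>cube I. g u)"
proof -
  have "(\<Sum>c\<in>cube (I - S). \<Sum>u\<in>{u \<in> cube I. restrict u (I - S) = c}. g u) = (\<Sum>u\<in>cube I. g u)"
    by (rule sum.group) (use assms in auto)
  then show ?thesis by (simp add: subcube_def)
qed

lemma cube_variance_subfunction:
  assumes "S \<subseteq> {1..n}" "c \<in> cube ({1..n} - S)"
  shows "cube_variance S (subfunction n f S c) = variance_on (subcube {1..n} S c) f"
proof -
  have fin: "finite S" using assms(1) finite_subset by blast
  note exp = integral_pmf_of_set [OF cube_nonempty finite_cube [OF fin]]
  have card: "card (cube S) = card (subcube {1..n} S c)"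
    using card_subcube [OF _ assms] card_cube [OF fin] by simp
  show ?thesis
    unfolding cube_variance_def variance_on_def exp sum_subcube [OF assms] card subfunction_def by simp
qed

text \<open>On a subcube the coordinates outside \<open>S\<close> contribute one fixed sign, so
  orthogonality on \<open>cube S\<close> applies. It makes the mean of \<open>f\<close> on a subcube
  invisible to a query about \<open>S\<close>.\<close>

lemma walsh_orthogonal_subcube:
  assumes "finite I" "S \<subseteq> I" "c \<in> cube (I - S)" "x \<in> cube I" "y \<in> cube I"
    "restrict x S \<noteq> restrict y S"
  shows "(\<Sum>u\<in>subcube I S c. walsh I u x * walsh I u y) = 0"
proof -
  let ?e = "walsh (I - S) c x * walsh (I - S) c y"
  have "walsh I u x * walsh I u y = ?e * (walsh S (restrict u S) (restrict x S) * walsh S (restrict u S) (restrict y S))"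
    if "u \<in> subcube I S c" for u
  proof -
    have "walsh (I - S) u x = walsh (I - S) c x" "walsh (I - S) u y = walsh (I - S) c y"
      using that by (auto simp: subcube_def simp flip: walsh_restrict(1) [of _ u])
    then show ?thesis
      by (simp add: walsh_split [OF assms(1,2)])
  qed
  then have "(\<Sum>u\<in>subcube I S c. walsh I u x * walsh I u y)
     = ?e * (\<Sum>u\<in>subcube I S c. walsh S (restrict u S) (restrict x S) * walsh S (restrict u S) (restrict y S))"
    by (simp add: sum_distrib_left)
  also have "\<dots> = ?e * (\<Sum>u\<in>cube S. walsh S u (restrict x S) * walsh S u (restrict y S))"
  proof -
    have "restrict (\<lambda>i\<in>I. if i \<in> S then u i else c i) S = u" if "u \<in> cube S" for u
      using that assms(2) by (auto simp: cube_def PiE_iff extensional_def fun_eq_iff)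
    then show ?thesis by (simp add: sum_subcube [OF assms(2,3)] del: walsh_restrict)
  qed
  also have "\<dots> = 0"
    using walsh_orthogonal [of S "restrict x S" "restrict y S"] assms finite_subset by auto
  finally show ?thesis .
qed

subsection \<open>Operators on a finite basis\<close>

definition inner_on :: "'i set \<Rightarrow> ('i \<Rightarrow> complex) \<Rightarrow> ('i \<Rightarrow> complex) \<Rightarrow> complex" where
  "inner_on B u v = (\<Sum>i\<in>B. cnj (u i) * v i)"

definition conj_transpose :: "('i \<Rightarrow> 'i \<Rightarrow> complex) \<Rightarrow> 'i \<Rightarrow> 'i \<Rightarrow> complex" where
  "conj_transpose A = (\<lambda>i j. cnj (A j i))"

lemma inner_on_self: "inner_on B v v = of_real (norm_sq B v)"
  unfolding inner_on_def norm_sq_def of_real_sum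
  by (intro sum.cong refl) (metis complex_norm_square mult.commute of_real_power)

lemma norm_sq_nonneg [simp]: "0 \<le> norm_sq B v"
  by (simp add: norm_sq_def sum_nonneg)

lemma norm_sq_cong: "(\<And>i. i \<in> B \<Longrightarrow> u i = v i) \<Longrightarrow> norm_sq B u = norm_sq B v"
  by (simp add: norm_sq_def)

lemma inner_on_cong: "(\<And>i. i \<in> B \<Longrightarrow> u i = u' i) \<Longrightarrow> (\<And>i. i \<in> B \<Longrightarrow> v i = v' i) \<Longrightarrow> inner_on B u v = inner_on B u' v'"
  by (simp add: inner_on_def)

lemma apply_op_cong: "(\<And>i. i \<in> B \<Longrightarrow> u i = v i) \<Longrightarrow> apply_op B A u = apply_op B A v"
  by (simp add: apply_op_def fun_eq_iff)

lemma cnj_inner_on: "cnj (inner_on B u v) = inner_on B v u"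
  by (simp add: inner_on_def mult.commute)

lemma inner_on_add_right: "inner_on B u (\<lambda>i. v i + w i) = inner_on B u v + inner_on B u w"
  and inner_on_diff_right: "inner_on B u (\<lambda>i. v i - w i) = inner_on B u v - inner_on B u w"
  and inner_on_scale_right: "inner_on B u (\<lambda>i. c * v i) = c * inner_on B u v"
  and inner_on_add_left: "inner_on B (\<lambda>i. v i + w i) u = inner_on B v u + inner_on B w u"
  and inner_on_diff_left: "inner_on B (\<lambda>i. v i - w i) u = inner_on B v u - inner_on B w u"
  and inner_on_scale_left: "inner_on B (\<lambda>i. c * v i) u = cnj c * inner_on B v u"
  by (simp_all add: inner_on_def sum.distrib sum_subtractf sum_distrib_left algebra_simps)

lemma apply_op_add: "apply_op B A (\<lambda>i. u i + v i) = (\<lambda>i. apply_op B A u i + apply_op B A v i)"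
  and apply_op_diff: "apply_op B A (\<lambda>i. u i - v i) = (\<lambda>i. apply_op B A u i - apply_op B A v i)"
  and apply_op_scale: "apply_op B A (\<lambda>i. c * u i) = (\<lambda>i. c * apply_op B A u i)"
  by (simp_all add: apply_op_def fun_eq_iff sum.distrib sum_subtractf sum_distrib_left algebra_simps)

lemma apply_op_sum: "apply_op B A (\<lambda>i. \<Sum>t\<in>S. u t i) = (\<lambda>i. \<Sum>t\<in>S. apply_op B A (u t) i)"
  unfolding apply_op_def fun_eq_iff sum_distrib_left by (intro allI sum.swap)

lemma inner_on_apply_op: "inner_on B (apply_op B A u) v = inner_on B u (apply_op B (conj_transpose A) v)"
proof -
  have "inner_on B (apply_op B A u) v = (\<Sum>i\<in>B. \<Sum>j\<in>B. cnj (A i j) * cnj (u j) * v i)"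
    by (simp add: inner_on_def apply_op_def sum_distrib_right)
  also have "\<dots> = (\<Sum>j\<in>B. \<Sum>i\<in>B. cnj (A i j) * cnj (u j) * v i)"
    by (rule sum.swap)
  also have "\<dots> = inner_on B u (apply_op B (conj_transpose A) v)"
    by (simp add: inner_on_def apply_op_def conj_transpose_def sum_distrib_left mult_ac)
  finally show ?thesis .
qed

lemma apply_op_compose:
  "apply_op B A (apply_op B A' v) i = apply_op B (\<lambda>i j. \<Sum>k\<in>B. A i k * A' k j) v i"
proof -
  have "apply_op B A (apply_op B A' v) i = (\<Sum>k\<in>B. \<Sum>j\<in>B. A i k * A' k j * v j)"
    by (simp add: apply_op_def sum_distrib_left mult_ac)
  also have "\<dots> = (\<Sum>j\<in>B. \<Sum>k\<in>B. A i k * A' k j * v j)"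
    by (rule sum.swap)
  finally show ?thesis
    by (simp add: apply_op_def sum_distrib_right)
qed

lemma apply_op_identity:
  assumes "finite B" "\<And>i j. i \<in> B \<Longrightarrow> j \<in> B \<Longrightarrow> A i j = of_bool (i = j)" "i \<in> B"
  shows "apply_op B A v i = v i"
proof -
  have "apply_op B A v i = (\<Sum>j\<in>B. if j = i then v j else 0)"
    unfolding apply_op_def by (intro sum.cong) (use assms in auto)
  then show ?thesis using assms(1,3) by simp
qed

lemma norm_sq_unitary:
  assumes "finite B" "unitary_on B U"
  shows "norm_sq B (apply_op B U v) = norm_sq B v"
proof -
  have "apply_op B (conj_transpose U) (apply_op B U v) i = v i" if "i \<in> B" for i
    unfolding apply_op_compose
    by (rule apply_op_identity) (use assms that in \<open>auto simp: unitary_on_def conj_transpose_def\<close>)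
  then have "inner_on B (apply_op B U v) (apply_op B U v) = inner_on B v v"
    unfolding inner_on_apply_op by (intro inner_on_cong) auto
  then show ?thesis by (simp add: inner_on_self)
qed

definition projection_on :: "'i set \<Rightarrow> ('i \<Rightarrow> 'i \<Rightarrow> complex) \<Rightarrow> bool" where
  "projection_on B P \<longleftrightarrow> (\<forall>i\<in>B. \<forall>j\<in>B. P i j = cnj (P j i) \<and> (\<Sum>k\<in>B. P i k * P k j) = P i j)"

lemma projection_onD:
  assumes "projection_on B P" "i \<in> B" "j \<in> B"
  shows "P i j = cnj (P j i)" "(\<Sum>k\<in>B. P i k * P k j) = P i j"
  using assms unfolding projection_on_def by blast+

lemma projection_selfadjoint:
  assumes "projection_on B P"
  shows "inner_on B (apply_op B P u) v = inner_on B u (apply_op B P v)"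
proof -
  have "conj_transpose P i j = P i j" if "i \<in> B" "j \<in> B" for i j
    unfolding conj_transpose_def using assms that unfolding projection_on_def by metis
  then have "apply_op B (conj_transpose P) v i = apply_op B P v i" if "i \<in> B" for i
    unfolding apply_op_def using that by (intro sum.cong) auto
  then show ?thesis unfolding inner_on_apply_op by (intro inner_on_cong) auto
qed

lemma projection_idem:
  assumes "projection_on B P" "i \<in> B"
  shows "apply_op B P (apply_op B P v) i = apply_op B P v i"
proof -
  have "(\<Sum>k\<in>B. P i k * P k j) = P i j" if "j \<in> B" for j
    using assms that unfolding projection_on_def by blast
  then show ?thesis
    unfolding apply_op_compose by (simp add: apply_op_def)
qed

lemma projection_orthogonal:
  assumes "projection_on B P"
  shows "inner_on B (apply_op B P u) (\<lambda>i. v i - apply_op B P v i) = 0"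
proof -
  have "apply_op B P (\<lambda>i. v i - apply_op B P v i) i = 0" if "i \<in> B" for i
    using projection_idem [OF assms that] by (simp add: apply_op_diff)
  then show ?thesis
    unfolding projection_selfadjoint [OF assms] by (simp add: inner_on_def)
qed

lemma projection_pythagoras:
  assumes "projection_on B P"
  shows "norm_sq B v = norm_sq B (apply_op B P v) + norm_sq B (\<lambda>i. v i - apply_op B P v i)"
proof -
  let ?p = "apply_op B P v" and ?r = "\<lambda>i. v i - apply_op B P v i"
  have "inner_on B (\<lambda>i. ?p i + ?r i) (\<lambda>i. ?p i + ?r i) = inner_on B ?p ?p + inner_on B ?r ?r"
    using projection_orthogonal [OF assms, of v v] cnj_inner_on [of B ?p ?r]
    by (simp only: inner_on_add_left inner_on_add_right) simp
  then have "complex_of_real (norm_sq B v) = of_real (norm_sq B ?p + norm_sq B ?r)"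
    by (simp add: inner_on_self)
  then show ?thesis by (simp only: of_real_eq_iff)
qed

lemma measurement_projection:
  assumes "measurement_on B E P" "e \<in> E"
  shows "projection_on B (P e)"
  unfolding projection_on_def
proof (intro ballI conjI)
  fix i j assume "i \<in> B" "j \<in> B"
  then show "P e i j = cnj (P e j i)" "(\<Sum>k\<in>B. P e i k * P e k j) = P e i j"
    using assms unfolding measurement_on_def by (blast, metis)
qed

lemma norm_sq_scale: "norm_sq B (\<lambda>i. c * v i) = (cmod c)\<^sup>2 * norm_sq B v"
  by (simp add: norm_sq_def norm_mult power_mult_distrib sum_distrib_left)

section \<open>The query as a permutation of a finite basis\<close>

lemma finite_qspace [simp]:
  assumes "finite I" "Q \<subseteq> Pow I"
  shows "finite (qspace Q d)"
proof -
  have "finite S" if "S \<in> Q" for S using assms that finite_subset by blast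
  moreover have "finite Q" using assms finite_subset by blast
  ultimately show ?thesis by (simp add: qspace_def finite_SigmaI)
qed

lemma query_map_in:
  assumes "i \<in> qspace Q d"
  shows "query_map x i \<in> qspace Q d"
proof -
  obtain S b a w where "i = ((S, b), a, w)" by (metis prod.collapse)
  with assms show ?thesis by (auto simp: qspace_def)
qed

lemma query_map_idem:
  assumes "i \<in> qspace Q d"
  shows "query_map x (query_map x i) = i"
proof -
  obtain S b a w where "i = ((S, b), a, w)" by (metis prod.collapse)
  with assms show ?thesis by (auto simp: qspace_def)
qed

text \<open>A query permutes the basis by an involution, so its matrix acts by precomposition with
  the same map.\<close>

lemma apply_query_op:
  assumes "finite (qspace Q d)" "i \<in> qspace Q d"
  shows "apply_op (qspace Q d) (query_op x) v i = v (query_map x i)"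
proof -
  have "apply_op (qspace Q d) (query_op x) v i = (\<Sum>j\<in>qspace Q d. if j = query_map x i then v j else 0)"
    unfolding apply_op_def query_op_def
    by (intro sum.cong) (use assms query_map_idem in auto)
  then show ?thesis
    using assms query_map_in by simp
qed

lemma norm_sq_query:
  assumes "finite (qspace Q d)"
  shows "norm_sq (qspace Q d) (apply_op (qspace Q d) (query_op x) v) = norm_sq (qspace Q d) v"
proof -
  have "bij_betw (query_map x) (qspace Q d) (qspace Q d)"
    by (rule bij_betw_byWitness [where f' = "query_map x"]) (simp_all add: query_map_idem query_map_in image_subset_iff)
  from sum.reindex_bij_betw [OF this, of "\<lambda>i. (cmod (v i))\<^sup>2"] show ?thesis
    by (simp add: norm_sq_def apply_query_op [OF assms] cong: sum.cong)
qed

text \<open>Groups the two values of the answer qubit, because a query mixes amplitudes only within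
  such a pair.\<close>

lemma sum_qspace:
  "(\<Sum>i\<in>qspace Q d. g i) = (\<Sum>q\<in>(SIGMA S:Q. cube S). \<Sum>w<d. g (q, 0, w) + g (q, 1, w))"
proof -
  have "(\<Sum>i\<in>qspace Q d. g i) = (\<Sum>q\<in>(SIGMA S:Q. cube S). \<Sum>a\<in>{0, 1}. \<Sum>w<d. g (q, a, w))"
    unfolding qspace_def by (simp only: sum.cartesian_product case_prod_unfold prod.collapse)
  then show ?thesis
    by (simp add: sum.distrib)
qed

subsection \<open>The adversary lower bound\<close>

text \<open>Left unnormalised, so each use of Parseval costs a factor
  \<open>2 ^ card I\<close>.\<close>

definition fourier :: "nat set \<Rightarrow> ((nat \<Rightarrow> real) \<Rightarrow> complex) \<Rightarrow> (nat \<Rightarrow> real) \<Rightarrow> complex" where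
  "fourier I h u = (\<Sum>x\<in>cube I. of_real (walsh I u x) * h x)"

text \<open>The quadratic form of the symmetrised adversary matrix, written in the basis of
  characters that diagonalises it.\<close>

definition energy :: "((nat \<Rightarrow> real) \<Rightarrow> real) \<Rightarrow> nat set \<Rightarrow> ((nat \<Rightarrow> real) \<Rightarrow> complex) \<Rightarrow> real" where
  "energy f I h = (\<Sum>u\<in>cube I. f u * (cmod (fourier I h u))\<^sup>2)"

lemma fourier_add: "fourier I (\<lambda>x. g x + h x) u = fourier I g u + fourier I h u"
  and fourier_diff: "fourier I (\<lambda>x. g x - h x) u = fourier I g u - fourier I h u"
  by (simp_all add: fourier_def sum.distrib sum_subtractf algebra_simps)

text \<open>Expanding both transforms brings the form back to the inputs. With the cube as
  \<open>U\<close> the kernel is the adversary matrix; a subcube with weight 1 gives the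
  orthogonality used against a query.\<close>

lemma sum_fourier_fourier:
  "(\<Sum>u\<in>U. of_real (f u) * (cnj (fourier I g u) * fourier I h u))
     = (\<Sum>x\<in>cube I. \<Sum>y\<in>cube I. of_real (\<Sum>u\<in>U. f u * (walsh I u x * walsh I u y)) * (cnj (g x) * h y))"
proof -
  have "(\<Sum>u\<in>U. of_real (f u) * (cnj (fourier I g u) * fourier I h u))
     = (\<Sum>u\<in>U. \<Sum>x\<in>cube I. \<Sum>y\<in>cube I. of_real (f u * (walsh I u x * walsh I u y)) * (cnj (g x) * h y))"
    unfolding fourier_def cnj_sum sum_product unfolding sum_distrib_left
    by (intro sum.cong refl) (simp add: mult_ac)
  also have "\<dots> = (\<Sum>x\<in>cube I. \<Sum>u\<in>U. \<Sum>y\<in>cube I. of_real (f u * (walsh I u x * walsh I u y)) * (cnj (g x) * h y))"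
    by (rule sum.swap)
  also have "\<dots> = (\<Sum>x\<in>cube I. \<Sum>y\<in>cube I. \<Sum>u\<in>U. of_real (f u * (walsh I u x * walsh I u y)) * (cnj (g x) * h y))"
    by (intro sum.cong refl sum.swap)
  finally show ?thesis
    by (simp add: sum_distrib_right)
qed

lemma cmod_sq: "of_real ((cmod z)\<^sup>2) = cnj z * z"
  by (metis complex_norm_square mult.commute of_real_power)

lemma energy_eq:
  "of_real (energy f I h) = (\<Sum>u\<in>cube I. of_real (f u) * (cnj (fourier I h u) * fourier I h u))"
  unfolding energy_def of_real_sum of_real_mult cmod_sq by simp

lemma parseval:
  assumes "finite I"
  shows "(\<Sum>u\<in>cube I. (cmod (fourier I h u))\<^sup>2) = 2 ^ card I * (\<Sum>x\<in>cube I. (cmod (h x))\<^sup>2)"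
proof -
  have "complex_of_real (\<Sum>u\<in>cube I. (cmod (fourier I h u))\<^sup>2)
      = (\<Sum>u\<in>cube I. of_real 1 * (cnj (fourier I h u) * fourier I h u))"
    unfolding of_real_sum cmod_sq by simp
  also have "\<dots> = (\<Sum>x\<in>cube I. \<Sum>y\<in>cube I. if y = x then 2 ^ card I * (cnj (h x) * h x) else 0)"
    unfolding sum_fourier_fourier mult_1_left
    by (intro sum.cong refl) (use assms in \<open>auto simp: walsh_orthogonal\<close>)
  also have "\<dots> = (\<Sum>x\<in>cube I. 2 ^ card I * (cnj (h x) * h x))"
    using assms by (intro sum.cong refl) simp
  also have "\<dots> = of_real (2 ^ card I * (\<Sum>x\<in>cube I. (cmod (h x))\<^sup>2))"
    unfolding of_real_mult of_real_sum cmod_sq by (simp add: sum_distrib_left)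
  finally show ?thesis
    by (simp only: of_real_eq_iff)
qed

text \<open>Here \<open>g\<close> lives on the inputs that answer the query with 1 and
  \<open>h\<close> on the others. On the subcube their transforms are orthogonal, so
  \<open>f\<close> may be replaced by its deviation from the mean; as the transform of
  \<open>g\<close> has constant modulus there, Cauchy-Schwarz leaves the standard deviation times
  the two \<open>L2\<close> norms.\<close>

lemma subcube_cross_bound:
  assumes I: "finite I" "S \<subseteq> I" "c \<in> cube (I - S)"
    and var: "sqrt (variance_on (subcube I S c) f) \<le> \<sigma>"
    and g: "\<And>x. x \<in> cube I \<Longrightarrow> restrict x S \<noteq> b \<Longrightarrow> g x = 0"
    and h: "\<And>x. x \<in> cube I \<Longrightarrow> restrict x S = b \<Longrightarrow> h x = 0"
  shows "\<bar>\<Sum>u\<in>subcube I S c. f u * Re (cnj (fourier I g u) * fourier I h u)\<bar>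
    \<le> \<sigma> / 2 * (\<Sum>u\<in>subcube I S c. (cmod (fourier I g u))\<^sup>2 + (cmod (fourier I h u))\<^sup>2)"
proof -
  let ?C = "subcube I S c"
  \<comment> \<open>On the support of \<open>g\<close> the coordinates in \<open>S\<close> are those
    of \<open>b\<close>, so within the subcube \<open>u\<close> enters the transform only through a
    sign.\<close>
  define G where "G = (\<Sum>x\<in>cube I. of_real (walsh (I - S) c x) * g x)"
  have fourier_g: "cmod (fourier I g u) = cmod G" if u: "u \<in> ?C" for u
  proof -
    have "of_real (walsh I u x) * g x = of_real (walsh S u b) * (of_real (walsh (I - S) c x) * g x)" if "x \<in> cube I" for x
    proof (cases "restrict x S = b")
      case True
      have "walsh (I - S) u x = walsh (I - S) c x"
        using u by (auto simp: subcube_def simp flip: walsh_restrict(1) [of _ u])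
      moreover have "walsh S u x = walsh S u b"
        by (simp flip: True)
      ultimately show ?thesis
        by (simp add: walsh_split [OF I(1,2)])
    qed (use g that in auto)
    then have "fourier I g u = of_real (walsh S u b) * G"
      unfolding fourier_def G_def sum_distrib_left by (intro sum.cong refl)
    then show ?thesis by (simp add: norm_mult)
  qed
  have card: "card ?C > 0"
    using card_subcube [OF I] by simp
  define m where "m = (\<Sum>w\<in>?C. f w) / card ?C"
  \<comment> \<open>Each term dies: off the supports one of the two values is 0, and on them
    \<open>x\<close> and \<open>y\<close> differ on \<open>S\<close>.\<close>
  have "(\<Sum>u\<in>?C. of_real 1 * (cnj (fourier I g u) * fourier I h u)) = 0"
    unfolding sum_fourier_fourier mult_1_left
  proof (intro sum.neutral ballI)
    fix x y assume xy: "x \<in> cube I" "y \<in> cube I"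
    consider "restrict x S \<noteq> b" | "restrict y S = b" | "restrict x S \<noteq> restrict y S" by metis
    then show "complex_of_real (\<Sum>u\<in>?C. walsh I u x * walsh I u y) * (cnj (g x) * h y) = 0"
      by cases (use xy g h walsh_orthogonal_subcube [OF I] in auto)
  qed
  then have "Re (\<Sum>u\<in>?C. cnj (fourier I g u) * fourier I h u) = 0"
    by simp
  then have "(\<Sum>u\<in>?C. m * Re (cnj (fourier I g u) * fourier I h u)) = 0"
    unfolding sum_distrib_left [symmetric] Re_sum by simp
  then have "(\<Sum>u\<in>?C. f u * Re (cnj (fourier I g u) * fourier I h u))
      = (\<Sum>u\<in>?C. (f u - m) * Re (cnj (fourier I g u) * fourier I h u))"
    by (simp add: left_diff_distrib sum_subtractf)
  also have "\<bar>\<dots>\<bar> \<le> (\<Sum>u\<in>?C. \<bar>f u - m\<bar> * \<bar>cmod G * cmod (fourier I h u)\<bar>)"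
  proof (intro order_trans [OF sum_abs] sum_mono)
    fix u assume "u \<in> ?C"
    then have "\<bar>Re (cnj (fourier I g u) * fourier I h u)\<bar> \<le> cmod G * cmod (fourier I h u)"
      using abs_Re_le_cmod [of "cnj (fourier I g u) * fourier I h u"] fourier_g by (simp add: norm_mult)
    then show "\<bar>(f u - m) * Re (cnj (fourier I g u) * fourier I h u)\<bar> \<le> \<bar>f u - m\<bar> * \<bar>cmod G * cmod (fourier I h u)\<bar>"
      unfolding abs_mult [of "f u - m"] by (intro mult_left_mono) auto
  qed
  also have "\<dots> \<le> L2_set (\<lambda>u. f u - m) ?C * L2_set (\<lambda>u. cmod G * cmod (fourier I h u)) ?C"
    by (rule L2_set_mult_ineq)
  also have "L2_set (\<lambda>u. f u - m) ?C = sqrt (card ?C) * sqrt (variance_on ?C f)"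
    using card by (simp add: L2_set_def variance_on_def m_def flip: real_sqrt_mult)
  also have "sqrt (card ?C) * sqrt (variance_on ?C f) * L2_set (\<lambda>u. cmod G * cmod (fourier I h u)) ?C
      \<le> sqrt (card ?C) * \<sigma> * L2_set (\<lambda>u. cmod G * cmod (fourier I h u)) ?C"
    using var by (intro mult_right_mono mult_left_mono) auto
  \<comment> \<open>\<open>sqrt (card ?C) * cmod G\<close> is the \<open>L2\<close> norm of the
    transform of \<open>g\<close>, again because its modulus is constant.\<close>
  also have "\<dots> = \<sigma> * (L2_set (\<lambda>u. cmod (fourier I g u)) ?C * L2_set (\<lambda>u. cmod (fourier I h u)) ?C)"
  proof -
    have "L2_set (\<lambda>u. cmod (fourier I g u)) ?C = sqrt (card ?C) * cmod G"
      using fourier_g by (simp add: L2_set_def real_sqrt_mult)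
    then show ?thesis
      by (simp flip: L2_set_right_distrib)
  qed
  also have "\<dots> \<le> \<sigma> * (((L2_set (\<lambda>u. cmod (fourier I g u)) ?C)\<^sup>2 + (L2_set (\<lambda>u. cmod (fourier I h u)) ?C)\<^sup>2) / 2)"
  proof (rule mult_left_mono)
    show "0 \<le> \<sigma>" using var by (rule order_trans [rotated]) (simp add: variance_on_def sum_nonneg)
    show "L2_set (\<lambda>u. cmod (fourier I g u)) ?C * L2_set (\<lambda>u. cmod (fourier I h u)) ?C
        \<le> ((L2_set (\<lambda>u. cmod (fourier I g u)) ?C)\<^sup>2 + (L2_set (\<lambda>u. cmod (fourier I h u)) ?C)\<^sup>2) / 2"
      using sum_squares_bound [of "L2_set (\<lambda>u. cmod (fourier I g u)) ?C" "L2_set (\<lambda>u. cmod (fourier I h u)) ?C"] by simp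
  qed
  also have "\<dots> = \<sigma> / 2 * (\<Sum>u\<in>?C. (cmod (fourier I g u))\<^sup>2 + (cmod (fourier I h u))\<^sup>2)"
    by (simp add: L2_set_def sum_nonneg sum.distrib)
  finally show ?thesis .
qed

text \<open>The subcubes of direction \<open>S\<close> tile the cube, so the local bounds add up;
  Parseval and the disjoint supports of \<open>g1\<close> and \<open>g0\<close> give back the full
  mass of \<open>g\<close>.\<close>

lemma query_cross_bound:
  fixes b :: "nat \<Rightarrow> real" and g :: "(nat \<Rightarrow> real) \<Rightarrow> complex"
  assumes I: "finite I" "S \<subseteq> I"
    and var: "\<And>c. c \<in> cube (I - S) \<Longrightarrow> sqrt (variance_on (subcube I S c) f) \<le> \<sigma>"
  defines "g1 \<equiv> \<lambda>x. if restrict x S = b then g x else 0"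
    and "g0 \<equiv> \<lambda>x. if restrict x S = b then 0 else g x"
  shows "\<bar>\<Sum>u\<in>cube I. f u * Re (cnj (fourier I g1 u) * fourier I g0 u)\<bar>
    \<le> \<sigma> / 2 * (2 ^ card I * (\<Sum>x\<in>cube I. (cmod (g x))\<^sup>2))"
proof -
  have "\<bar>\<Sum>u\<in>cube I. f u * Re (cnj (fourier I g1 u) * fourier I g0 u)\<bar>
     \<le> (\<Sum>c\<in>cube (I - S). \<bar>\<Sum>u\<in>subcube I S c. f u * Re (cnj (fourier I g1 u) * fourier I g0 u)\<bar>)"
    unfolding sum_cube_split [OF I, symmetric] by (rule sum_abs)
  also have "\<dots> \<le> (\<Sum>c\<in>cube (I - S). \<sigma> / 2 * (\<Sum>u\<in>subcube I S c. (cmod (fourier I g1 u))\<^sup>2 + (cmod (fourier I g0 u))\<^sup>2))"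
    by (intro sum_mono subcube_cross_bound [where b = b] I var) (auto simp: g1_def g0_def)
  also have "\<dots> = \<sigma> / 2 * (\<Sum>u\<in>cube I. (cmod (fourier I g1 u))\<^sup>2 + (cmod (fourier I g0 u))\<^sup>2)"
    unfolding sum_distrib_left [symmetric] sum_cube_split [OF I] ..
  also have "\<dots> = \<sigma> / 2 * (2 ^ card I * (\<Sum>x\<in>cube I. (cmod (g1 x))\<^sup>2 + (cmod (g0 x))\<^sup>2))"
    using parseval [OF I(1)] by (simp add: sum.distrib algebra_simps)
  also have "(\<Sum>x\<in>cube I. (cmod (g1 x))\<^sup>2 + (cmod (g0 x))\<^sup>2) = (\<Sum>x\<in>cube I. (cmod (g x))\<^sup>2)"
    by (intro sum.cong) (auto simp: g1_def g0_def)
  finally show ?thesis .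
qed

section \<open>The effect of one query on the energy\<close>

lemma parallelogram_cmod: "(cmod (a + b))\<^sup>2 + (cmod (a - b))\<^sup>2 = 2 * ((cmod a)\<^sup>2 + (cmod b)\<^sup>2)"
  unfolding cmod_power2 by (simp add: power2_eq_square algebra_simps)

lemma energy_parallelogram:
  "energy f I (\<lambda>x. g x + h x) + energy f I (\<lambda>x. g x - h x) = 2 * (energy f I g + energy f I h)"
  unfolding energy_def fourier_add fourier_diff sum.distrib [symmetric] distrib_left [symmetric] parallelogram_cmod
    sum_distrib_left by (simp add: mult_ac)

text \<open>\<open>g\<close> and \<open>h\<close> are the amplitudes of the two answer values,
  swapped by the query where \<open>x\<close> restricts to \<open>b\<close>. Their sum is unchanged
  and their difference changes sign only on those inputs, so by the parallelogram law the energy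
  moves by a cross term between the two parts of the difference.\<close>

lemma energy_query_step:
  assumes I: "finite I" "S \<subseteq> I"
    and var: "\<And>c. c \<in> cube (I - S) \<Longrightarrow> sqrt (variance_on (subcube I S c) f) \<le> \<sigma>"
    and "0 \<le> \<sigma>"
  shows "\<bar>energy f I (\<lambda>x. if restrict x S = b then h x else g x) + energy f I (\<lambda>x. if restrict x S = b then g x else h x)
     - (energy f I g + energy f I h)\<bar> \<le> 2 * \<sigma> * 2 ^ card I * (\<Sum>x\<in>cube I. (cmod (g x))\<^sup>2 + (cmod (h x))\<^sup>2)"
    (is "\<bar>energy f I ?g' + energy f I ?h' - _\<bar> \<le> _")
proof -
  define d where "d x = g x - h x" for x
  define d1 where "d1 = (\<lambda>x. if restrict x S = b then d x else 0)"
  define d0 where "d0 = (\<lambda>x. if restrict x S = b then 0 else d x)"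
  have sum_eq: "(\<lambda>x. ?g' x + ?h' x) = (\<lambda>x. g x + h x)"
    by (auto simp: add.commute)
  have diff': "(\<lambda>x. ?g' x - ?h' x) = (\<lambda>x. d0 x - d1 x)" and diff: "(\<lambda>x. g x - h x) = (\<lambda>x. d0 x + d1 x)"
    by (auto simp: d0_def d1_def d_def)
  have re: "(cmod (a - b))\<^sup>2 - (cmod (a + b))\<^sup>2 = -4 * Re (cnj b * a)" for a b
    unfolding cmod_power2 by (simp add: power2_eq_square algebra_simps)
  have "energy f I ?g' + energy f I ?h' - (energy f I g + energy f I h)
      = (energy f I (\<lambda>x. d0 x - d1 x) - energy f I (\<lambda>x. d0 x + d1 x)) / 2"
    using energy_parallelogram [of f I ?g' ?h'] energy_parallelogram [of f I g h]
    unfolding sum_eq diff diff' by (simp add: field_simps)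
  also have "energy f I (\<lambda>x. d0 x - d1 x) - energy f I (\<lambda>x. d0 x + d1 x)
      = -4 * (\<Sum>u\<in>cube I. f u * Re (cnj (fourier I d1 u) * fourier I d0 u))"
    unfolding energy_def fourier_add fourier_diff sum_subtractf [symmetric] right_diff_distrib [symmetric] re sum_distrib_left
    by (simp add: mult_ac)
  finally have "\<bar>energy f I ?g' + energy f I ?h' - (energy f I g + energy f I h)\<bar>
      = \<bar>-4 * (\<Sum>u\<in>cube I. f u * Re (cnj (fourier I d1 u) * fourier I d0 u)) / 2\<bar>"
    by (rule arg_cong)
  also have "\<dots> = 2 * \<bar>\<Sum>u\<in>cube I. f u * Re (cnj (fourier I d1 u) * fourier I d0 u)\<bar>"
    by (simp add: abs_mult)
  also have "\<dots> \<le> 2 * (\<sigma> / 2 * (2 ^ card I * (\<Sum>x\<in>cube I. (cmod (d x))\<^sup>2)))"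
    unfolding d1_def d0_def using query_cross_bound [OF I var, where g = d and b = b] by simp
  also have "\<dots> = \<sigma> * 2 ^ card I * (\<Sum>x\<in>cube I. (cmod (d x))\<^sup>2)"
    by simp
  also have "\<dots> \<le> \<sigma> * 2 ^ card I * (\<Sum>x\<in>cube I. 2 * ((cmod (g x))\<^sup>2 + (cmod (h x))\<^sup>2))"
  proof (intro mult_left_mono sum_mono)
    show "(cmod (d x))\<^sup>2 \<le> 2 * ((cmod (g x))\<^sup>2 + (cmod (h x))\<^sup>2)" for x
      using parallelogram_cmod [of "g x" "h x"] zero_le_power2 [of "cmod (g x + h x)"]
      unfolding d_def by linarith
  qed (use \<open>0 \<le> \<sigma>\<close> in simp)
  also have "\<dots> = 2 * \<sigma> * 2 ^ card I * (\<Sum>x\<in>cube I. (cmod (g x))\<^sup>2 + (cmod (h x))\<^sup>2)"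
    by (simp only: sum_distrib_left [symmetric] mult_ac)
  finally show ?thesis .
qed

text \<open>Negating \<open>u\<close> flips \<open>f\<close> and, for inputs of equal parity, keeps
  the product of the characters. Hence the adversary matrix couples only inputs of opposite
  parity.\<close>

lemma sum_walsh_walsh_odd:
  assumes "odd_on_cube n f" "x \<in> cube {1..n}" "y \<in> cube {1..n}" "parity n x = parity n y"
  shows "(\<Sum>u\<in>cube {1..n}. f u * (walsh {1..n} u x * walsh {1..n} u y)) = 0"
proof -
  let ?m = "\<lambda>u. \<lambda>i\<in>{1..n}. - u i :: real"
  let ?F = "\<lambda>u. f u * (walsh {1..n} u x * walsh {1..n} u y)"
  have mm: "?m (?m u) = u" if "u \<in> cube {1..n}" for u
    by (rule cube_eqI [OF uminus_cube [OF uminus_cube [OF that]] that]) simp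
  have "bij_betw ?m (cube {1..n}) (cube {1..n})"
    by (rule bij_betw_byWitness [where f' = ?m]) (use mm in \<open>auto simp del: restrict_apply\<close>)
  from sum.reindex_bij_betw [OF this, of ?F]
  have "(\<Sum>u\<in>cube {1..n}. ?F (?m u)) = (\<Sum>u\<in>cube {1..n}. ?F u)" .
  moreover have "?F (?m u) = - ?F u" if "u \<in> cube {1..n}" for u
  proof -
    have "f (?m u) = - f u"
      using assms(1) that unfolding odd_on_cube_def by blast
    then show ?thesis
      unfolding walsh_uminus [OF that assms(2)] walsh_uminus [OF that assms(3)]
      using assms(4) parity_values [OF assms(3)] by auto
  qed
  ultimately show ?thesis
    by (simp add: sum_negf)
qed

text \<open>The unnormalised expectation of \<open>f\<close> in the dual variable when the input
  register is in superposition; the algorithm's own basis \<open>B\<close> is a spectator.\<close>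

definition total_energy :: "((nat \<Rightarrow> real) \<Rightarrow> real) \<Rightarrow> nat set \<Rightarrow> 'i set \<Rightarrow> ((nat \<Rightarrow> real) \<Rightarrow> 'i \<Rightarrow> complex) \<Rightarrow> real" where
  "total_energy f I B \<psi> = (\<Sum>i\<in>B. energy f I (\<lambda>x. \<psi> x i))"

lemma total_energy_swap:
  "total_energy f I B \<psi> = (\<Sum>u\<in>cube I. f u * norm_sq B (\<lambda>i. fourier I (\<lambda>x. \<psi> x i) u))"
  unfolding total_energy_def energy_def norm_sq_def sum_distrib_left by (rule sum.swap)

text \<open>A unitary that does not depend on \<open>x\<close> commutes with the transform in
  \<open>x\<close>, so it only rotates the vector attached to each \<open>u\<close>.\<close>

lemma total_energy_unitary:
  assumes "finite B" "unitary_on B U"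
  shows "total_energy f I B (\<lambda>x. apply_op B U (\<psi> x)) = total_energy f I B \<psi>"
proof -
  have "fourier I (\<lambda>x. apply_op B U (\<psi> x) i) u = apply_op B U (\<lambda>j. fourier I (\<lambda>x. \<psi> x j) u) i" for u i
    unfolding fourier_def apply_op_sum by (simp add: apply_op_scale)
  then show ?thesis
    by (simp add: total_energy_swap norm_sq_unitary [OF assms])
qed

text \<open>The one-query estimate is summed over the pairs of answer values. The mass is one per
  input, hence \<open>2 ^ card I\<close> in all; the second such factor comes from Parseval.\<close>

lemma total_energy_query:
  assumes I: "finite I" "Q \<subseteq> Pow I"
    and var: "\<And>S c. S \<in> Q \<Longrightarrow> c \<in> cube (I - S) \<Longrightarrow> sqrt (variance_on (subcube I S c) f) \<le> \<sigma>"
    and "0 \<le> \<sigma>"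
    and norm: "\<And>x. x \<in> cube I \<Longrightarrow> norm_sq (qspace Q d) (\<psi> x) = 1"
  shows "\<bar>total_energy f I (qspace Q d) (\<lambda>x i. \<psi> x (query_map x i)) - total_energy f I (qspace Q d) \<psi>\<bar>
     \<le> 2 * \<sigma> * (2 ^ card I)\<^sup>2"
proof -
  let ?R = "SIGMA S:Q. cube S" and ?N = "2 ^ card I :: real"
  let ?e = "\<lambda>q a w. energy f I (\<lambda>x. \<psi> x (query_map x (q, a, w)))"
  let ?g = "\<lambda>q a w. energy f I (\<lambda>x. \<psi> x (q, a, w))"
  let ?n = "\<lambda>q a w x. (cmod (\<psi> x (q, a, w)))\<^sup>2"
  have step: "\<bar>(?e q 0 w + ?e q 1 w) - (?g q 0 w + ?g q 1 w)\<bar>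
      \<le> 2 * \<sigma> * ?N * (\<Sum>x\<in>cube I. ?n q 0 w x + ?n q 1 w x)" if q: "q \<in> ?R" for q w
  proof -
    obtain S b where Sb: "q = (S, b)" by (cases q)
    have S: "S \<in> Q" "S \<subseteq> I" using q Sb I(2) by auto
    have "(\<lambda>x. \<psi> x (query_map x (q, 0, w))) = (\<lambda>x. if restrict x S = b then \<psi> x (q, 1, w) else \<psi> x (q, 0, w))"
      "(\<lambda>x. \<psi> x (query_map x (q, 1, w))) = (\<lambda>x. if restrict x S = b then \<psi> x (q, 0, w) else \<psi> x (q, 1, w))"
      by (auto simp: fun_eq_iff Sb)
    then show ?thesis
      using energy_query_step [OF I(1) S(2) var [OF S(1)] \<open>0 \<le> \<sigma>\<close>, of b "\<lambda>x. \<psi> x (q, 1, w)" "\<lambda>x. \<psi> x (q, 0, w)"]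
      by (simp only:)
  qed
  have "\<bar>total_energy f I (qspace Q d) (\<lambda>x i. \<psi> x (query_map x i)) - total_energy f I (qspace Q d) \<psi>\<bar>
      = \<bar>\<Sum>q\<in>?R. \<Sum>w<d. (?e q 0 w + ?e q 1 w) - (?g q 0 w + ?g q 1 w)\<bar>"
    unfolding total_energy_def sum_qspace sum_subtractf ..
  also have "\<dots> \<le> (\<Sum>q\<in>?R. \<Sum>w<d. 2 * \<sigma> * ?N * (\<Sum>x\<in>cube I. ?n q 0 w x + ?n q 1 w x))"
    by (intro order_trans [OF sum_abs] sum_mono order_trans [OF sum_abs] step)
  also have "\<dots> = 2 * \<sigma> * ?N * (\<Sum>q\<in>?R. \<Sum>w<d. \<Sum>x\<in>cube I. ?n q 0 w x + ?n q 1 w x)"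
    unfolding sum_distrib_left ..
  also have "(\<Sum>q\<in>?R. \<Sum>w<d. \<Sum>x\<in>cube I. ?n q 0 w x + ?n q 1 w x)
      = (\<Sum>q\<in>?R. \<Sum>x\<in>cube I. \<Sum>w<d. ?n q 0 w x + ?n q 1 w x)"
    by (intro sum.cong refl sum.swap)
  also have "\<dots> = (\<Sum>x\<in>cube I. \<Sum>q\<in>?R. \<Sum>w<d. ?n q 0 w x + ?n q 1 w x)"
    by (rule sum.swap)
  also have "\<dots> = (\<Sum>x\<in>cube I. norm_sq (qspace Q d) (\<psi> x))"
    unfolding norm_sq_def sum_qspace ..
  also have "\<dots> = ?N"
    using norm card_cube [OF I(1)] by simp
  finally show ?thesis
    by (simp add: power2_eq_square mult.assoc)
qed

lemma total_parseval:
  assumes "finite I"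
  shows "(\<Sum>i\<in>B. \<Sum>u\<in>cube I. (cmod (fourier I (\<lambda>x. \<psi> x i) u))\<^sup>2) = 2 ^ card I * (\<Sum>x\<in>cube I. norm_sq B (\<psi> x))"
  unfolding parseval [OF assms] sum_distrib_left [symmetric] norm_sq_def by (simp only: sum.swap [of _ B])

text \<open>The kernel vanishes on pairs of equal parity by oddness, the inner product on the
  remaining pairs by assumption.\<close>

lemma total_energy_orthogonal:
  assumes "odd_on_cube n f"
    and "\<And>x y. x \<in> cube {1..n} \<Longrightarrow> y \<in> cube {1..n} \<Longrightarrow> parity n x \<noteq> parity n y \<Longrightarrow> inner_on B (\<psi> x) (\<psi> y) = 0"
  shows "total_energy f {1..n} B \<psi> = 0"
proof -
  let ?I = "{1..n}"
  let ?k = "\<lambda>x y. complex_of_real (\<Sum>u\<in>cube ?I. f u * (walsh ?I u x * walsh ?I u y))"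
  have "complex_of_real (total_energy f ?I B \<psi>)
      = (\<Sum>i\<in>B. \<Sum>x\<in>cube ?I. \<Sum>y\<in>cube ?I. ?k x y * (cnj (\<psi> x i) * \<psi> y i))"
    unfolding total_energy_def of_real_sum energy_eq sum_fourier_fourier ..
  also have "\<dots> = (\<Sum>x\<in>cube ?I. \<Sum>i\<in>B. \<Sum>y\<in>cube ?I. ?k x y * (cnj (\<psi> x i) * \<psi> y i))"
    by (rule sum.swap)
  also have "\<dots> = (\<Sum>x\<in>cube ?I. \<Sum>y\<in>cube ?I. \<Sum>i\<in>B. ?k x y * (cnj (\<psi> x i) * \<psi> y i))"
    by (intro sum.cong refl sum.swap)
  also have "\<dots> = (\<Sum>x\<in>cube ?I. \<Sum>y\<in>cube ?I. ?k x y * inner_on B (\<psi> x) (\<psi> y))"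
    by (simp only: sum_distrib_left inner_on_def)
  also have "\<dots> = 0"
  proof (intro sum.neutral ballI)
    fix x y assume "x \<in> cube ?I" "y \<in> cube ?I"
    then show "?k x y * inner_on B (\<psi> x) (\<psi> y) = 0"
      using assms(2) sum_walsh_walsh_odd [OF assms(1), of x y] by (cases "parity n x = parity n y") simp_all
  qed
  finally show ?thesis by (simp only: of_real_eq_0_iff)
qed

text \<open>\<open>p\<close> is the correct part of the final state and \<open>r\<close> the wrong
  part. Each alone has energy zero, so only their cross term remains, and it stays a fixed factor
  below the maximum.\<close>

lemma total_energy_final:
  assumes f: "odd_on_cube n f" "\<And>u. u \<in> cube {1..n} \<Longrightarrow> \<bar>f u\<bar> \<le> M"
    and p: "\<And>x y. x \<in> cube {1..n} \<Longrightarrow> y \<in> cube {1..n} \<Longrightarrow> parity n x \<noteq> parity n y \<Longrightarrow> inner_on B (p x) (p y) = 0"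
    and r: "\<And>x y. x \<in> cube {1..n} \<Longrightarrow> y \<in> cube {1..n} \<Longrightarrow> parity n x \<noteq> parity n y \<Longrightarrow> inner_on B (r x) (r y) = 0"
    and norm: "\<And>x. x \<in> cube {1..n} \<Longrightarrow> norm_sq B (p x) + norm_sq B (r x) = 1"
    and success: "\<And>x. x \<in> cube {1..n} \<Longrightarrow> norm_sq B (p x) \<ge> 2 / 3"
  shows "\<bar>total_energy f {1..n} B (\<lambda>x i. p x i + r x i)\<bar> \<le> 17 / 18 * M * (2 ^ n)\<^sup>2"
proof -
  let ?I = "{1..n}"
  let ?p = "\<lambda>i. fourier ?I (\<lambda>x. p x i)" and ?r = "\<lambda>i. fourier ?I (\<lambda>x. r x i)"
  have M: "0 \<le> M"
    using f(2) [OF one_cube] by linarith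
  have split: "(cmod (a + b))\<^sup>2 = (cmod a)\<^sup>2 + (cmod b)\<^sup>2 + 2 * Re (cnj a * b)" for a b
    unfolding cmod_power2 by (simp add: power2_eq_square algebra_simps)
  \<comment> \<open>With success probability at least \<open>2/3\<close>, plain AM-GM would only give the constant \<open>1\<close>.\<close>
  have amgm: "\<bar>2 * Re (cnj a * b)\<bar> \<le> 2 / 3 * (cmod a)\<^sup>2 + 3 / 2 * (cmod b)\<^sup>2" for a b
  proof -
    have "\<bar>2 * Re (cnj a * b)\<bar> \<le> 2 * (cmod a * cmod b)"
      using abs_Re_le_cmod [of "cnj a * b"] by (simp add: norm_mult)
    moreover have "0 \<le> (2 / 3) * (cmod a - 3 / 2 * cmod b)\<^sup>2" by simp
    ultimately show ?thesis by (simp add: power2_eq_square algebra_simps)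
  qed
  have "total_energy f ?I B (\<lambda>x i. p x i + r x i) = total_energy f ?I B p + total_energy f ?I B r
      + (\<Sum>i\<in>B. \<Sum>u\<in>cube ?I. f u * (2 * Re (cnj (?p i u) * ?r i u)))"
    unfolding total_energy_def energy_def fourier_add split distrib_left sum.distrib ..
  also have "\<dots> = (\<Sum>i\<in>B. \<Sum>u\<in>cube ?I. f u * (2 * Re (cnj (?p i u) * ?r i u)))"
    using total_energy_orthogonal [OF f(1) p] total_energy_orthogonal [OF f(1) r] by simp
  also have "\<bar>\<dots>\<bar> \<le> (\<Sum>i\<in>B. \<Sum>u\<in>cube ?I. M * (2 / 3 * (cmod (?p i u))\<^sup>2 + 3 / 2 * (cmod (?r i u))\<^sup>2))"
  proof (intro order_trans [OF sum_abs] sum_mono)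
    show "\<bar>f u * (2 * Re (cnj (?p i u) * ?r i u))\<bar> \<le> M * (2 / 3 * (cmod (?p i u))\<^sup>2 + 3 / 2 * (cmod (?r i u))\<^sup>2)"
      if "u \<in> cube ?I" for i u
      unfolding abs_mult [of "f u"] using f(2) [OF that] M amgm by (intro mult_mono) auto
  qed
  also have "\<dots> = M * (2 / 3 * (\<Sum>i\<in>B. \<Sum>u\<in>cube ?I. (cmod (?p i u))\<^sup>2) + 3 / 2 * (\<Sum>i\<in>B. \<Sum>u\<in>cube ?I. (cmod (?r i u))\<^sup>2))"
    unfolding sum_distrib_left sum.distrib distrib_left ..
  also have "\<dots> = M * 2 ^ n * (\<Sum>x\<in>cube ?I. 2 / 3 * norm_sq B (p x) + 3 / 2 * norm_sq B (r x))"
    unfolding total_parseval [OF finite_atLeastAtMost]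
    by (simp add: sum.distrib sum_distrib_left algebra_simps)
  \<comment> \<open>The summand is 3/2 minus 5/6 of the mass of \<open>p x\<close>, and that mass is
    at least 2/3: 3/2 - 5/9 = 17/18.\<close>
  also have "\<dots> \<le> M * 2 ^ n * (\<Sum>x\<in>cube ?I. 17 / 18)"
  proof (intro mult_left_mono sum_mono)
    show "2 / 3 * norm_sq B (p x) + 3 / 2 * norm_sq B (r x) \<le> 17 / 18" if "x \<in> cube ?I" for x
      using norm [OF that] success [OF that] by linarith
  qed (use M in simp)
  also have "\<dots> = 17 / 18 * M * (2 ^ n)\<^sup>2"
    by (simp add: card_cube power2_eq_square)
  finally show ?thesis .
qed

section \<open>Comparing the start and the end of a run\<close>

lemma norm_sq_query_state:
  assumes "finite (qspace Q d)" "norm_sq (qspace Q d) \<psi>0 = 1" "\<And>t. t \<le> T \<Longrightarrow> unitary_on (qspace Q d) (U t)"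
  shows "t \<le> T \<Longrightarrow> norm_sq (qspace Q d) (query_state (qspace Q d) \<psi>0 U x t) = 1"
  by (induction t) (simp_all add: assms norm_sq_unitary norm_sq_query)

lemma measurement_orthogonal:
  assumes "measurement_on B E P" "e \<in> E" "e' \<in> E" "e \<noteq> e'" "i \<in> B"
  shows "apply_op B (P e) (apply_op B (P e') v) i = 0"
proof -
  have "(\<Sum>k\<in>B. P e i k * P e' k j) = 0" if "j \<in> B" for j
    using assms that unfolding measurement_on_def by metis
  then show ?thesis
    unfolding apply_op_compose by (simp add: apply_op_def)
qed

text \<open>Projecting on \<open>e\<close> annihilates the \<open>e'\<close> part. A measurement
  with any number of outcomes can thus be read as a test of \<open>e'\<close> against the
  rest.\<close>

lemma norm_sq_other_outcomes:
  assumes "measurement_on B E P" "e \<in> E" "e' \<in> E" "e \<noteq> e'"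
  shows "norm_sq B (apply_op B (P e) v) \<le> norm_sq B (\<lambda>i. v i - apply_op B (P e') v i)"
proof -
  let ?r = "\<lambda>i. v i - apply_op B (P e') v i"
  have "norm_sq B (apply_op B (P e) v) = norm_sq B (apply_op B (P e) ?r)"
    by (intro norm_sq_cong) (simp add: apply_op_diff measurement_orthogonal [OF assms])
  also have "\<dots> \<le> norm_sq B ?r"
    using projection_pythagoras [OF measurement_projection [OF assms(1,2)], of ?r] by simp
  finally show ?thesis .
qed

text \<open>In units of \<open>(2 ^ n)\<^sup>2\<close> the energy starts at \<open>f u0\<close>,
  moves by at most \<open>2 * \<sigma>\<close> per query and ends within 17/18 of
  \<open>\<bar>f u0\<bar>\<close>; the missing 1/18 yields the constant 18 * 2 = 36.\<close>

lemma adversary_bound: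
  assumes Q: "Q \<subseteq> Pow {1..n}" and T: "quantum_computes n Q (parity n) T"
    and f: "odd_on_cube n f" "u0 \<in> cube {1..n}" "\<And>u. u \<in> cube {1..n} \<Longrightarrow> \<bar>f u\<bar> \<le> \<bar>f u0\<bar>"
    and var: "\<And>S c. S \<in> Q \<Longrightarrow> c \<in> cube ({1..n} - S) \<Longrightarrow> sqrt (variance_on (subcube {1..n} S c) f) \<le> \<sigma>"
    and \<sigma>: "0 \<le> \<sigma>"
  shows "\<bar>f u0\<bar> \<le> 36 * real T * \<sigma>"
proof -
  let ?I = "{1..n}" and ?N = "2 ^ n :: real"
  obtain d \<psi>0 U E P where A: "norm_sq (qspace Q d) \<psi>0 = 1" "\<forall>t\<le>T. unitary_on (qspace Q d) (U t)"
      "measurement_on (qspace Q d) E P"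
    and out: "\<And>x. x \<in> cube ?I \<Longrightarrow> parity n x \<in> E \<and>
           norm_sq (qspace Q d) (apply_op (qspace Q d) (P (parity n x)) (query_state (qspace Q d) \<psi>0 U x T)) \<ge> 2 / 3"
    using T unfolding quantum_computes_def Let_def by blast
  define B where "B = qspace Q d"
  have fin: "finite B"
    unfolding B_def by (rule finite_qspace [OF finite_atLeastAtMost Q])
  \<comment> \<open>The sign makes the transform of the common start state a point mass at
    \<open>u0\<close>; for each \<open>x\<close> it is a global phase, invisible to the
    measurement.\<close>
  define \<Psi> where "\<Psi> t x = (\<lambda>i. of_real (walsh ?I u0 x) * query_state B \<psi>0 U x t i)" for t x
  have norm: "norm_sq B (\<Psi> t x) = 1" if "t \<le> T" for t x
    unfolding \<Psi>_def norm_sq_scale using norm_sq_query_state [of Q d \<psi>0 T U t x] fin A that by (simp add: B_def)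
  define \<Phi> where "\<Phi> t = total_energy f ?I B (\<Psi> t)" for t
  have "\<Phi> 0 = f u0 * ?N\<^sup>2"
  proof -
    let ?\<phi> = "apply_op B (U 0) \<psi>0"
    have "norm_sq B (\<lambda>i. fourier ?I (\<lambda>x. \<Psi> 0 x i) u) = (if u = u0 then ?N\<^sup>2 else 0)" if "u \<in> cube ?I" for u
    proof -
      have "fourier ?I (\<lambda>x. \<Psi> 0 x i) u = of_real (if u = u0 then ?N else 0) * ?\<phi> i" for i
      proof -
        have "fourier ?I (\<lambda>x. \<Psi> 0 x i) u = of_real (\<Sum>x\<in>cube ?I. walsh ?I x u * walsh ?I x u0) * ?\<phi> i"
          unfolding fourier_def \<Psi>_def of_real_sum sum_distrib_right
          by (intro sum.cong refl) (simp add: walsh_commute [of _ u] walsh_commute [of _ u0])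
        then show ?thesis
          unfolding walsh_orthogonal [OF finite_atLeastAtMost that f(2)] by simp
      qed
      then show ?thesis
        using norm_sq_unitary [OF fin, of "U 0" \<psi>0] A by (simp add: norm_sq_scale B_def)
    qed
    then have "\<Phi> 0 = (\<Sum>u\<in>cube ?I. if u = u0 then f u * ?N\<^sup>2 else 0)"
      unfolding \<Phi>_def total_energy_swap by (intro sum.cong) auto
    then show ?thesis using f(2) by simp
  qed
  moreover have "\<bar>\<Phi> t - \<Phi> 0\<bar> \<le> real t * (2 * \<sigma> * ?N\<^sup>2)" if "t \<le> T" for t
    using that
  proof (induction t)
    case (Suc t)
    have "\<Psi> (Suc t) x = apply_op B (U (Suc t)) (\<lambda>i. \<Psi> t x (query_map x i))" for x
    proof -
      have "apply_op B (U (Suc t)) (\<lambda>i. \<Psi> t x (query_map x i))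
          = apply_op B (U (Suc t)) (\<lambda>i. of_real (walsh ?I u0 x) * apply_op B (query_op x) (query_state B \<psi>0 U x t) i)"
        unfolding \<Psi>_def B_def by (intro apply_op_cong) (use fin in \<open>simp add: apply_query_op B_def\<close>)
      then show ?thesis
        unfolding apply_op_scale by (simp add: \<Psi>_def)
    qed
    then have \<Psi>_Suc: "\<Psi> (Suc t) = (\<lambda>x. apply_op B (U (Suc t)) (\<lambda>i. \<Psi> t x (query_map x i)))" ..
    have "\<Phi> (Suc t) = total_energy f ?I B (\<lambda>x i. \<Psi> t x (query_map x i))"
      unfolding \<Phi>_def \<Psi>_Suc by (rule total_energy_unitary [OF fin]) (use A(2) Suc.prems in \<open>simp add: B_def\<close>)
    moreover have "\<bar>total_energy f ?I B (\<lambda>x i. \<Psi> t x (query_map x i)) - total_energy f ?I B (\<Psi> t)\<bar>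
        \<le> 2 * \<sigma> * (2 ^ card ?I)\<^sup>2"
      unfolding B_def by (intro total_energy_query Q var \<sigma>) (use norm Suc.prems in \<open>auto simp: B_def\<close>)
    ultimately have "\<bar>\<Phi> (Suc t) - \<Phi> t\<bar> \<le> 2 * \<sigma> * ?N\<^sup>2"
      by (simp add: \<Phi>_def)
    moreover have "\<bar>\<Phi> t - \<Phi> 0\<bar> \<le> real t * (2 * \<sigma> * ?N\<^sup>2)"
      using Suc by simp
    moreover have "real (Suc t) * (2 * \<sigma> * ?N\<^sup>2) = real t * (2 * \<sigma> * ?N\<^sup>2) + 2 * \<sigma> * ?N\<^sup>2"
      by (simp add: algebra_simps)
    ultimately show ?case by linarith
  qed simp
  moreover have "\<bar>\<Phi> T\<bar> \<le> 17 / 18 * \<bar>f u0\<bar> * ?N\<^sup>2"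
  proof -
    have one: "1 \<in> E"
      using out [OF one_cube] by (simp add: parity_def)
    define V where "V x = apply_op B (P 1) (\<Psi> T x)" for x
    define W where "W x = (\<lambda>i. \<Psi> T x i - V x i)" for x
    \<comment> \<open>\<open>V\<close> carries outcome 1 and \<open>W\<close> all other outcomes, so
      \<open>p\<close> contains the correctly answered part, and states of opposite parity are
      orthogonal both within \<open>p\<close> and within \<open>r\<close>.\<close>
    define p where "p x = (if parity n x = 1 then V x else W x)" for x
    define r where "r x = (if parity n x = 1 then W x else V x)" for x
    have M: "measurement_on B E P" using A(3) by (simp add: B_def)
    note proj = measurement_projection [OF M one]
    have VW: "inner_on B (V x) (W y) = 0" "inner_on B (W x) (V y) = 0" for x y
      using projection_orthogonal [OF proj] cnj_inner_on [of B "V y" "W x"] unfolding V_def W_def by auto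
    have VW_norm: "norm_sq B (V x) + norm_sq B (W x) = 1" for x
      using projection_pythagoras [OF proj, of "\<Psi> T x"] norm unfolding V_def W_def by simp
    have "\<Psi> T = (\<lambda>x i. p x i + r x i)"
      by (auto simp: p_def r_def W_def fun_eq_iff)
    then have "\<Phi> T = total_energy f ?I B (\<lambda>x i. p x i + r x i)"
      by (simp add: \<Phi>_def)
    also have "\<bar>\<dots>\<bar> \<le> 17 / 18 * \<bar>f u0\<bar> * ?N\<^sup>2"
    proof (rule total_energy_final [OF f(1,3)])
      fix x assume x: "x \<in> cube ?I"
      show "norm_sq B (p x) + norm_sq B (r x) = 1"
        using VW_norm [of x] by (simp add: p_def r_def)
      have "apply_op B (P (parity n x)) (\<Psi> T x) = (\<lambda>i. of_real (walsh ?I u0 x) * apply_op B (P (parity n x)) (query_state B \<psi>0 U x T) i)"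
        unfolding \<Psi>_def apply_op_scale ..
      then have "norm_sq B (apply_op B (P (parity n x)) (\<Psi> T x)) \<ge> 2 / 3"
        using out [OF x] by (simp add: norm_sq_scale B_def)
      moreover have "norm_sq B (apply_op B (P (parity n x)) (\<Psi> T x)) \<le> norm_sq B (W x)" if "parity n x \<noteq> 1"
        unfolding V_def W_def using out [OF x] by (intro norm_sq_other_outcomes [OF M _ one that]) auto
      ultimately show "norm_sq B (p x) \<ge> 2 / 3"
        by (auto simp: p_def V_def)
    next
      fix x y assume "x \<in> cube ?I" "y \<in> cube ?I" "parity n x \<noteq> parity n y"
      then have "parity n x = 1 \<and> parity n y \<noteq> 1 \<or> parity n x \<noteq> 1 \<and> parity n y = 1"
        using parity_values by metis
      then show "inner_on B (p x) (p y) = 0" "inner_on B (r x) (r y) = 0"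
        using VW by (auto simp: p_def r_def)
    qed
    finally show ?thesis .
  qed
  ultimately have "\<bar>f u0 * ?N\<^sup>2\<bar> \<le> 17 / 18 * \<bar>f u0\<bar> * ?N\<^sup>2 + real T * (2 * \<sigma> * ?N\<^sup>2)"
    by (smt (verit) order_refl)
  then have "?N\<^sup>2 * \<bar>f u0\<bar> \<le> ?N\<^sup>2 * (17 / 18 * \<bar>f u0\<bar> + real T * (2 * \<sigma>))"
    by (simp add: abs_mult algebra_simps)
  then have "\<bar>f u0\<bar> \<le> 17 / 18 * \<bar>f u0\<bar> + real T * (2 * \<sigma>)"
    by (subst (asm) mult_le_cancel_left_pos) simp_all
  then show ?thesis by simp
qed

subsection \<open>Duality\<close>

text \<open>Functions vanishing off \<open>A\<close> stand for vectors of a finite-dimensional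
  space. The set is a product of compact intervals, with the singleton of 0 outside
  \<open>A\<close>.\<close>

lemma compact_finite_support_box:
  assumes "finite A"
  shows "compact {h :: 'a \<Rightarrow> real. (\<forall>a\<in>A. \<bar>h a\<bar> \<le> M) \<and> (\<forall>a. a \<notin> A \<longrightarrow> h a = 0)}"
proof -
  have "compactin (product_topology (\<lambda>a. euclidean) UNIV)
      (\<Pi>\<^sub>E a\<in>UNIV. if a \<in> A then {-M..M} else {0::real})"
    by (simp add: compactin_PiE)
  moreover have "{h :: 'a \<Rightarrow> real. (\<forall>a\<in>A. \<bar>h a\<bar> \<le> M) \<and> (\<forall>a. a \<notin> A \<longrightarrow> h a = 0)}
      = (\<Pi>\<^sub>E a\<in>UNIV. if a \<in> A then {-M..M} else {0})"
    by (auto simp: PiE_iff abs_le_iff split: if_splits) (metis minus_le_iff)+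
  ultimately show ?thesis
    by (simp add: euclidean_product_topology)
qed

text \<open>Minimise the distance from \<open>z\<close> to the sums of families of weight at most
  \<open>L\<close>; let \<open>r\<close> be the residual and \<open>G\<close> its pairing with the
  optimal sum. Optimality, tested on the centred copy of \<open>r\<close> on one \<open>C j\<close>,
  bounds every standard deviation of \<open>r\<close> by \<open>G / L\<close>. Then
  \<open>bound\<close> gives that \<open>r\<close> pairs with \<open>z\<close> to at most
  \<open>G\<close>, and the difference of the two pairings is the squared length of
  \<open>r\<close>.\<close>

lemma variance_duality:
  fixes X :: "'a set" and J :: "'j set" and C :: "'j \<Rightarrow> 'a set" and z :: "'a \<Rightarrow> real" and L :: real
  assumes fin: "finite X" "finite J" and CX: "\<And>j. j \<in> J \<Longrightarrow> C j \<subseteq> X" and L: "L > 0"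
    and ne: "\<And>j. j \<in> J \<Longrightarrow> C j \<noteq> {}"
    and bound: "\<And>f M. 0 \<le> M \<Longrightarrow> (\<And>j. j \<in> J \<Longrightarrow> sqrt (variance_on (C j) f) \<le> M) \<Longrightarrow> (\<Sum>x\<in>X. f x * z x) \<le> L * M"
  shows "\<exists>h. (\<forall>j\<in>J. \<forall>x\<in>X - C j. h j x = 0) \<and> (\<forall>j\<in>J. (\<Sum>x\<in>C j. h j x) = 0) \<and>
     (\<forall>x\<in>X. (\<Sum>j\<in>J. h j x) = z x) \<and> (\<Sum>j\<in>J. sqrt (card (C j)) * L2_set (h j) (C j)) \<le> L"
proof -
  have finC: "finite (C j)" if "j \<in> J" for j
    using CX fin that finite_subset by blast
  have card1: "1 \<le> sqrt (card (C j))" if "j \<in> J" for j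
    using ne [OF that] finC [OF that] by (simp add: Suc_leI card_gt_0_iff)
  define A where "A = Sigma J C"
  \<comment> \<open>On functions of sum zero this weight is dual to the standard deviation, by
    Cauchy-Schwarz.\<close>
  define W where "W h = (\<Sum>j\<in>J. sqrt (card (C j)) * L2_set (\<lambda>x. h (j, x)) (C j))" for h :: "'j \<times> 'a \<Rightarrow> real"
  define D where "D = {h. (\<forall>a. a \<notin> A \<longrightarrow> h a = 0) \<and> (\<forall>j\<in>J. (\<Sum>x\<in>C j. h (j, x)) = 0) \<and> W h \<le> L}"
  let ?B = "{h :: 'j \<times> 'a \<Rightarrow> real. (\<forall>a\<in>A. \<bar>h a\<bar> \<le> L) \<and> (\<forall>a. a \<notin> A \<longrightarrow> h a = 0)}"
  let ?Z = "{h :: 'j \<times> 'a \<Rightarrow> real. (\<forall>j\<in>J. (\<Sum>x\<in>C j. h (j, x)) = 0)} \<inter> {h. W h \<le> L}"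
  have W_nonneg: "0 \<le> sqrt (card (C j)) * L2_set (\<lambda>x. h (j, x)) (C j)" for h :: "'j \<times> 'a \<Rightarrow> real" and j
    by simp
  have W_bound: "\<bar>h (j, x)\<bar> \<le> W h" if "j \<in> J" "x \<in> C j" for h j x
  proof -
    have "\<bar>h (j, x)\<bar> \<le> L2_set (\<lambda>x. \<bar>h (j, x)\<bar>) (C j)"
      using member_le_L2_set [OF finC [OF that(1)] that(2), of "\<lambda>x. \<bar>h (j, x)\<bar>"] by simp
    also have "\<dots> = L2_set (\<lambda>x. h (j, x)) (C j)"
      by (simp add: L2_set_def)
    also have "\<dots> \<le> sqrt (card (C j)) * L2_set (\<lambda>x. h (j, x)) (C j)"
      using mult_right_mono [OF card1 [OF that(1)] L2_set_nonneg] by simp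
    also have "\<dots> \<le> W h"
      unfolding W_def using that(1) fin(2) by (intro member_le_sum) auto
    finally show ?thesis .
  qed
  have coord: "continuous_on UNIV (\<lambda>h :: 'j \<times> 'a \<Rightarrow> real. h p)" for p
    by (rule continuous_on_product_coordinates)
  have contW: "continuous_on UNIV W"
    unfolding W_def [abs_def] L2_set_def
    by (intro continuous_on_sum continuous_on_mult continuous_on_const continuous_on_real_sqrt continuous_on_power coord)
  have "{h :: 'j \<times> 'a \<Rightarrow> real. \<forall>j\<in>J. (\<Sum>x\<in>C j. h (j, x)) = 0} = (\<Inter>j\<in>J. {h. (\<Sum>x\<in>C j. h (j, x)) = 0})"
    by auto
  moreover have "closed {h :: 'j \<times> 'a \<Rightarrow> real. (\<Sum>x\<in>C j. h (j, x)) = 0}" for j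
    by (intro closed_Collect_eq continuous_on_sum continuous_on_const coord)
  moreover have "closed {h. W h \<le> L}"
    by (intro closed_Collect_le contW continuous_on_const)
  ultimately have "closed ?Z"
    by (simp add: closed_INT closed_Int)
  \<comment> \<open>The weight dominates every entry, so \<open>D\<close> is a closed subset of a
    compact box.\<close>
  have D_eq: "D = ?B \<inter> ?Z"
    unfolding D_def A_def using W_bound by (auto intro: order_trans)
  have "finite A"
    unfolding A_def using fin finC by blast
  then have "compact D"
    unfolding D_eq using \<open>closed ?Z\<close> by (intro compact_Int_closed compact_finite_support_box)
  have zero: "(\<lambda>_. 0) \<in> D"
    using L by (simp add: D_def W_def L2_set_def)
  have "continuous_on D (\<lambda>h. \<Sum>x\<in>X. (z x - (\<Sum>j\<in>J. h (j, x)))\<^sup>2)"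
    by (rule continuous_on_subset [OF _ subset_UNIV])
      (intro continuous_on_sum continuous_on_power continuous_on_diff continuous_on_const coord)
  from continuous_attains_inf [OF \<open>compact D\<close> _ this] zero obtain g where g: "g \<in> D"
    and min: "\<And>h. h \<in> D \<Longrightarrow> (\<Sum>x\<in>X. (z x - (\<Sum>j\<in>J. g (j, x)))\<^sup>2) \<le> (\<Sum>x\<in>X. (z x - (\<Sum>j\<in>J. h (j, x)))\<^sup>2)"
    by blast
  define r where "r x = z x - (\<Sum>j\<in>J. g (j, x))" for x
  \<comment> \<open>First-order optimality: \<open>D\<close> is convex, so moving from
    \<open>g\<close> towards any \<open>h\<close> cannot shorten the residual.\<close>
  have opt: "(\<Sum>x\<in>X. r x * (\<Sum>j\<in>J. h (j, x))) \<le> (\<Sum>x\<in>X. r x * (\<Sum>j\<in>J. g (j, x)))" if h: "h \<in> D" for h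
  proof -
    define e where "e x = (\<Sum>j\<in>J. h (j, x) - g (j, x))" for x
    define R where "R = (\<Sum>x\<in>X. r x * e x)"
    define E where "E = (\<Sum>x\<in>X. (e x)\<^sup>2)"
    have "R \<le> 0"
    proof (rule ccontr)
      assume "\<not> R \<le> 0"
      then have R: "R > 0" by simp
      have E: "E \<ge> 0" by (simp add: E_def sum_nonneg)
      \<comment> \<open>\<open>s \<le> 1\<close> keeps the mixture in \<open>D\<close>, and
        \<open>s * (E + 1) \<le> R\<close> makes the quadratic term too small to offset the linear
        gain. Adding 1 covers \<open>E = 0\<close>.\<close>
      define s where "s = min 1 (R / (E + 1))"
      have s: "0 < s" "s \<le> 1" "s * (E + 1) \<le> R"
        using R E mult_right_mono [of s "R / (E + 1)" "E + 1"] by (auto simp: s_def)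
      define k where "k p = (1 - s) * g p + s * h p" for p
      have "W k \<le> (1 - s) * W g + s * W h"
      proof -
        have "L2_set (\<lambda>x. k (j, x)) (C j) \<le> (1 - s) * L2_set (\<lambda>x. g (j, x)) (C j) + s * L2_set (\<lambda>x. h (j, x)) (C j)" for j
          unfolding k_def using s L2_set_triangle_ineq [of "\<lambda>x. (1 - s) * g (j, x)" "\<lambda>x. s * h (j, x)" "C j"]
          by (simp add: L2_set_right_distrib)
        then have "W k \<le> (\<Sum>j\<in>J. sqrt (card (C j)) * ((1 - s) * L2_set (\<lambda>x. g (j, x)) (C j) + s * L2_set (\<lambda>x. h (j, x)) (C j)))"
          unfolding W_def by (intro sum_mono mult_left_mono) auto
        also have "\<dots> = (1 - s) * W g + s * W h"
          unfolding W_def sum_distrib_left sum.distrib [symmetric] by (intro sum.cong) (auto simp: algebra_simps)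
        finally show ?thesis .
      qed
      also have "\<dots> \<le> (1 - s) * L + s * L"
        using s g h by (intro add_mono mult_left_mono) (auto simp: D_def)
      also have "\<dots> = L"
        by (simp add: algebra_simps)
      finally have "k \<in> D"
        using g h by (auto simp: D_def k_def sum.distrib simp flip: sum_distrib_left)
      from min [OF this] have "(\<Sum>x\<in>X. (r x)\<^sup>2) \<le> (\<Sum>x\<in>X. (r x - s * e x)\<^sup>2)"
        unfolding r_def k_def e_def
        by (simp add: sum.distrib sum_subtractf algebra_simps flip: sum_distrib_left)
      also have "\<dots> = (\<Sum>x\<in>X. (r x)\<^sup>2) - 2 * s * R + s * s * E"
        unfolding R_def E_def sum_distrib_left sum.distrib [symmetric] sum_subtractf [symmetric]
        by (intro sum.cong) (auto simp: power2_eq_square algebra_simps)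
      finally have "s * (2 * R) \<le> s * (s * E)"
        by (simp add: algebra_simps)
      then have "2 * R \<le> s * E"
        using mult_le_cancel_left_pos [OF s(1)] by blast
      with s R show False by (simp add: algebra_simps)
    qed
    then show ?thesis
      by (simp add: R_def e_def sum_subtractf right_diff_distrib)
  qed
  define G where "G = (\<Sum>x\<in>X. r x * (\<Sum>j\<in>J. g (j, x)))"
  have G0: "0 \<le> G"
    using opt [OF zero] by (simp add: G_def)
  have "L * sqrt (variance_on (C j) r) \<le> G" if j: "j \<in> J" for j
  proof (cases "variance_on (C j) r = 0")
    case False
    define c where "c = real (card (C j))"
    have c: "c > 0" using finC ne j by (simp add: c_def card_gt_0_iff)
    define m where "m = (\<Sum>w\<in>C j. r w) / c"
    define S where "S = L2_set (\<lambda>x. r x - m) (C j)"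
    have u: "variance_on (C j) r = S\<^sup>2 / c"
      by (simp add: variance_on_def S_def L2_set_def sum_nonneg m_def c_def)
    have S: "S > 0" using False u by (metis L2_set_nonneg S_def div_0 less_eq_real_def power_zero_numeral)
    \<comment> \<open>The factor gives the centred residual weight exactly \<open>L\<close>.\<close>
    define q where "q = L / (sqrt c * S)"
    have q: "q > 0" using L c S by (simp add: q_def)
    define h where "h p = (if fst p = j \<and> snd p \<in> C j then q * (r (snd p) - m) else 0)" for p :: "'j \<times> 'a"
    have sum0: "(\<Sum>x\<in>C j. r x - m) = 0"
      using c by (simp add: sum_subtractf m_def flip: c_def)
    have "W h = (\<Sum>i\<in>J. if i = j then sqrt c * (q * S) else 0)"
      unfolding W_def
    proof (intro sum.cong refl)
      fix i assume "i \<in> J"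
      show "sqrt (card (C i)) * L2_set (\<lambda>x. h (i, x)) (C i) = (if i = j then sqrt c * (q * S) else 0)"
      proof (cases "i = j")
        case True
        then have "L2_set (\<lambda>x. h (i, x)) (C i) = L2_set (\<lambda>x. q * (r x - m)) (C j)"
          by (intro L2_set_cong) (auto simp: h_def)
        then show ?thesis
          using True q by (simp add: S_def L2_set_right_distrib c_def)
      next
        case False
        then show ?thesis by (simp add: h_def L2_set_def)
      qed
    qed
    also have "\<dots> = L"
      using j fin(2) c S by (simp add: q_def)
    finally have WL: "W h = L" .
    have "(\<Sum>x\<in>C i. h (i, x)) = 0" if "i \<in> J" for i
    proof (cases "i = j")
      case True
      then have "(\<Sum>x\<in>C i. h (i, x)) = (\<Sum>x\<in>C j. q * (r x - m))"
        by (intro sum.cong) (auto simp: h_def)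
      then show ?thesis using sum0 by (simp flip: sum_distrib_left)
    qed (simp add: h_def)
    then have "h \<in> D"
      using WL j by (auto simp: D_def A_def h_def)
    from opt [OF this] have "(\<Sum>x\<in>X. r x * (\<Sum>i\<in>J. h (i, x))) \<le> G"
      by (simp add: G_def)
    also have "(\<Sum>x\<in>X. r x * (\<Sum>i\<in>J. h (i, x))) = (\<Sum>x\<in>X. if x \<in> C j then q * (r x * (r x - m)) else 0)"
    proof (intro sum.cong refl)
      fix x
      have "(\<Sum>i\<in>J. h (i, x)) = (\<Sum>i\<in>J. if i = j then (if x \<in> C j then q * (r x - m) else 0) else 0)"
        by (intro sum.cong) (auto simp: h_def)
      then show "r x * (\<Sum>i\<in>J. h (i, x)) = (if x \<in> C j then q * (r x * (r x - m)) else 0)"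
        using j fin(2) by simp
    qed
    also have "\<dots> = (\<Sum>x\<in>C j. q * (r x * (r x - m)))"
      using CX [OF j] fin(1) by (simp add: sum.inter_restrict [symmetric] Int_absorb1)
    also have "\<dots> = q * ((\<Sum>x\<in>C j. (r x - m)\<^sup>2) + m * (\<Sum>x\<in>C j. r x - m))"
      unfolding sum_distrib_left sum.distrib [symmetric] by (intro sum.cong) (auto simp: power2_eq_square algebra_simps)
    also have "\<dots> = q * S\<^sup>2"
      using sum0 by (simp add: S_def L2_set_def sum_nonneg)
    also have "\<dots> = L * sqrt (variance_on (C j) r)"
      using S c by (simp add: u q_def real_sqrt_divide power2_eq_square)
    finally show ?thesis .
  qed (simp add: G0)
  \<comment> \<open>The residual itself is the test function for \<open>bound\<close>, with
    \<open>M = G / L\<close>.\<close>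
  then have "(\<Sum>x\<in>X. r x * z x) \<le> L * (G / L)"
    using L G0 by (intro bound) (auto simp: field_simps)
  then have "(\<Sum>x\<in>X. r x * z x) - G \<le> 0"
    using L by simp
  also have "(\<Sum>x\<in>X. r x * z x) - G = (\<Sum>x\<in>X. (r x)\<^sup>2)"
    unfolding G_def sum_subtractf [symmetric] by (intro sum.cong) (auto simp: r_def power2_eq_square algebra_simps)
  finally have "\<forall>x\<in>X. r x = 0"
    using fin(1) by (metis (no_types, lifting) order_antisym sum_nonneg sum_nonneg_eq_0_iff zero_eq_power2 zero_le_power2)
  then have "\<forall>x\<in>X. (\<Sum>j\<in>J. g (j, x)) = z x"
    by (simp add: r_def)
  with g show ?thesis
    by (intro exI [of _ "\<lambda>j x. g (j, x)"]) (auto simp: D_def A_def W_def)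
qed

subsection \<open>Reflections\<close>

text \<open>Gram-Schmidt, one vector at a time: the projection grows by the rank-one projection onto
  the part of \<open>v\<close> orthogonal to the earlier span, unless that part vanishes. The last
  clause says that the range is no larger than the span.\<close>

lemma projection_onto_span:
  assumes "finite B" "finite V"
  shows "\<exists>P. projection_on B P \<and> (\<forall>v\<in>V. \<forall>i\<in>B. apply_op B P v i = v i) \<and>
    (\<forall>w. (\<forall>v\<in>V. inner_on B v w = 0) \<longrightarrow> (\<forall>i\<in>B. apply_op B P w i = 0))"
  using assms(2)
proof induction
  case empty
  show ?case
    by (rule exI [of _ "\<lambda>i j. 0"]) (simp add: projection_on_def apply_op_def)
next
  case (insert v V)
  then obtain P where P: "projection_on B P" and fix_V: "\<And>u i. u \<in> V \<Longrightarrow> i \<in> B \<Longrightarrow> apply_op B P u i = u i"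
    and perp: "\<And>w i. (\<And>v. v \<in> V \<Longrightarrow> inner_on B v w = 0) \<Longrightarrow> i \<in> B \<Longrightarrow> apply_op B P w i = 0"
    by metis
  define r where "r = (\<lambda>i. v i - apply_op B P v i)"
  define s where "s = norm_sq B r"
  show ?case
  proof (cases "s = 0")
    case True
    then have "\<forall>i\<in>B. apply_op B P v i = v i"
      using assms(1) by (simp add: s_def r_def norm_sq_def sum_nonneg_eq_0_iff)
    then show ?thesis
      using P fix_V perp by (intro exI [of _ P]) auto
  next
    case False
    have Pr: "apply_op B P r i = 0" if "i \<in> B" for i
      using projection_idem [OF P that] by (simp add: r_def apply_op_diff)
    have inner_on_r: "inner_on B r u = 0" if "\<And>i. i \<in> B \<Longrightarrow> apply_op B P u i = u i" for u
    proof -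
      have "inner_on B r u = inner_on B r (apply_op B P u)" using that by (intro inner_on_cong) auto
      also have "\<dots> = inner_on B (apply_op B P r) u" by (rule projection_selfadjoint [OF P, symmetric])
      also have "\<dots> = 0" using Pr by (simp add: inner_on_def)
      finally show ?thesis .
    qed
    define P' where "P' i j = P i j + r i * cnj (r j) / of_real s" for i j
    have apply': "apply_op B P' w i = apply_op B P w i + r i * (inner_on B r w / of_real s)" for w i
      unfolding apply_op_def P'_def inner_on_def sum_divide_distrib sum_distrib_left sum.distrib [symmetric]
      by (intro sum.cong) (simp_all add: algebra_simps)
    have "projection_on B P'"
      unfolding projection_on_def
    proof (intro ballI conjI)
      fix i j assume ij: "i \<in> B" "j \<in> B"
      have herm: "P i j = cnj (P j i)" if "i \<in> B" "j \<in> B" for i j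
        using P that unfolding projection_on_def by blast
      from herm [OF ij] show "P' i j = cnj (P' j i)"
        by (simp add: P'_def mult.commute)
      have "(\<Sum>k\<in>B. cnj (r k) * P k j) = cnj (apply_op B P r j)"
        unfolding apply_op_def cnj_sum by (intro sum.cong) (use herm [OF _ ij(2)] in auto)
      then have z1: "(\<Sum>k\<in>B. cnj (r k) * P k j) = 0" using Pr [OF ij(2)] by simp
      have z2: "(\<Sum>k\<in>B. P i k * r k) = 0" using Pr [OF ij(1)] by (simp add: apply_op_def)
      have z3: "(\<Sum>k\<in>B. cnj (r k) * r k) = of_real s"
        using inner_on_self [of B r] by (simp add: inner_on_def s_def)
      have z4: "(\<Sum>k\<in>B. P i k * P k j) = P i j"
        using P ij unfolding projection_on_def by blast
      have "(\<Sum>k\<in>B. P' i k * P' k j) = (\<Sum>k\<in>B. P i k * P k j) + (\<Sum>k\<in>B. P i k * r k) * (cnj (r j) / of_real s)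
          + r i / of_real s * (\<Sum>k\<in>B. cnj (r k) * P k j)
          + r i / of_real s * (\<Sum>k\<in>B. cnj (r k) * r k) * (cnj (r j) / of_real s)"
        unfolding sum_distrib_left sum_distrib_right sum.distrib [symmetric] P'_def
        by (intro sum.cong) (simp_all add: algebra_simps)
      then show "(\<Sum>k\<in>B. P' i k * P' k j) = P' i j"
        unfolding z1 z2 z3 z4 using False by (simp add: P'_def)
    qed
    moreover have "apply_op B P' u i = u i" if "u \<in> V" "i \<in> B" for u i
      using fix_V [OF that] inner_on_r [OF fix_V [OF that(1)]] by (simp add: apply')
    moreover have "apply_op B P' v i = v i" if "i \<in> B" for i
    proof -
      have "inner_on B r (apply_op B P v) = 0"
        by (rule inner_on_r) (rule projection_idem [OF P])
      then have "inner_on B r v = inner_on B r r"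
        by (simp add: r_def inner_on_diff_right)
      then show ?thesis
        using False by (simp add: apply' inner_on_self s_def) (simp add: r_def)
    qed
    moreover have "apply_op B P' w i = 0" if w: "\<And>u. u \<in> insert v V \<Longrightarrow> inner_on B u w = 0" and i: "i \<in> B" for w i
    proof -
      have Pw: "apply_op B P w i = 0" if "i \<in> B" for i
        using perp w that by simp
      then have "inner_on B (apply_op B P v) w = 0"
        unfolding projection_selfadjoint [OF P] by (simp add: inner_on_def)
      then have "inner_on B r w = 0"
        using w [of v] by (simp add: r_def inner_on_diff_left)
      then show ?thesis
        using Pw [OF i] by (simp add: apply')
    qed
    ultimately show ?thesis
      by (intro exI [of _ P']) blast
  qed
qed

lemma unitary_reflection:
  assumes "finite B" "projection_on B P"
  shows "unitary_on B (\<lambda>i j. of_bool (i = j) - 2 * P i j)"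
proof -
  have herm: "cnj (P j i) = P i j" if "i \<in> B" "j \<in> B" for i j
    using assms that unfolding projection_on_def by metis
  have idem: "(\<Sum>k\<in>B. P i k * P k j) = P i j" if "i \<in> B" "j \<in> B" for i j
    using assms that unfolding projection_on_def by blast
  have prod: "(\<Sum>k\<in>B. (of_bool (i = k) - 2 * P i k) * (of_bool (k = j) - 2 * P k j)) = of_bool (i = j)"
    if "i \<in> B" "j \<in> B" for i j
  proof -
    have "(\<Sum>k\<in>B. (of_bool (i = k) - 2 * P i k) * (of_bool (k = j) - 2 * P k j))
        = (\<Sum>k\<in>B. if k = i then of_bool (i = j) - 2 * P i j else 0) - 2 * (\<Sum>k\<in>B. if k = j then P i j else 0)
          + 4 * (\<Sum>k\<in>B. P i k * P k j)"
      unfolding sum_distrib_left sum_subtractf [symmetric] sum.distrib [symmetric]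
      by (intro sum.cong) (auto simp: algebra_simps)
    then show ?thesis
      using assms(1) that idem [OF that] by simp
  qed
  have "cnj (of_bool (k = i) - 2 * P k i) = of_bool (i = k) - 2 * P i k" if "i \<in> B" "k \<in> B" for i k
    using herm [OF that] by auto
  then show ?thesis
    unfolding unitary_on_def using prod by (simp cong: sum.cong)
qed

lemma apply_reflection:
  assumes "finite B" "i \<in> B"
  shows "apply_op B (\<lambda>i j. of_bool (i = j) - 2 * P i j) v i = v i - 2 * apply_op B P v i"
proof -
  have "apply_op B (\<lambda>i j. of_bool (i = j) - 2 * P i j) v i = (\<Sum>j\<in>B. if j = i then v i else 0) - 2 * apply_op B P v i"
    unfolding apply_op_def sum_distrib_left sum_subtractf [symmetric]
    by (intro sum.cong) (auto simp: algebra_simps)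
  then show ?thesis using assms by simp
qed

text \<open>Reflect in the span of all differences \<open>a x - b x\<close>. Every sum
  \<open>a y + b y\<close> is orthogonal to that span and stays fixed, while the differences change
  sign; so \<open>a x\<close>, half of sum plus difference, goes to \<open>b x\<close>. One unitary
  serves all \<open>x\<close> at once.\<close>

lemma reflection_exchanging:
  fixes a b :: "'x \<Rightarrow> 'i \<Rightarrow> complex"
  assumes "finite B" "finite X"
    and orth: "\<And>x y. x \<in> X \<Longrightarrow> y \<in> X \<Longrightarrow> inner_on B (\<lambda>i. a x i - b x i) (\<lambda>i. a y i + b y i) = 0"
  shows "\<exists>U. unitary_on B U \<and> (\<forall>x\<in>X. \<forall>i\<in>B. apply_op B U (a x) i = b x i) \<and>
    (\<forall>w. (\<forall>x\<in>X. inner_on B (\<lambda>i. a x i - b x i) w = 0) \<longrightarrow> (\<forall>i\<in>B. apply_op B U w i = w i))"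
proof -
  obtain P where P: "projection_on B P"
    and P1: "\<And>x i. x \<in> X \<Longrightarrow> i \<in> B \<Longrightarrow> apply_op B P (\<lambda>i. a x i - b x i) i = a x i - b x i"
    and P0: "\<And>w i. (\<And>x. x \<in> X \<Longrightarrow> inner_on B (\<lambda>i. a x i - b x i) w = 0) \<Longrightarrow> i \<in> B \<Longrightarrow> apply_op B P w i = 0"
    using projection_onto_span [OF assms(1) finite_imageI [OF assms(2)], of "\<lambda>x i. a x i - b x i"]
    by (auto simp: Ball_def image_iff) blast
  have "2 * apply_op B P (a x) i = a x i - b x i" if "x \<in> X" "i \<in> B" for x i
  proof -
    have "apply_op B P (a x) i - apply_op B P (b x) i = a x i - b x i"
      using P1 [OF that] by (simp add: apply_op_diff)
    moreover have "apply_op B P (a x) i + apply_op B P (b x) i = 0"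
      using P0 [OF orth that(2), OF _ that(1)] by (simp add: apply_op_add)
    moreover have "2 * apply_op B P (a x) i
        = (apply_op B P (a x) i - apply_op B P (b x) i) + (apply_op B P (a x) i + apply_op B P (b x) i)"
      by simp
    ultimately show ?thesis by simp
  qed
  then show ?thesis
    using P0 by (intro exI [of _ "\<lambda>i j. of_bool (i = j) - 2 * P i j"] conjI unitary_reflection assms P)
      (simp_all add: apply_reflection assms)
qed

subsection \<open>The catalytic algorithm\<close>

definition query_inner :: "nat set set \<Rightarrow> nat \<Rightarrow> (nat set \<times> (nat \<Rightarrow> real) \<Rightarrow> nat \<Rightarrow> real) \<Rightarrow> (nat set \<times> (nat \<Rightarrow> real) \<Rightarrow> nat \<Rightarrow> real) \<Rightarrow> real" where
  "query_inner Q m v v' = (\<Sum>q\<in>(SIGMA S:Q. cube S). \<Sum>w<m. v q w * v' q w)"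

definition flip_query :: "(nat \<Rightarrow> real) \<Rightarrow> (nat set \<times> (nat \<Rightarrow> real) \<Rightarrow> nat \<Rightarrow> real) \<Rightarrow> nat set \<times> (nat \<Rightarrow> real) \<Rightarrow> nat \<Rightarrow> real" where
  "flip_query x v = (\<lambda>q w. if restrict x (fst q) = snd q then - v q w else v q w)"

text \<open>The workspace register splits into private values \<open>w < m\<close>, paired with the answer qubit in the state
  \<open>|->\<close>, so that a query acts as a phase, and public values \<open>w \<ge> m\<close>, paired with \<open>|+>\<close>
  and invariant under queries.\<close>

definition register_state :: "nat \<Rightarrow> nat set \<times> (nat \<Rightarrow> real) \<Rightarrow> (nat \<Rightarrow> real) \<Rightarrow> (nat set \<times> (nat \<Rightarrow> real) \<Rightarrow> nat \<Rightarrow> real) \<Rightarrow> qbasis \<Rightarrow> complex" where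
  "register_state m q0 g v = (\<lambda>(q, a, w). of_real ((if w < m then (if a = 0 then v q w else - v q w)
      else if q = q0 then g w else 0) / sqrt 2))"

lemma register_state_add: "(\<lambda>i. register_state m q0 g v i + register_state m q0 g' v' i) = register_state m q0 (\<lambda>w. g w + g' w) (\<lambda>q w. v q w + v' q w)"
  and register_state_diff: "(\<lambda>i. register_state m q0 g v i - register_state m q0 g' v' i) = register_state m q0 (\<lambda>w. g w - g' w) (\<lambda>q w. v q w - v' q w)"
  and register_state_scale: "(\<lambda>i. of_real c * register_state m q0 g v i) = register_state m q0 (\<lambda>w. c * g w) (\<lambda>q w. c * v q w)"
  by (auto simp: register_state_def fun_eq_iff add_divide_distrib diff_divide_distrib)

text \<open>Each answer value contributes half of the product, so the state is an isometric image of
  \<open>g\<close> on its window together with \<open>v\<close>. The public part sits at the single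
  index \<open>q0\<close>, so it is counted once.\<close>

lemma inner_on_register_state:
  assumes "finite (SIGMA S:Q. cube S)" "q0 \<in> (SIGMA S:Q. cube S)"
  shows "inner_on (qspace Q (m + k)) (register_state m q0 g v) (register_state m q0 g' v')
     = of_real ((\<Sum>w\<in>{m..<m + k}. g w * g' w) + query_inner Q m v v')"
proof -
  let ?R = "SIGMA S:Q. cube S"
  have "inner_on (qspace Q (m + k)) (register_state m q0 g v) (register_state m q0 g' v')
     = (\<Sum>q\<in>?R. \<Sum>w<m + k. of_real (if w < m then v q w * v' q w else if q = q0 then g w * g' w else 0))"
    unfolding inner_on_def sum_qspace by (intro sum.cong refl) (auto simp: register_state_def simp flip: of_real_mult of_real_add)
  also have "\<dots> = of_real (\<Sum>q\<in>?R. (\<Sum>w<m. v q w * v' q w) + (if q = q0 then \<Sum>w\<in>{m..<m + k}. g w * g' w else 0))"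
  proof -
    have "{..<m + k} = {..<m} \<union> {m..<m + k}" "{..<m} \<inter> {m..<m + k} = {}" by auto
    then have "(\<Sum>w<m + k. if w < m then v q w * v' q w else if q = q0 then g w * g' w else 0)
        = (\<Sum>w<m. v q w * v' q w) + (if q = q0 then \<Sum>w\<in>{m..<m + k}. g w * g' w else 0)" for q
      by (simp add: sum.union_disjoint)
    then show ?thesis by (simp only: of_real_sum [symmetric])
  qed
  also have "\<dots> = of_real ((\<Sum>w\<in>{m..<m + k}. g w * g' w) + query_inner Q m v v')"
    using assms by (simp add: sum.distrib query_inner_def)
  finally show ?thesis .
qed

lemma register_state_query:
  assumes "i \<in> qspace Q d"
  shows "register_state m q0 g v (query_map x i) = register_state m q0 g (flip_query x v) i"
proof -
  obtain S b a w where "i = ((S, b), a, w)" by (metis prod.collapse)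
  with assms show ?thesis by (auto simp: register_state_def flip_query_def qspace_def)
qed

section \<open>Error estimates and two-outcome measurements\<close>

lemma norm_sq_add_le: "norm_sq B (\<lambda>i. u i + v i) \<le> 2 * (norm_sq B u + norm_sq B v)"
proof -
  have "(cmod (a + b))\<^sup>2 \<le> 2 * ((cmod a)\<^sup>2 + (cmod b)\<^sup>2)" for a b
    using zero_le_power2 [of "cmod (a - b)"]
    unfolding cmod_power2 by (simp add: power2_eq_square algebra_simps)
  then show ?thesis
    unfolding norm_sq_def sum_distrib_left sum.distrib [symmetric] by (intro sum_mono) simp
qed

text \<open>This is the nonnegativity of the square of \<open>cmod (a + 6 * b)\<close>, divided by
  6. The weights fit an error of squared norm 1/36: 5/6 - 5/36 = 25/36 exceeds 2/3.\<close>

lemma norm_sq_perturbation: "norm_sq B (\<lambda>i. u i + v i) \<ge> 5 / 6 * norm_sq B u - 5 * norm_sq B v"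
proof -
  have "(cmod (a + b))\<^sup>2 \<ge> 5 / 6 * (cmod a)\<^sup>2 - 5 * (cmod b)\<^sup>2" for a b
  proof -
    have "0 \<le> (Re a + 6 * Re b)\<^sup>2 + (Im a + 6 * Im b)\<^sup>2" by simp
    then show ?thesis
      unfolding cmod_power2 by (simp add: power2_eq_square algebra_simps)
  qed
  then show ?thesis
    unfolding norm_sq_def sum_distrib_left sum_subtractf [symmetric] by (intro sum_mono) simp
qed

lemma query_inner_scale: "query_inner Q m (\<lambda>q w. c * u q w) (\<lambda>q w. c * v q w) = c\<^sup>2 * query_inner Q m u v"
  by (simp add: query_inner_def sum_distrib_left power2_eq_square mult_ac)

lemma norm_sq_register_state:
  assumes "finite (SIGMA S:Q. cube S)" "q0 \<in> (SIGMA S:Q. cube S)"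
  shows "norm_sq (qspace Q (m + k)) (register_state m q0 g v) = (\<Sum>w\<in>{m..<m + k}. (g w)\<^sup>2) + query_inner Q m v v"
  using inner_on_register_state [OF assms, of m k g v g v] unfolding inner_on_self of_real_eq_iff by (simp add: power2_eq_square)

lemma unitary_identity: "finite B \<Longrightarrow> unitary_on B (\<lambda>i j. of_bool (i = j))"
  using unitary_reflection [of B "\<lambda>i j. 0"] by (simp add: projection_on_def)

lemma projection_rank_one:
  assumes "inner_on B g g = 1"
  shows "projection_on B (\<lambda>i j. g i * cnj (g j))"
proof -
  have "(\<Sum>k\<in>B. g i * cnj (g k) * (g k * cnj (g j))) = g i * inner_on B g g * cnj (g j)" for i j
    by (simp add: inner_on_def sum_distrib_left sum_distrib_right mult_ac)
  then show ?thesis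
    using assms by (simp add: projection_on_def mult.commute)
qed

lemma apply_rank_one: "apply_op B (\<lambda>i j. g i * cnj (g j)) v i = g i * inner_on B g v"
  by (simp add: apply_op_def inner_on_def sum_distrib_left mult_ac)

lemma projection_complement:
  assumes "finite B" "projection_on B P"
  shows "projection_on B (\<lambda>i j. of_bool (i = j) - P i j)"
    and "i \<in> B \<Longrightarrow> j \<in> B \<Longrightarrow> (\<Sum>k\<in>B. P i k * (of_bool (k = j) - P k j)) = 0"
    and "i \<in> B \<Longrightarrow> j \<in> B \<Longrightarrow> (\<Sum>k\<in>B. (of_bool (i = k) - P i k) * P k j) = 0"
proof -
  have herm: "P i j = cnj (P j i)" and idem: "(\<Sum>k\<in>B. P i k * P k j) = P i j" if "i \<in> B" "j \<in> B" for i j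
    using assms that unfolding projection_on_def by blast+
  show 1: "(\<Sum>k\<in>B. P i k * (of_bool (k = j) - P k j)) = 0" if "i \<in> B" "j \<in> B" for i j
  proof -
    have "(\<Sum>k\<in>B. P i k * (of_bool (k = j) - P k j)) = (\<Sum>k\<in>B. if k = j then P i j else 0) - (\<Sum>k\<in>B. P i k * P k j)"
      unfolding sum_subtractf [symmetric] by (intro sum.cong) (auto simp: algebra_simps)
    then show ?thesis using assms(1) that idem by simp
  qed
  show 2: "(\<Sum>k\<in>B. (of_bool (i = k) - P i k) * P k j) = 0" if "i \<in> B" "j \<in> B" for i j
  proof -
    have "(\<Sum>k\<in>B. (of_bool (i = k) - P i k) * P k j) = (\<Sum>k\<in>B. if k = i then P i j else 0) - (\<Sum>k\<in>B. P i k * P k j)"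
      unfolding sum_subtractf [symmetric] by (intro sum.cong) (auto simp: algebra_simps)
    then show ?thesis using assms(1) that idem by simp
  qed
  show "projection_on B (\<lambda>i j. of_bool (i = j) - P i j)"
    unfolding projection_on_def
  proof (intro ballI conjI)
    fix i j assume ij: "i \<in> B" "j \<in> B"
    show "of_bool (i = j) - P i j = cnj (of_bool (j = i) - P j i)"
      using herm [OF ij] by (auto simp: eq_commute)
    have "(\<Sum>k\<in>B. (of_bool (i = k) - P i k) * (of_bool (k = j) - P k j))
        = (\<Sum>k\<in>B. if k = j then of_bool (i = j) - P i j else 0) - (\<Sum>k\<in>B. (of_bool (i = k) - P i k) * P k j)"
      unfolding sum_subtractf [symmetric] by (intro sum.cong) (auto simp: algebra_simps)
    then show "(\<Sum>k\<in>B. (of_bool (i = k) - P i k) * (of_bool (k = j) - P k j)) = of_bool (i = j) - P i j"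
      using 2 [OF ij] assms(1) ij by simp
  qed
qed

lemma binary_measurement:
  assumes "finite B" "projection_on B P"
  shows "measurement_on B {1, -1 :: real} (\<lambda>e. if e = 1 then P else (\<lambda>i j. of_bool (i = j) - P i j))"
    (is "measurement_on B ?E ?P")
proof -
  let ?P' = "\<lambda>i j. of_bool (i = j) - P i j"
  have P': "projection_on B ?P'"
    by (rule projection_complement(1) [OF assms])
  have P_neg: "?P 1 = P" "?P (-1) = ?P'" by simp_all
  have herm: "?P e i j = cnj (?P e j i)" if e: "e \<in> ?E" and ij: "i \<in> B" "j \<in> B" for e i j
  proof -
    consider "e = 1" | "e = -1" using e by blast
    then show ?thesis
    proof cases
      case 1
      show ?thesis unfolding 1 P_neg by (rule projection_onD(1) [OF assms(2) ij])
    next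
      case 2
      show ?thesis unfolding 2 P_neg by (rule projection_onD(1) [OF P' ij])
    qed
  qed
  have "(\<Sum>k\<in>B. ?P e i k * ?P e' k j) = (if e = e' then ?P e i j else 0)"
    if e: "e \<in> ?E" "e' \<in> ?E" and ij: "i \<in> B" "j \<in> B" for e e' i j
  proof -
    consider "e = 1" "e' = 1" | "e = 1" "e' = -1" | "e = -1" "e' = 1" | "e = -1" "e' = -1"
      using e by blast
    then show ?thesis
    proof cases
      case 1
      show ?thesis unfolding 1 P_neg using projection_onD(2) [OF assms(2) ij] by simp
    next
      case 2
      show ?thesis unfolding 2 P_neg using projection_complement(2) [OF assms ij] by simp
    next
      case 3
      show ?thesis unfolding 3 P_neg using projection_complement(3) [OF assms ij] by simp
    next
      case 4
      show ?thesis unfolding 4 P_neg using projection_onD(2) [OF P' ij] by simp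
    qed
  qed
  moreover have "(\<Sum>e\<in>?E. ?P e i j) = of_bool (i = j)" for i j
    by simp
  moreover have "finite ?E"
    by simp
  ultimately show ?thesis
    unfolding measurement_on_def using herm by (intro conjI ballI)
qed

text \<open>The difference is supported where \<open>x\<close> gets answer 1, the sum where
  \<open>y\<close> gets answer 0, so only queries separating the two in this direction
  contribute.\<close>

lemma query_inner_flip:
  "query_inner Q m (\<lambda>q w. flip_query x u q w - u q w) (\<lambda>q w. flip_query y v q w + v q w)
   = - (4 * (\<Sum>q\<in>(SIGMA S:Q. cube S). \<Sum>w<m.
        if restrict x (fst q) = snd q \<and> restrict y (fst q) \<noteq> snd q then u q w * v q w else 0))"
  unfolding query_inner_def sum_distrib_left sum_negf [symmetric]
  by (intro sum.cong refl) (auto simp: flip_query_def)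

lemma query_inner_zero [simp]: "query_inner Q m (\<lambda>q w. 0) v = 0" "query_inner Q m u (\<lambda>q w. 0) = 0"
  by (simp_all add: query_inner_def)

text \<open>The public register holds \<open>K\<close> tokens and a reference amplitude. A query and
  the reflection after it turn one token into \<open>F x\<close> times a served token and return
  \<open>v x\<close> unchanged, so \<open>v x\<close> is reused for all \<open>K\<close> tokens.
  Leaving it out of the start costs a squared error of at most \<open>L / (2 * K)\<close>.\<close>

lemma adversary_algorithm:
  fixes v :: "(nat \<Rightarrow> real) \<Rightarrow> nat set \<times> (nat \<Rightarrow> real) \<Rightarrow> nat \<Rightarrow> real" and F :: "(nat \<Rightarrow> real) \<Rightarrow> real"
  assumes Q: "Q \<subseteq> Pow {1..n}" "Q \<noteq> {}" and K: "K > 0" "72 * L \<le> real K"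
    and F: "\<And>x. x \<in> cube {1..n} \<Longrightarrow> F x = 1 \<or> F x = -1"
    and gram: "\<And>x y. x \<in> cube {1..n} \<Longrightarrow> y \<in> cube {1..n} \<Longrightarrow>
      4 * (\<Sum>q\<in>(SIGMA S:Q. cube S). \<Sum>w<m.
        if restrict x (fst q) = snd q \<and> restrict y (fst q) \<noteq> snd q then v x q w * v y q w else 0) = 1 - F x * F y"
    and norm: "\<And>x. x \<in> cube {1..n} \<Longrightarrow> query_inner Q m (v x) (v x) \<le> L"
  shows "quantum_computes n Q F K"
proof -
  let ?R = "SIGMA S:Q. cube S"
  let ?X = "cube {1..n}"
  \<comment> \<open>The public window has one reference cell, \<open>K\<close> cells for tokens
    still to be served and \<open>K\<close> for those already served.\<close>
  define d where "d = m + (2 * K + 1)"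
  define B where "B = qspace Q d"
  have finB: "finite B"
    unfolding B_def by (rule finite_qspace [OF finite_atLeastAtMost Q(1)])
  have finR: "finite ?R"
  proof -
    have "finite S" if "S \<in> Q" for S using Q(1) that finite_subset by blast
    moreover have "finite Q" using Q(1) finite_subset by blast
    ultimately show ?thesis by (simp add: finite_SigmaI)
  qed
  obtain q0 where q0: "q0 \<in> ?R"
    using Q(2) cube_nonempty by fastforce
  note inner_on_register_state' = inner_on_register_state [OF finR q0, of m "2 * K + 1", folded d_def B_def]
    and norm_register_state' = norm_sq_register_state [OF finR q0, of m "2 * K + 1", folded d_def B_def]
  define e where "e k = (\<lambda>w. of_bool (w = m + k) :: real)" for k :: nat
  have sum_e: "(\<Sum>w\<in>{m..<d}. g w * e k w) = (if k < 2 * K + 1 then g (m + k) else 0)"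
    "(\<Sum>w\<in>{m..<d}. e k w * g w) = (if k < 2 * K + 1 then g (m + k) else 0)" for g k
  proof -
    have "(\<Sum>w\<in>{m..<d}. g w * e k w) = (\<Sum>w\<in>{m..<d}. if w = m + k then g (m + k) else 0)"
      by (intro sum.cong) (auto simp: e_def)
    then show "(\<Sum>w\<in>{m..<d}. g w * e k w) = (if k < 2 * K + 1 then g (m + k) else 0)"
      by (simp add: d_def)
    then show "(\<Sum>w\<in>{m..<d}. e k w * g w) = (if k < 2 * K + 1 then g (m + k) else 0)"
      by (simp add: mult.commute)
  qed
  \<comment> \<open>At time \<open>t\<close> the cells after \<open>m\<close> hold \<open>t\<close>
    zeros, then \<open>K - t\<close> unserved tokens 1, then \<open>t\<close> served tokens
    \<open>s\<close>. The reference \<open>sqrt K\<close> weighs as much as all tokens together,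
    which makes the final states for the two signs orthogonal.\<close>
  define G where "G s t = (\<lambda>w. if w = m then sqrt K else if w < m + Suc t then 0 else if w < m + Suc K then 1
      else if w < m + Suc K + t then s else 0 :: real)" for s :: real and t
  define good where "good t U \<longleftrightarrow> unitary_on B U \<and>
      (\<forall>x\<in>?X. \<forall>i\<in>B. apply_op B U (register_state m q0 (e (Suc t)) (flip_query x (v x))) i
        = register_state m q0 (\<lambda>w. F x * e (Suc (K + t)) w) (v x) i) \<and>
      (\<forall>w. (\<forall>x\<in>?X. inner_on B (\<lambda>i. register_state m q0 (e (Suc t)) (flip_query x (v x)) i
           - register_state m q0 (\<lambda>w. F x * e (Suc (K + t)) w) (v x) i) w = 0)
         \<longrightarrow> (\<forall>i\<in>B. apply_op B U w i = w i))" for t U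
  \<comment> \<open>The public parts pair to \<open>1 - F x * F y\<close>, the private parts to its
    negative by \<open>gram\<close>; this is the orthogonality that the exchanging reflection
    needs.\<close>
  have "\<exists>U. good t U" if t: "t < K" for t
    unfolding good_def
  proof (rule reflection_exchanging [OF finB])
    fix x y assume xy: "x \<in> ?X" "y \<in> ?X"
    have "(\<Sum>w\<in>{m..<d}. (e (Suc t) w - F x * e (Suc (K + t)) w) * (e (Suc t) w + F y * e (Suc (K + t)) w))
        = (\<Sum>w\<in>{m..<d}. e (Suc t) w * (1 * e (Suc t) w)) - F x * F y * (\<Sum>w\<in>{m..<d}. e (Suc (K + t)) w * (1 * e (Suc (K + t)) w))"
      unfolding sum_distrib_left sum_subtractf [symmetric]
      by (intro sum.cong refl) (use t in \<open>auto simp: e_def\<close>)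
    also have "\<dots> = 1 - F x * F y"
      unfolding sum_e using t by (simp add: e_def)
    finally show "inner_on B (\<lambda>i. register_state m q0 (e (Suc t)) (flip_query x (v x)) i - register_state m q0 (\<lambda>w. F x * e (Suc (K + t)) w) (v x) i)
       (\<lambda>i. register_state m q0 (e (Suc t)) (flip_query y (v y)) i + register_state m q0 (\<lambda>w. F y * e (Suc (K + t)) w) (v y) i) = 0"
      unfolding register_state_add register_state_diff inner_on_register_state' query_inner_flip gram [OF xy] by simp
  qed simp
  then obtain R where good: "\<And>t. t < K \<Longrightarrow> good t (R t)"
    by metis
  have R: "unitary_on B (R t)" if "t < K" for t
    using good [OF that] unfolding good_def by blast
  have R_swap: "apply_op B (R t) (register_state m q0 (e (Suc t)) (flip_query x (v x))) i = register_state m q0 (\<lambda>w. F x * e (Suc (K + t)) w) (v x) i"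
    if "t < K" "x \<in> ?X" "i \<in> B" for t x i
    using good [OF that(1)] that(2,3) unfolding good_def by blast
  have R_fix: "apply_op B (R t) w i = w i" if "t < K" "\<And>x. x \<in> ?X \<Longrightarrow> inner_on B (\<lambda>i. register_state m q0 (e (Suc t)) (flip_query x (v x)) i
           - register_state m q0 (\<lambda>w. F x * e (Suc (K + t)) w) (v x) i) w = 0" "i \<in> B" for t w i
    using good [OF that(1)] that(2,3) unfolding good_def by blast
  define U where "U t = (case t of 0 \<Rightarrow> \<lambda>i j. of_bool (i = j) | Suc t \<Rightarrow> R t)" for t
  have U: "unitary_on B (U t)" if "t \<le> K" for t
    using that R unitary_identity [OF finB] by (auto simp: U_def split: nat.split)
  define c where "c = 1 / sqrt (2 * K)"
  have c: "c\<^sup>2 = 1 / (2 * K)" by (simp add: c_def power_divide)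
  \<comment> \<open>The start has no catalyst, and \<open>G s 0\<close> contains no served token, so
    it is the same for both signs.\<close>
  define \<psi>0 where "\<psi>0 = (\<lambda>i. of_real c * register_state m q0 (G 1 0) (\<lambda>q w. 0) i)"
  define \<Psi> where "\<Psi> x t = register_state m q0 (G (F x) t) (v x)" for x t
  have step: "apply_op B (U (Suc t)) (apply_op B (query_op x) (\<Psi> x t)) i = \<Psi> x (Suc t) i"
    if t: "t < K" and x: "x \<in> ?X" and i: "i \<in> B" for t x i
  proof -
    \<comment> \<open>The remaining public part vanishes on the two cells involved; it is orthogonal
      to all differences and hence fixed by the reflection.\<close>
    let ?w = "register_state m q0 (\<lambda>w. G (F x) t w - e (Suc t) w) (\<lambda>q w. 0)"
    have "apply_op B (query_op x) (\<Psi> x t) j = register_state m q0 (e (Suc t)) (flip_query x (v x)) j + ?w j" if "j \<in> B" for j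
    proof -
      have "apply_op B (query_op x) (\<Psi> x t) j = register_state m q0 (G (F x) t) (flip_query x (v x)) j"
        using that finB unfolding \<Psi>_def B_def by (simp add: apply_query_op register_state_query)
      then show ?thesis
        unfolding fun_cong [OF register_state_add] by simp
    qed
    then have "apply_op B (U (Suc t)) (apply_op B (query_op x) (\<Psi> x t)) i
        = apply_op B (R t) (register_state m q0 (e (Suc t)) (flip_query x (v x))) i + apply_op B (R t) ?w i"
      unfolding apply_op_add [symmetric, THEN fun_cong] U_def nat.case by (intro fun_cong [OF apply_op_cong])
    also have "apply_op B (R t) ?w i = ?w i"
    proof (rule R_fix [OF t _ i])
      fix y assume y: "y \<in> ?X"
      have "(\<Sum>w\<in>{m..<d}. (e (Suc t) w - F y * e (Suc (K + t)) w) * (G (F x) t w - e (Suc t) w))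
        = (\<Sum>w\<in>{m..<d}. e (Suc t) w * (G (F x) t w - e (Suc t) w)) - F y * (\<Sum>w\<in>{m..<d}. e (Suc (K + t)) w * (G (F x) t w - e (Suc t) w))"
        unfolding sum_distrib_left sum_subtractf [symmetric]
        by (intro sum.cong refl) (simp add: algebra_simps)
      also have "\<dots> = 0"
        unfolding sum_e using t by (simp add: e_def G_def)
      finally show "inner_on B (\<lambda>i. register_state m q0 (e (Suc t)) (flip_query y (v y)) i - register_state m q0 (\<lambda>w. F y * e (Suc (K + t)) w) (v y) i) ?w = 0"
        unfolding register_state_diff inner_on_register_state' by simp
    qed
    also note R_swap [OF t x i]
    also have "register_state m q0 (\<lambda>w. F x * e (Suc (K + t)) w) (v x) i + ?w i = \<Psi> x (Suc t) i"
    proof -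
      have "F x * e (Suc (K + t)) w + (G (F x) t w - e (Suc t) w) = G (F x) (Suc t) w" for w
        using t by (auto simp: e_def G_def)
      then show ?thesis
        unfolding fun_cong [OF register_state_add] \<Psi>_def by simp
    qed
    finally show ?thesis .
  qed
  \<comment> \<open>The catalysed states follow the dynamics exactly, so the deviation starts as the
    missing catalyst and keeps its norm under unitaries.\<close>
  have error: "norm_sq B (\<lambda>i. query_state B \<psi>0 U x t i - of_real c * \<Psi> x t i) = c\<^sup>2 * query_inner Q m (v x) (v x)"
    if "t \<le> K" and x: "x \<in> ?X" for t x
    using that(1)
  proof (induction t)
    case 0
    have "apply_op B (U 0) \<psi>0 i = \<psi>0 i" if "i \<in> B" for i
      using finB that by (intro apply_op_identity) (auto simp: U_def)
    then have "norm_sq B (\<lambda>i. query_state B \<psi>0 U x 0 i - of_real c * \<Psi> x 0 i)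
        = norm_sq B (register_state m q0 (\<lambda>w. c * G 1 0 w - c * G (F x) 0 w) (\<lambda>q w. c * 0 - c * v x q w))"
      unfolding register_state_diff [symmetric] register_state_scale [symmetric] \<Psi>_def \<psi>0_def by (intro norm_sq_cong) simp
    also have "(\<lambda>w. c * G 1 0 w - c * G (F x) 0 w) = (\<lambda>w. 0)"
      by (auto simp: G_def)
    finally show ?case
      unfolding norm_register_state' using query_inner_scale [of Q m "- c" "v x" "v x"] by simp
  next
    case (Suc t)
    let ?e = "\<lambda>i. query_state B \<psi>0 U x t i - of_real c * \<Psi> x t i"
    have "query_state B \<psi>0 U x (Suc t) i - of_real c * \<Psi> x (Suc t) i
        = apply_op B (U (Suc t)) (apply_op B (query_op x) ?e) i" if "i \<in> B" for i
      using step [of t x i] Suc.prems x that by (simp add: apply_op_diff apply_op_scale)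
    then have "norm_sq B (\<lambda>i. query_state B \<psi>0 U x (Suc t) i - of_real c * \<Psi> x (Suc t) i)
        = norm_sq B (apply_op B (U (Suc t)) (apply_op B (query_op x) ?e))"
      by (intro norm_sq_cong)
    also have "\<dots> = norm_sq B ?e"
      unfolding norm_sq_unitary [OF finB U [OF Suc.prems]] unfolding B_def
      by (rule norm_sq_query) (use finB in \<open>simp add: B_def\<close>)
    also have "\<dots> = c\<^sup>2 * query_inner Q m (v x) (v x)"
      using Suc by simp
    finally show ?case .
  qed
  have sum_window: "(\<Sum>w\<in>{m..<d}. (if w = m then real K else 0) + (if m + Suc t \<le> w \<and> w < m + Suc K + t then a else 0)) = real K + real K * a"
    if "t \<le> K" for t and a :: real
  proof -
    have "{w \<in> {m..<d}. m + Suc t \<le> w \<and> w < m + Suc K + t} = {m + Suc t..<m + Suc K + t}"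
      using that by (auto simp: d_def)
    then have "(\<Sum>w\<in>{m..<d}. if m + Suc t \<le> w \<and> w < m + Suc K + t then a else 0) = real K * a"
      by (simp flip: sum.inter_filter)
    moreover have "(\<Sum>w\<in>{m..<d}. if w = m then real K else 0) = real K"
      by (simp add: d_def)
    ultimately show ?thesis by (simp add: sum.distrib)
  qed
  have G_norm: "(\<Sum>w\<in>{m..<d}. (G s t w)\<^sup>2) = 2 * K" if "s = 1 \<or> s = -1" "t \<le> K" for s t
  proof -
    have "(\<Sum>w\<in>{m..<d}. (G s t w)\<^sup>2)
        = (\<Sum>w\<in>{m..<d}. (if w = m then real K else 0) + (if m + Suc t \<le> w \<and> w < m + Suc K + t then 1 else 0))"
      by (intro sum.cong refl) (use that in \<open>auto simp: G_def\<close>)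
    also have "\<dots> = real K + real K * 1"
      by (rule sum_window [OF that(2)])
    finally show ?thesis by simp
  qed
  have G_final: "(\<Sum>w\<in>{m..<d}. G 1 K w * G (-1) K w) = 0"
  proof -
    have "(\<Sum>w\<in>{m..<d}. G 1 K w * G (-1) K w)
        = (\<Sum>w\<in>{m..<d}. (if w = m then real K else 0) + (if m + Suc K \<le> w \<and> w < m + Suc K + K then -1 else 0))"
      by (intro sum.cong refl) (auto simp: G_def)
    also have "\<dots> = real K + real K * (-1)"
      by (rule sum_window [OF order_refl])
    finally show ?thesis by simp
  qed
  \<comment> \<open>The ideal final states with the catalyst removed. The states for 1 and -1 are
    orthonormal, so testing for \<open>\<tau> 1\<close> reads off the sign.\<close>
  define \<tau> where "\<tau> s = (\<lambda>i. of_real c * register_state m q0 (G s K) (\<lambda>q w. 0) i)" for s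
  have inner_on_\<tau>: "inner_on B (\<tau> s) (\<tau> s') = of_real (c\<^sup>2 * (\<Sum>w\<in>{m..<d}. G s K w * G s' K w))" for s s'
    unfolding \<tau>_def inner_on_scale_left inner_on_scale_right inner_on_register_state' by (simp add: power2_eq_square)
  have \<tau>1: "inner_on B (\<tau> s) (\<tau> s) = 1" if "s = 1 \<or> s = -1" for s
    unfolding inner_on_\<tau> power2_eq_square [of "G s K _", symmetric] G_norm [OF that order_refl] using K(1) by (simp add: c)
  define P where "P = (\<lambda>r :: real. if r = 1 then \<lambda>i j. \<tau> 1 i * cnj (\<tau> 1 j) else (\<lambda>i j. of_bool (i = j) - \<tau> 1 i * cnj (\<tau> 1 j)))"
  note proj = projection_rank_one [OF \<tau>1]
  have M: "measurement_on B {1, -1} P"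
    unfolding P_def by (rule binary_measurement [OF finB proj]) simp
  have "inner_on B \<psi>0 \<psi>0 = of_real (c\<^sup>2 * (\<Sum>w\<in>{m..<d}. (G 1 0 w)\<^sup>2))"
    unfolding \<psi>0_def inner_on_scale_left inner_on_scale_right inner_on_register_state' by (simp add: power2_eq_square)
  also have "(\<Sum>w\<in>{m..<d}. (G 1 0 w)\<^sup>2) = 2 * K"
    by (rule G_norm) simp_all
  finally have "norm_sq B \<psi>0 = 1"
    unfolding inner_on_self of_real_eq_iff using K(1) by (simp add: c)
  moreover have "norm_sq B (apply_op B (P (F x)) (query_state B \<psi>0 U x K)) \<ge> 2 / 3" if x: "x \<in> ?X" for x
  proof -
    define \<delta> where "\<delta> = (\<lambda>i. query_state B \<psi>0 U x K i - \<tau> (F x) i)"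
    have PM: "projection_on B (P (F x))"
      using F [OF x] by (intro measurement_projection [OF M]) auto
    have "register_state m q0 (G (F x) K) (v x) i = register_state m q0 (G (F x) K) (\<lambda>q w. 0) i + register_state m q0 (\<lambda>w. 0) (v x) i" for i
      using fun_cong [OF register_state_add [of m q0 "G (F x) K" "\<lambda>q w. 0" "\<lambda>w. 0" "v x"], of i] by simp
    then have \<delta>_eq: "\<delta> = (\<lambda>i. (query_state B \<psi>0 U x K i - of_real c * \<Psi> x K i) + of_real c * register_state m q0 (\<lambda>w. 0) (v x) i)"
      unfolding \<delta>_def \<tau>_def \<Psi>_def by (simp add: algebra_simps)
    \<comment> \<open>The catalyst is paid for twice: missing at the start and left over at the end.
      Together this is at most \<open>4 * c\<^sup>2 * L = 2 * L / K\<close>, which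
      \<open>72 * L \<le> K\<close> brings down to 1/36.\<close>
    have "norm_sq B \<delta> \<le> 2 * (norm_sq B (\<lambda>i. query_state B \<psi>0 U x K i - of_real c * \<Psi> x K i) + norm_sq B (\<lambda>i. of_real c * register_state m q0 (\<lambda>w. 0) (v x) i))"
      unfolding \<delta>_eq by (rule norm_sq_add_le)
    also note error [OF order_refl x]
    also have "norm_sq B (\<lambda>i. of_real c * register_state m q0 (\<lambda>w. 0) (v x) i) = c\<^sup>2 * query_inner Q m (v x) (v x)"
      unfolding register_state_scale norm_register_state' query_inner_scale by simp
    also have "2 * (c\<^sup>2 * query_inner Q m (v x) (v x) + c\<^sup>2 * query_inner Q m (v x) (v x)) = 2 * query_inner Q m (v x) (v x) / K"
      by (simp add: c)
    also have "\<dots> \<le> 1 / 36"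
      using norm [OF x] K by (simp add: field_simps)
    finally have \<delta>: "norm_sq B \<delta> \<le> 1 / 36" .
    have "apply_op B (P (F x)) (\<tau> (F x)) i = \<tau> (F x) i" if "i \<in> B" for i
    proof (cases "F x = 1")
      case True
      then show ?thesis by (simp add: P_def apply_rank_one \<tau>1)
    next
      case False
      then have Fx: "F x = -1" using F [OF x] by simp
      have "apply_op B (P (F x)) (\<tau> (F x)) i = \<tau> (F x) i - apply_op B (\<lambda>i j. \<tau> 1 i * cnj (\<tau> 1 j)) (\<tau> (F x)) i"
      proof -
        have "apply_op B (P (F x)) (\<tau> (F x)) i = apply_op B (\<lambda>i j. of_bool (i = j)) (\<tau> (F x)) i - apply_op B (\<lambda>i j. \<tau> 1 i * cnj (\<tau> 1 j)) (\<tau> (F x)) i"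
          using False by (simp add: P_def apply_op_def left_diff_distrib sum_subtractf)
        then show ?thesis using apply_op_identity [OF finB _ that, of "\<lambda>i j. of_bool (i = j)"] by simp
      qed
      then show ?thesis
        unfolding apply_rank_one Fx inner_on_\<tau> G_final by simp
    qed
    then have "norm_sq B (apply_op B (P (F x)) (query_state B \<psi>0 U x K)) = norm_sq B (\<lambda>i. \<tau> (F x) i + apply_op B (P (F x)) \<delta> i)"
      unfolding \<delta>_def apply_op_diff by (intro norm_sq_cong) simp
    also have "\<dots> \<ge> 5 / 6 * norm_sq B (\<tau> (F x)) - 5 * norm_sq B (apply_op B (P (F x)) \<delta>)"
      by (rule norm_sq_perturbation)
    moreover have "norm_sq B (\<tau> (F x)) = 1"
      using \<tau>1 [OF F [OF x]] unfolding inner_on_self by (simp only: of_real_eq_1_iff)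
    moreover have "norm_sq B (apply_op B (P (F x)) \<delta>) \<le> norm_sq B \<delta>"
      using projection_pythagoras [OF PM, of \<delta>] by simp
    ultimately show ?thesis using \<delta> by linarith
  qed
  ultimately show ?thesis
    unfolding quantum_computes_def Let_def
    by (intro exI [of _ d] exI [of _ \<psi>0] exI [of _ U] exI [of _ "{1, -1}"] exI [of _ P])
      (use U M F in \<open>auto simp: B_def\<close>)
qed

subsection \<open>Query vectors from the dual solution\<close>

lemma sum_indexed_queries:
  assumes "finite Q" "\<And>S. S \<in> Q \<Longrightarrow> finite S" "bij_betw e {..<m} J" "\<And>j. j \<in> J \<Longrightarrow> fst j \<in> Q"
  shows "(\<Sum>q\<in>(SIGMA S:Q. cube S). \<Sum>w<m. if fst (e w) = fst q then g (e w) (snd q) else 0)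
    = (\<Sum>j\<in>J. \<Sum>b\<in>cube (fst j). g j b)"
proof -
  have "(\<Sum>q\<in>(SIGMA S:Q. cube S). \<Sum>w<m. if fst (e w) = fst q then g (e w) (snd q) else 0)
      = (\<Sum>q\<in>(SIGMA S:Q. cube S). \<Sum>j\<in>J. if fst j = fst q then g j (snd q) else 0)"
    by (intro sum.cong refl sum.reindex_bij_betw [OF assms(3)])
  also have "\<dots> = (\<Sum>j\<in>J. \<Sum>q\<in>(SIGMA S:Q. cube S). if fst j = fst q then g j (snd q) else 0)"
    by (rule sum.swap)
  also have "\<dots> = (\<Sum>j\<in>J. \<Sum>S\<in>Q. \<Sum>b\<in>cube S. if fst j = S then g j b else 0)"
  proof (intro sum.cong refl)
    fix j
    show "(\<Sum>q\<in>(SIGMA S:Q. cube S). if fst j = fst q then g j (snd q) else 0) = (\<Sum>S\<in>Q. \<Sum>b\<in>cube S. if fst j = S then g j b else 0)"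
      using assms(1,2) by (subst sum.Sigma) (auto simp: case_prod_unfold)
  qed
  also have "\<dots> = (\<Sum>j\<in>J. \<Sum>S\<in>Q. if S = fst j then \<Sum>b\<in>cube (fst j). g j b else 0)"
    by (intro sum.cong refl) auto
  also have "\<dots> = (\<Sum>j\<in>J. \<Sum>b\<in>cube (fst j). g j b)"
    by (intro sum.cong refl) (use assms in simp)
  finally show ?thesis .
qed

lemma walsh_subcube:
  assumes "finite I" "S \<subseteq> I" "u \<in> subcube I S c"
  shows "walsh I u x = walsh (I - S) c x * walsh S u x"
proof -
  have "walsh (I - S) u x = walsh (I - S) c x"
    using assms(3) by (auto simp: subcube_def simp flip: walsh_restrict(1) [of _ u])
  then show ?thesis
    by (simp add: walsh_split [OF assms(1,2)])
qed

text \<open>Parseval in the directions \<open>S\<close>: distinct points of the subcube differ on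
  \<open>S\<close>, and the character at \<open>x\<close> is a sign that disappears in the
  square.\<close>

lemma subcube_parseval:
  fixes h :: "(nat \<Rightarrow> real) \<Rightarrow> real"
  assumes I: "finite I" "S \<subseteq> I" and c: "c \<in> cube (I - S)"
  shows "(\<Sum>b\<in>cube S. (\<Sum>u\<in>subcube I S c. h u * (walsh S u x * walsh S u b))\<^sup>2)
    = card (subcube I S c) * (\<Sum>u\<in>subcube I S c. (h u)\<^sup>2)"
proof -
  let ?C = "subcube I S c"
  let ?g = "\<lambda>u. h u * walsh S u x"
  have finS: "finite S" using I finite_subset by blast
  have orth: "(\<Sum>b\<in>cube S. walsh S u b * walsh S w b) = (if u = w then card ?C else 0)" if "u \<in> ?C" "w \<in> ?C" for u w
  proof -
    have mem: "u \<in> cube I" "w \<in> cube I" and eq: "restrict u (I - S) = restrict w (I - S)"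
      using that by (auto simp: subcube_def)
    have "(\<Sum>b\<in>cube S. walsh S u b * walsh S w b) = (\<Sum>b\<in>cube S. walsh S b (restrict u S) * walsh S b (restrict w S))"
      by (simp add: walsh_commute [of S u] walsh_commute [of S w])
    also have "\<dots> = (if restrict u S = restrict w S then 2 ^ card S else 0)"
      using mem I by (intro walsh_orthogonal finS) auto
    also have "restrict u S = restrict w S \<longleftrightarrow> u = w"
    proof
      assume S: "restrict u S = restrict w S"
      show "u = w"
      proof (rule cube_eqI [OF mem])
        fix i assume "i \<in> I"
        then show "u i = w i"
          using fun_cong [OF S, of i] fun_cong [OF eq, of i] by (cases "i \<in> S") auto
      qed
    qed simp
    finally show ?thesis
      by (simp add: card_subcube [OF I c])
  qed
  have "(\<Sum>b\<in>cube S. (\<Sum>u\<in>?C. h u * (walsh S u x * walsh S u b))\<^sup>2)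
      = (\<Sum>b\<in>cube S. \<Sum>u\<in>?C. \<Sum>w\<in>?C. ?g u * ?g w * (walsh S u b * walsh S w b))"
    unfolding power2_eq_square sum_product by (intro sum.cong refl) (simp add: mult_ac)
  also have "\<dots> = (\<Sum>u\<in>?C. \<Sum>b\<in>cube S. \<Sum>w\<in>?C. ?g u * ?g w * (walsh S u b * walsh S w b))"
    by (rule sum.swap)
  also have "\<dots> = (\<Sum>u\<in>?C. \<Sum>w\<in>?C. \<Sum>b\<in>cube S. ?g u * ?g w * (walsh S u b * walsh S w b))"
    by (intro sum.cong refl sum.swap)
  also have "\<dots> = (\<Sum>u\<in>?C. \<Sum>w\<in>?C. if w = u then card ?C * (h u)\<^sup>2 else 0)"
  proof (intro sum.cong refl)
    fix u w assume uw: "u \<in> ?C" "w \<in> ?C"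
    have "?g u * ?g u = (h u)\<^sup>2"
      using walsh_sq [of S u x] by (simp add: power2_eq_square algebra_simps)
    then show "(\<Sum>b\<in>cube S. ?g u * ?g w * (walsh S u b * walsh S w b)) = (if w = u then card ?C * (h u)\<^sup>2 else 0)"
      unfolding sum_distrib_left [symmetric] orth [OF uw] by auto
  qed
  also have "\<dots> = card ?C * (\<Sum>u\<in>?C. (h u)\<^sup>2)"
    using I by (simp add: sum_distrib_left)
  finally show ?thesis .
qed

text \<open>Each \<open>h j\<close> is split into two factors: \<open>\<alpha> j\<close> at the
  query that \<open>x\<close> answers with 1, and its transform over \<open>2 * \<alpha> j\<close>
  elsewhere. For separated \<open>x\<close> and \<open>y\<close> the product is half the transform
  of \<open>h j\<close> at the pair; for the others that transform vanishes because
  \<open>h j\<close> has sum zero. Summed over \<open>j\<close>, only two points remain, giving 1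
  and the product of the parities.\<close>

lemma query_vectors:
  fixes h :: "nat set \<times> (nat \<Rightarrow> real) \<Rightarrow> (nat \<Rightarrow> real) \<Rightarrow> real"
  assumes Q: "Q \<subseteq> Pow {1..n}"
  defines "J \<equiv> SIGMA S:Q. cube ({1..n} - S)"
  defines "C \<equiv> \<lambda>j. subcube {1..n} (fst j) (snd j)"
  defines "W \<equiv> \<lambda>j. sqrt (card (C j)) * L2_set (h j) (C j)"
  assumes supp: "\<And>j u. j \<in> J \<Longrightarrow> u \<in> cube {1..n} \<Longrightarrow> u \<notin> C j \<Longrightarrow> h j u = 0"
    and zero: "\<And>j. j \<in> J \<Longrightarrow> (\<Sum>u\<in>C j. h j u) = 0"
    and decomp: "\<And>u. u \<in> cube {1..n} \<Longrightarrow> (\<Sum>j\<in>J. h j u)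
        = (of_bool (u = (\<lambda>i\<in>{1..n}. 1)) - of_bool (u = (\<lambda>i\<in>{1..n}. -1))) / 2"
  shows "\<exists>m v. (\<forall>x\<in>cube {1..n}. query_inner Q m (v x) (v x) \<le> (\<Sum>j\<in>J. W j)) \<and>
    (\<forall>x\<in>cube {1..n}. \<forall>y\<in>cube {1..n}. 4 * (\<Sum>q\<in>(SIGMA S:Q. cube S). \<Sum>w<m.
        if restrict x (fst q) = snd q \<and> restrict y (fst q) \<noteq> snd q then v x q w * v y q w else 0)
      = 1 - parity n x * parity n y)"
proof -
  let ?I = "{1..n}"
  have finQ: "finite Q" and finS: "\<And>S. S \<in> Q \<Longrightarrow> finite S"
    using Q by (auto intro: finite_subset)
  have finJ: "finite J"
    unfolding J_def using finQ by (intro finite_SigmaI) auto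
  have J: "fst j \<in> Q" "fst j \<subseteq> ?I" "snd j \<in> cube (?I - fst j)" if "j \<in> J" for j
  proof -
    show "fst j \<in> Q" "snd j \<in> cube (?I - fst j)"
      using that by (auto simp: J_def)
    then show "fst j \<subseteq> ?I"
      using Q by blast
  qed
  obtain e where e: "bij_betw e {..<card J} J"
    using ex_bij_betw_nat_finite [OF finJ] by (auto simp: atLeast0LessThan)
  note sum_J = sum_indexed_queries [OF finQ finS e J(1)]
  define k where "k j x b = (\<Sum>u\<in>C j. h j u * (walsh (fst j) u x * walsh (fst j) u b))" for j x b
  \<comment> \<open>This value balances the two contributions to the norm,
    \<open>\<alpha>\<^sup>2\<close> and \<open>W\<^sup>2 / (4 * \<alpha>\<^sup>2)\<close>, at
    \<open>W / 2\<close> each.\<close>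
  define \<alpha> where "\<alpha> j = sqrt (W j / 2)" for j
  have W: "W j \<ge> 0" for j by (simp add: W_def)
  have \<alpha>_sq: "\<alpha> j * \<alpha> j = W j / 2" for j
    using W by (simp add: \<alpha>_def)
  have k_parseval: "(\<Sum>b\<in>cube (fst j). (k j x b)\<^sup>2) = (W j)\<^sup>2" if "j \<in> J" for j x
    unfolding k_def W_def C_def
    by (subst subcube_parseval) (use J [OF that] in \<open>simp_all add: power_mult_distrib L2_set_def sum_nonneg\<close>)
  \<comment> \<open>If \<open>\<alpha> j\<close> is 0, the quotient is 0 by convention, and Parseval
    forces \<open>k j x b\<close> to be 0 too.\<close>
  have k_half: "\<alpha> j * (k j x b / (2 * \<alpha> j)) = k j x b / 2" if "j \<in> J" "b \<in> cube (fst j)" for j x b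
  proof (cases "\<alpha> j = 0")
    case True
    then have "(\<Sum>b\<in>cube (fst j). (k j x b)\<^sup>2) = 0"
      using \<alpha>_sq [of j] k_parseval [OF that(1)] by simp
    then show ?thesis
      using that finS [OF J(1) [OF that(1)]] by (simp add: sum_nonneg_eq_0_iff)
  qed simp
  define V where "V x j b = walsh (?I - fst j) (snd j) x * (if restrict x (fst j) = b then \<alpha> j else k j x b / (2 * \<alpha> j))" for x j b
  define v where "v x q w = (if fst (e w) = fst q then V x (e w) (snd q) else 0)" for x q w
  show ?thesis
  proof (intro exI [of _ "card J"] exI [of _ v] conjI ballI)
    fix x assume x: "x \<in> cube ?I"
    have "query_inner Q (card J) (v x) (v x)
        = (\<Sum>q\<in>(SIGMA S:Q. cube S). \<Sum>w<card J. if fst (e w) = fst q then (V x (e w) (snd q))\<^sup>2 else 0)"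
      unfolding query_inner_def v_def by (intro sum.cong refl) (simp add: power2_eq_square)
    also have "\<dots> = (\<Sum>j\<in>J. \<Sum>b\<in>cube (fst j). (V x j b)\<^sup>2)"
      by (rule sum_J)
    also have "\<dots> \<le> (\<Sum>j\<in>J. W j)"
    proof (rule sum_mono)
      fix j assume j: "j \<in> J"
      let ?b = "restrict x (fst j)"
      have finC: "finite (cube (fst j))"
        using finS [OF J(1) [OF j]] by simp
      have "(V x j b)\<^sup>2 \<le> (if b = ?b then (\<alpha> j)\<^sup>2 else 0) + (k j x b)\<^sup>2 / (4 * (\<alpha> j)\<^sup>2)" for b
      proof -
        have "(walsh (?I - fst j) (snd j) x)\<^sup>2 = 1" by (simp add: power2_eq_square)
        then show ?thesis
          unfolding V_def power_mult_distrib by (simp add: power_divide power_mult_distrib)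
      qed
      then have "(\<Sum>b\<in>cube (fst j). (V x j b)\<^sup>2) \<le> (\<Sum>b\<in>cube (fst j). (if b = ?b then (\<alpha> j)\<^sup>2 else 0) + (k j x b)\<^sup>2 / (4 * (\<alpha> j)\<^sup>2))"
        by (rule sum_mono)
      also have "\<dots> = (\<alpha> j)\<^sup>2 + (W j)\<^sup>2 / (4 * (\<alpha> j)\<^sup>2)"
        using finC restrict_cube [OF x J(2) [OF j]] by (simp add: sum.distrib k_parseval [OF j] flip: sum_divide_distrib)
      also have "\<dots> = W j"
        unfolding power2_eq_square [of "\<alpha> j"] \<alpha>_sq by (cases "W j = 0") (simp_all add: power2_eq_square)
      finally show "(\<Sum>b\<in>cube (fst j). (V x j b)\<^sup>2) \<le> W j" .
    qed
    finally show "query_inner Q (card J) (v x) (v x) \<le> (\<Sum>j\<in>J. W j)" .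
  next
    fix x y assume x: "x \<in> cube ?I" and y: "y \<in> cube ?I"
    let ?one = "\<lambda>i\<in>?I. 1 :: real" and ?mone = "\<lambda>i\<in>?I. -1 :: real"
    have "(\<Sum>q\<in>(SIGMA S:Q. cube S). \<Sum>w<card J.
          if restrict x (fst q) = snd q \<and> restrict y (fst q) \<noteq> snd q then v x q w * v y q w else 0)
        = (\<Sum>q\<in>(SIGMA S:Q. cube S). \<Sum>w<card J. if fst (e w) = fst q then
          (if restrict x (fst (e w)) = snd q \<and> restrict y (fst (e w)) \<noteq> snd q then V x (e w) (snd q) * V y (e w) (snd q) else 0) else 0)"
      unfolding v_def by (intro sum.cong refl) auto
    also have "\<dots> = (\<Sum>j\<in>J. \<Sum>b\<in>cube (fst j). if restrict x (fst j) = b \<and> restrict y (fst j) \<noteq> b then V x j b * V y j b else 0)"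
      by (rule sum_J)
    also have "\<dots> = (\<Sum>j\<in>J. \<Sum>u\<in>cube ?I. h j u / 2 * (walsh ?I u x * walsh ?I u y))"
    proof (rule sum.cong [OF refl])
      fix j assume j: "j \<in> J"
      let ?S = "fst j" and ?b = "restrict x (fst j)"
      let ?E = "walsh (?I - ?S) (snd j) x * walsh (?I - ?S) (snd j) y"
      have b: "?b \<in> cube ?S" by (rule restrict_cube [OF x J(2) [OF j]])
      have "(\<Sum>u\<in>cube ?I. h j u / 2 * (walsh ?I u x * walsh ?I u y)) = (\<Sum>u\<in>C j. h j u / 2 * (walsh ?I u x * walsh ?I u y))"
        by (rule sum.mono_neutral_right) (auto simp: C_def subcube_def supp [OF j, unfolded C_def subcube_def])
      also have "\<dots> = ?E / 2 * (\<Sum>u\<in>C j. h j u * (walsh ?S u x * walsh ?S u y))"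
        unfolding sum_distrib_left C_def
      proof (intro sum.cong refl)
        fix u assume u: "u \<in> subcube ?I ?S (snd j)"
        show "h j u / 2 * (walsh ?I u x * walsh ?I u y) = ?E / 2 * (h j u * (walsh ?S u x * walsh ?S u y))"
          unfolding walsh_subcube [OF finite_atLeastAtMost J(2) [OF j] u] by simp
      qed
      also have "\<dots> = (if ?b \<noteq> restrict y ?S then V x j ?b * V y j ?b else 0)"
      proof (cases "?b = restrict y ?S")
        case True
        then have "walsh ?S u x = walsh ?S u y" for u
          by (metis walsh_restrict(2))
        then show ?thesis
          using True zero [OF j] by simp
      next
        case False
        have "V x j ?b * V y j ?b = ?E * (\<alpha> j * (k j y ?b / (2 * \<alpha> j)))"
          using False by (simp add: V_def)
        also have "\<dots> = ?E / 2 * k j y ?b"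
          unfolding k_half [OF j b] by simp
        also have "k j y ?b = (\<Sum>u\<in>C j. h j u * (walsh ?S u x * walsh ?S u y))"
          by (simp add: k_def mult_ac)
        finally show ?thesis unfolding if_P [OF False] by (rule sym)
      qed
      also have "\<dots> = (\<Sum>b\<in>cube ?S. if b = ?b then (if ?b \<noteq> restrict y ?S then V x j ?b * V y j ?b else 0) else 0)"
        using b finS [OF J(1) [OF j]] by simp
      also have "\<dots> = (\<Sum>b\<in>cube ?S. if ?b = b \<and> restrict y ?S \<noteq> b then V x j b * V y j b else 0)"
        by (intro sum.cong refl) auto
      finally show "(\<Sum>b\<in>cube ?S. if ?b = b \<and> restrict y ?S \<noteq> b then V x j b * V y j b else 0)
          = (\<Sum>u\<in>cube ?I. h j u / 2 * (walsh ?I u x * walsh ?I u y))" ..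
    qed
    also have "\<dots> = (\<Sum>u\<in>cube ?I. \<Sum>j\<in>J. h j u / 2 * (walsh ?I u x * walsh ?I u y))"
      by (rule sum.swap)
    also have "\<dots> = (\<Sum>u\<in>cube ?I. (\<Sum>j\<in>J. h j u) / 2 * (walsh ?I u x * walsh ?I u y))"
      unfolding sum_divide_distrib sum_distrib_right ..
    \<comment> \<open>The quarter is one half from the product of the \<open>V\<close> entries and
      one half from the decomposed target.\<close>
    also have "\<dots> = (\<Sum>u\<in>cube ?I. (if u = ?one then walsh ?I ?one x * walsh ?I ?one y / 4 else 0)
        - (if u = ?mone then walsh ?I ?mone x * walsh ?I ?mone y / 4 else 0))"
    proof (rule sum.cong [OF refl])
      show "(\<Sum>j\<in>J. h j u) / 2 * (walsh ?I u x * walsh ?I u y) = (if u = ?one then walsh ?I ?one x * walsh ?I ?one y / 4 else 0)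
        - (if u = ?mone then walsh ?I ?mone x * walsh ?I ?mone y / 4 else 0)" if "u \<in> cube ?I" for u
        unfolding decomp [OF that] by (cases "u = ?one"; cases "u = ?mone") simp_all
    qed
    also have "\<dots> = (1 - parity n x * parity n y) / 4"
    proof -
      have "?mone \<in> cube ?I" by (auto simp: cube_def PiE_iff extensional_def)
      then show ?thesis
        unfolding sum_subtractf walsh_one walsh_minus_one [OF x] walsh_minus_one [OF y]
        using one_cube [of ?I] by (simp add: diff_divide_distrib)
    qed
    finally show "4 * (\<Sum>q\<in>(SIGMA S:Q. cube S). \<Sum>w<card J.
          if restrict x (fst q) = snd q \<and> restrict y (fst q) \<noteq> snd q then v x q w * v y q w else 0)
        = 1 - parity n x * parity n y"
      by simp
  qed
qed

subsection \<open>The two bounds\<close>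

lemma variance_on_nonneg [simp]: "0 \<le> variance_on C f"
  by (simp add: variance_on_def sum_nonneg)

lemma sqrt_variance_on: "sqrt (variance_on C f) = L2_set (\<lambda>u. f u - (\<Sum>w\<in>C. f w) / card C) C / sqrt (card C)"
  by (simp add: variance_on_def L2_set_def real_sqrt_divide)

text \<open>The standard deviation is a seminorm; the half-difference is the shape of the odd part
  of a function.\<close>

lemma sqrt_variance_on_half_diff:
  "sqrt (variance_on C (\<lambda>u. (f u - g u) / 2)) \<le> (sqrt (variance_on C f) + sqrt (variance_on C g)) / 2"
proof -
  let ?m = "\<lambda>f. (\<Sum>w\<in>C. f w) / card C"
  let ?l = "\<lambda>f. L2_set (\<lambda>u. f u - ?m f) C"
  have "?m (\<lambda>u. (f u - g u) / 2) = (?m f - ?m g) / 2"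
    by (simp add: sum_subtractf diff_divide_distrib flip: sum_divide_distrib)
  moreover have "(f u - g u) / 2 - (a - b) / 2 = 1 / 2 * (f u - a) + 1 / 2 * - (g u - b)" for u a b
    by (simp add: field_simps)
  ultimately have "?l (\<lambda>u. (f u - g u) / 2) = L2_set (\<lambda>u. 1 / 2 * (f u - ?m f) + 1 / 2 * - (g u - ?m g)) C"
    by (simp only:)
  also have "\<dots> \<le> L2_set (\<lambda>u. 1 / 2 * (f u - ?m f)) C + L2_set (\<lambda>u. 1 / 2 * - (g u - ?m g)) C"
    by (rule L2_set_triangle_ineq)
  also have "\<dots> = 1 / 2 * ?l f + 1 / 2 * L2_set (\<lambda>u. - (g u - ?m g)) C"
    by (simp only: L2_set_right_distrib [symmetric, of "1 / 2 :: real"] zero_le_divide_1_iff zero_le_numeral)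
  also have "L2_set (\<lambda>u. - (g u - ?m g)) C = ?l g"
    unfolding L2_set_def by (simp only: power2_minus)
  finally have "?l (\<lambda>u. (f u - g u) / 2) \<le> (?l f + ?l g) / 2"
    by simp
  then have "?l (\<lambda>u. (f u - g u) / 2) / sqrt (card C) \<le> (?l f + ?l g) / 2 / sqrt (card C)"
    by (intro divide_right_mono) auto
  then show ?thesis
    by (simp add: sqrt_variance_on add_divide_distrib)
qed

lemma variance_on_le:
  assumes "finite C" "\<And>u. u \<in> C \<Longrightarrow> \<bar>f u\<bar> \<le> 1"
  shows "variance_on C f \<le> 1"
proof (cases "C = {}")
  case True
  then show ?thesis by (simp add: variance_on_def)
next
  case False
  define m where "m = (\<Sum>w\<in>C. f w) / card C"
  have card: "real (card C) > 0" using assms(1) False by (simp add: card_gt_0_iff)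
  have "(\<Sum>u\<in>C. (f u - m)\<^sup>2) = (\<Sum>u\<in>C. (f u)\<^sup>2) - 2 * m * (\<Sum>u\<in>C. f u) + card C * m\<^sup>2"
  proof -
    have "(\<Sum>u\<in>C. (f u - m)\<^sup>2) = (\<Sum>u\<in>C. (f u)\<^sup>2 - 2 * m * f u + m\<^sup>2)"
      by (simp add: power2_diff algebra_simps)
    then show ?thesis
      by (simp only: sum.distrib sum_subtractf sum_distrib_left [symmetric] sum_constant)
  qed
  also have "(\<Sum>u\<in>C. f u) = card C * m"
    using card by (simp add: m_def)
  also have "(\<Sum>u\<in>C. (f u)\<^sup>2) - 2 * m * (card C * m) + card C * m\<^sup>2 = (\<Sum>u\<in>C. (f u)\<^sup>2) - card C * m\<^sup>2"
    by (simp add: power2_eq_square)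
  also have "\<dots> \<le> (\<Sum>u\<in>C. (f u)\<^sup>2)"
    by simp
  also have "\<dots> \<le> (\<Sum>u\<in>C. 1)"
    using assms(2) by (intro sum_mono) (simp add: abs_square_le_1)
  finally have "(\<Sum>u\<in>C. (f u - m)\<^sup>2) \<le> card C" by simp
  then show ?thesis
    using card by (simp add: variance_on_def m_def field_simps)
qed

text \<open>Negation carries the subcube with fixed part \<open>c\<close> to the one with fixed part
  \<open>-c\<close>. With the seminorm inequality, passing to the odd part cannot raise the largest
  standard deviation over all subcubes.\<close>

lemma variance_on_subcube_uminus:
  assumes "S \<subseteq> {1..n}" "c \<in> cube ({1..n} - S)"
  shows "variance_on (subcube {1..n} S c) (\<lambda>u. f (\<lambda>i\<in>{1..n}. - u i))
    = variance_on (subcube {1..n} S (\<lambda>i\<in>{1..n} - S. - c i)) f"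
proof -
  let ?m = "\<lambda>u. \<lambda>i\<in>{1..n}. - u i :: real"
  let ?C = "subcube {1..n} S c" and ?D = "subcube {1..n} S (\<lambda>i\<in>{1..n} - S. - c i)"
  have mm: "?m (?m u) = u" if "u \<in> cube {1..n}" for u
    by (rule cube_eqI [OF uminus_cube [OF uminus_cube [OF that]] that]) simp
  have CD: "?m u \<in> ?D" if "u \<in> ?C" for u
  proof -
    have "c = restrict u ({1..n} - S)" using that by (simp add: subcube_def)
    then have "restrict (?m u) ({1..n} - S) = (\<lambda>i\<in>{1..n} - S. - c i)" by (auto simp: fun_eq_iff)
    then show ?thesis
      using that uminus_cube [of u "{1..n}"] unfolding subcube_def by blast
  qed
  have DC: "?m u \<in> ?C" if u: "u \<in> ?D" for u
  proof -
    have "restrict (?m u) ({1..n} - S) = c"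
    proof (rule cube_eqI [OF _ assms(2)])
      show "restrict (?m u) ({1..n} - S) \<in> cube ({1..n} - S)"
        using u by (intro restrict_cube [OF uminus_cube]) (auto simp: subcube_def)
      fix i assume i: "i \<in> {1..n} - S"
      have "restrict u ({1..n} - S) i = - c i"
        using u i by (simp add: subcube_def)
      then show "restrict (?m u) ({1..n} - S) i = c i"
        using i by simp
    qed
    then show ?thesis
      using u uminus_cube [of u "{1..n}"] unfolding subcube_def by blast
  qed
  have bij: "bij_betw ?m ?C ?D"
  proof (rule bij_betw_byWitness [where f' = ?m])
    show "\<forall>u\<in>?C. ?m (?m u) = u" "\<forall>u\<in>?D. ?m (?m u) = u"
      using mm unfolding subcube_def by blast+
    show "?m ` ?C \<subseteq> ?D" "?m ` ?D \<subseteq> ?C"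
      using CD DC by blast+
  qed
  show ?thesis
    unfolding variance_on_def bij_betw_same_card [OF bij]
      sum.reindex_bij_betw [OF bij, of f] sum.reindex_bij_betw [OF bij, of "\<lambda>u. (f u - _)\<^sup>2"] ..
qed

section \<open>From suprema in the extended reals to real inequalities\<close>

lemma max_sd_le_iff:
  assumes "Q \<subseteq> Pow {1..n}" "0 \<le> M"
  shows "max_sd n Q f \<le> ennreal M \<longleftrightarrow>
    (\<forall>S\<in>Q. \<forall>c\<in>cube ({1..n} - S). sqrt (variance_on (subcube {1..n} S c) f) \<le> M)"
proof -
  have "cube_variance S (subfunction n f S c) = variance_on (subcube {1..n} S c) f"
    if "S \<in> Q" "c \<in> cube ({1..n} - S)" for S c
    using assms(1) that by (intro cube_variance_subfunction) auto
  then show ?thesis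
    unfolding max_sd_def SUP_le_iff using assms(2) by (simp add: ennreal_le_iff cong: ball_cong)
qed

text \<open>There are finitely many subcubes, and the sum of all their standard deviations is a
  finite bound.\<close>

lemma max_sd_finite:
  assumes "Q \<subseteq> Pow {1..n}"
  obtains \<sigma> where "0 \<le> \<sigma>" "max_sd n Q f = ennreal \<sigma>"
proof -
  let ?s = "\<lambda>(S, c). sqrt (variance_on (subcube {1..n} S c) f)"
  let ?J = "SIGMA S:Q. cube ({1..n} - S)"
  have "finite Q" using assms finite_subset by blast
  then have fin: "finite ?J" by (intro finite_SigmaI) auto
  have "max_sd n Q f \<le> ennreal (sum ?s ?J)"
  proof (subst max_sd_le_iff [OF assms])
    show "0 \<le> sum ?s ?J" by (intro sum_nonneg) auto
    show "\<forall>S\<in>Q. \<forall>c\<in>cube ({1..n} - S). sqrt (variance_on (subcube {1..n} S c) f) \<le> sum ?s ?J"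
    proof (intro ballI)
      fix S c assume "S \<in> Q" "c \<in> cube ({1..n} - S)"
      then have "(S, c) \<in> ?J" by blast
      moreover have "0 \<le> ?s j" for j by (cases j) simp
      ultimately have "?s (S, c) \<le> sum ?s ?J"
        by (intro member_le_sum fin)
      then show "sqrt (variance_on (subcube {1..n} S c) f) \<le> sum ?s ?J"
        by (simp only: prod.case)
    qed
  qed
  then have "max_sd n Q f < top"
    by (rule le_less_trans) (rule ennreal_less_top)
  then show ?thesis
    using that [of "enn2real (max_sd n Q f)"] by simp
qed

lemma sup_norm_attained:
  obtains u where "u \<in> cube {1..n}" "sup_norm n f = \<bar>f u\<bar>" "\<And>w. w \<in> cube {1..n} \<Longrightarrow> \<bar>f w\<bar> \<le> \<bar>f u\<bar>"
proof -
  have fin: "finite ((\<lambda>x. \<bar>f x\<bar>) ` cube {1..n})" by simp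
  then have "sup_norm n f \<in> (\<lambda>x. \<bar>f x\<bar>) ` cube {1..n}"
    unfolding sup_norm_def by (rule Max_in) simp
  then obtain u where u: "u \<in> cube {1..n}" "sup_norm n f = \<bar>f u\<bar>" by auto
  have "\<bar>f w\<bar> \<le> sup_norm n f" if "w \<in> cube {1..n}" for w
    unfolding sup_norm_def using fin that by (intro Max_ge) auto
  then show ?thesis
    by (intro that [OF u]) (simp only: u(2))
qed

text \<open>The condition covers a vanishing denominator, where the ratio is \<open>\<infinity>\<close>.\<close>

lemma ratio_le_iff:
  assumes "0 < a" "0 \<le> \<sigma>" "0 \<le> r"
  shows "ennreal a / ennreal \<sigma> \<le> ennreal r \<longleftrightarrow> a \<le> r * \<sigma>"
proof (cases "\<sigma> = 0")
  case True
  then show ?thesis using assms by (simp add: ennreal_divide_zero top_unique not_le)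
next
  case False
  then have "\<sigma> > 0" using assms(2) by simp
  then show ?thesis using assms by (simp add: divide_ennreal ennreal_le_iff pos_divide_le_eq)
qed

text \<open>Clears the denominator. If \<open>\<sigma> = 0\<close>, the real inequality fails for a
  nonzero \<open>f\<close>, in agreement with an infinite ratio.\<close>

lemma val_Q_le_iff:
  assumes "Q \<subseteq> Pow {1..n}" "0 \<le> r"
  shows "val_Q n Q \<le> ennreal r \<longleftrightarrow>
    (\<forall>f \<sigma>. odd_on_cube n f \<longrightarrow> (\<exists>x\<in>cube {1..n}. f x \<noteq> 0) \<longrightarrow> 0 \<le> \<sigma> \<longrightarrow> max_sd n Q f = ennreal \<sigma>
      \<longrightarrow> sup_norm n f \<le> r * \<sigma>)"
proof -
  have ratio: "ennreal (sup_norm n f) / ennreal \<sigma> \<le> ennreal r \<longleftrightarrow> sup_norm n f \<le> r * \<sigma>"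
    if f: "\<exists>x\<in>cube {1..n}. f x \<noteq> 0" and \<sigma>: "0 \<le> \<sigma>" for f \<sigma>
  proof (rule ratio_le_iff [OF _ \<sigma> assms(2)])
    obtain x where x: "x \<in> cube {1..n}" "f x \<noteq> 0"
      using f by blast
    obtain u where "sup_norm n f = \<bar>f u\<bar>" "\<bar>f x\<bar> \<le> \<bar>f u\<bar>"
      using x(1) sup_norm_attained [of n f] by metis
    then show "0 < sup_norm n f"
      using x(2) by linarith
  qed
  show ?thesis
  proof (intro iffI allI impI)
    fix f \<sigma> assume le: "val_Q n Q \<le> ennreal r" and f: "odd_on_cube n f" "\<exists>x\<in>cube {1..n}. f x \<noteq> 0"
      and \<sigma>: "0 \<le> \<sigma>" "max_sd n Q f = ennreal \<sigma>"
    have "ennreal (sup_norm n f) / max_sd n Q f \<le> val_Q n Q"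
      unfolding val_Q_def by (rule SUP_upper) (simp only: mem_Collect_eq f simp_thms)
    then show "sup_norm n f \<le> r * \<sigma>"
      using le ratio [OF f(2) \<sigma>(1)] \<sigma>(2) by (metis order_trans)
  next
    assume le: "\<forall>f \<sigma>. odd_on_cube n f \<longrightarrow> (\<exists>x\<in>cube {1..n}. f x \<noteq> 0) \<longrightarrow> 0 \<le> \<sigma> \<longrightarrow> max_sd n Q f = ennreal \<sigma>
      \<longrightarrow> sup_norm n f \<le> r * \<sigma>"
    show "val_Q n Q \<le> ennreal r"
      unfolding val_Q_def
    proof (rule SUP_least)
      fix f assume "f \<in> {f. odd_on_cube n f \<and> (\<exists>x\<in>cube {1..n}. f x \<noteq> 0)}"
      then have f: "odd_on_cube n f" "\<exists>x\<in>cube {1..n}. f x \<noteq> 0" by blast+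
      obtain \<sigma> where \<sigma>: "0 \<le> \<sigma>" "max_sd n Q f = ennreal \<sigma>"
        by (rule max_sd_finite [OF assms(1)])
      show "ennreal (sup_norm n f) / max_sd n Q f \<le> ennreal r"
        unfolding \<sigma>(2) ratio [OF f(2) \<sigma>(1)] using le f \<sigma> by blast
    qed
  qed
qed

lemma val_Q_lower:
  assumes Q: "Q \<subseteq> Pow {1..n}" and T: "quantum_computes n Q (parity n) T"
  shows "val_Q n Q \<le> ennreal (36 * real T)"
proof (subst val_Q_le_iff [OF Q], simp, intro allI impI)
  fix f \<sigma> assume f: "odd_on_cube n f" and \<sigma>: "0 \<le> \<sigma>" "max_sd n Q f = ennreal \<sigma>"
  obtain u where u: "u \<in> cube {1..n}" "sup_norm n f = \<bar>f u\<bar>" "\<And>w. w \<in> cube {1..n} \<Longrightarrow> \<bar>f w\<bar> \<le> \<bar>f u\<bar>"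
    by (rule sup_norm_attained [of n f]) (rule that)
  have "\<forall>S\<in>Q. \<forall>c\<in>cube ({1..n} - S). sqrt (variance_on (subcube {1..n} S c) f) \<le> \<sigma>"
    using max_sd_le_iff [OF Q \<sigma>(1), of f] \<sigma>(2) by simp
  then show "sup_norm n f \<le> 36 * real T * \<sigma>"
    unfolding u(2) by (intro adversary_bound [OF Q T f u(1,3) _ \<sigma>(1)]) auto
qed

lemma coordinate_abs:
  assumes "n \<ge> 1" "x \<in> cube {1..n}"
  shows "\<bar>x 1\<bar> = 1"
proof -
  have "1 \<in> {1..n}" using assms(1) by simp
  from cube_values [OF assms(2) this] show ?thesis by auto
qed

text \<open>The first coordinate is an odd function of norm 1, the test function for both facts
  about \<open>val_Q\<close> that follow.\<close>

lemma coordinate_ratio_le: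
  assumes "n \<ge> 1"
  shows "ennreal 1 / max_sd n Q (\<lambda>x. x 1) \<le> val_Q n Q"
proof -
  obtain u where "u \<in> cube {1..n}" "sup_norm n (\<lambda>x. x 1) = \<bar>u 1\<bar>"
    by (rule sup_norm_attained [of n "\<lambda>x. x 1"]) (rule that)
  then have "sup_norm n (\<lambda>x. x 1) = 1"
    using coordinate_abs [OF assms] by simp
  moreover have "ennreal (sup_norm n (\<lambda>x. x 1)) / max_sd n Q (\<lambda>x. x 1) \<le> val_Q n Q"
    unfolding val_Q_def
  proof (intro SUP_upper CollectI conjI)
    show "odd_on_cube n (\<lambda>x. x 1)"
      using assms by (simp add: odd_on_cube_def)
    show "\<exists>x\<in>cube {1..n}. x 1 \<noteq> 0"
      by (rule bexI [OF _ one_cube]) (use assms in simp)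
  qed
  ultimately show ?thesis by (simp only:)
qed

text \<open>A coordinate has standard deviation at most 1 on every subcube. The bound lets the
  rounding to an integer number of queries be absorbed in the constant.\<close>

lemma val_Q_ge_1:
  assumes "n \<ge> 1" "Q \<subseteq> Pow {1..n}"
  shows "1 \<le> val_Q n Q"
proof -
  let ?f = "\<lambda>x :: nat \<Rightarrow> real. x 1"
  have "max_sd n Q ?f \<le> ennreal 1"
  proof (subst max_sd_le_iff [OF assms(2)])
    show "\<forall>S\<in>Q. \<forall>c\<in>cube ({1..n} - S). sqrt (variance_on (subcube {1..n} S c) ?f) \<le> 1"
    proof (intro ballI)
      fix S c
      have "variance_on (subcube {1..n} S c) ?f \<le> 1"
      proof (rule variance_on_le)
        fix u assume "u \<in> subcube {1..n} S c"
        then have "u \<in> cube {1..n}" by (simp add: subcube_def)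
        then show "\<bar>u 1\<bar> \<le> 1" using coordinate_abs [OF assms(1)] by simp
      qed simp
      then show "sqrt (variance_on (subcube {1..n} S c) ?f) \<le> 1" by simp
    qed
  qed simp
  moreover obtain \<sigma> where \<sigma>: "0 \<le> \<sigma>" "max_sd n Q ?f = ennreal \<sigma>"
    by (rule max_sd_finite [OF assms(2)])
  ultimately have \<sigma>1: "\<sigma> \<le> 1"
    by (simp add: ennreal_le_iff)
  have "1 \<le> ennreal 1 / ennreal \<sigma>"
  proof (cases "\<sigma> = 0")
    case False
    then have "1 / \<sigma> \<ge> 1" using \<sigma>(1) \<sigma>1 by simp
    then have "ennreal 1 \<le> ennreal (1 / \<sigma>)" by (rule ennreal_leI)
    also have "\<dots> = ennreal 1 / ennreal \<sigma>"
      using False \<sigma>(1) by (intro divide_ennreal [symmetric]) simp_all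
    finally show ?thesis by simp
  qed simp
  also have "\<dots> \<le> val_Q n Q"
    using coordinate_ratio_le [OF assms(1), of Q] unfolding \<sigma>(2) .
  finally show ?thesis .
qed

text \<open>The denominator is an empty supremum, that is 0. A finite \<open>val_Q\<close> therefore
  provides a query index to hold the public register.\<close>

lemma val_Q_empty:
  assumes "n \<ge> 1"
  shows "val_Q n {} = top"
  using coordinate_ratio_le [OF assms, of "{}"]
  by (simp add: max_sd_def bot_ennreal top_unique)

text \<open>\<open>val_Q\<close> bounds a linear functional by standard deviations; duality turns
  this into a decomposition of weight at most \<open>L\<close>, whose transforms are the query
  vectors that run the catalytic algorithm.\<close>

lemma val_Q_upper:
  assumes n: "n \<ge> 1" and Q: "Q \<subseteq> Pow {1..n}" and L: "val_Q n Q \<le> ennreal L" "0 < L"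
    and K: "K > 0" "72 * L \<le> real K"
  shows "quantum_computes n Q (parity n) K"
proof -
  let ?I = "{1..n}" and ?one = "\<lambda>i\<in>{1..n}. 1 :: real" and ?mone = "\<lambda>i\<in>{1..n}. -1 :: real"
  let ?J = "SIGMA S:Q. cube (?I - S)" and ?C = "\<lambda>j. subcube ?I (fst j) (snd j)"
  \<comment> \<open>Pairing \<open>f\<close> with \<open>?z\<close> evaluates its odd part at the
    all-ones point.\<close>
  let ?z = "\<lambda>u. (of_bool (u = ?one) - of_bool (u = ?mone)) / 2 :: real"
  have finQ: "finite Q" using Q finite_subset by blast
  have Q_ne: "Q \<noteq> {}" using val_Q_empty [OF n] L by (auto simp: top_unique)
  have mone: "?mone \<in> cube ?I" by (auto simp: cube_def PiE_iff extensional_def)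
  have bound: "(\<Sum>u\<in>cube ?I. f u * ?z u) \<le> L * M"
    if M: "0 \<le> M" and sd: "\<And>j. j \<in> ?J \<Longrightarrow> sqrt (variance_on (?C j) f) \<le> M" for f M
  proof -
    define g where "g u = (f u - f (\<lambda>i\<in>?I. - u i)) / 2" for u
    have neg: "(\<lambda>i\<in>?I. - (\<lambda>i\<in>?I. - u i) i) = u" if "u \<in> cube ?I" for u :: "nat \<Rightarrow> real"
      by (rule cube_eqI [OF uminus_cube [OF uminus_cube [OF that]] that]) simp
    have "odd_on_cube n g"
      unfolding odd_on_cube_def g_def using neg by (simp add: field_simps)
    obtain \<sigma> where \<sigma>: "0 \<le> \<sigma>" "max_sd n Q g = ennreal \<sigma>"
      by (rule max_sd_finite [OF Q])
    have "max_sd n Q g \<le> ennreal M"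
    proof (subst max_sd_le_iff [OF Q M], intro ballI)
      fix S c assume S: "S \<in> Q" and c: "c \<in> cube (?I - S)"
      have SI: "S \<subseteq> ?I" using S Q by auto
      have "sqrt (variance_on (subcube ?I S c) g)
          \<le> (sqrt (variance_on (subcube ?I S c) f) + sqrt (variance_on (subcube ?I S c) (\<lambda>u. f (\<lambda>i\<in>?I. - u i)))) / 2"
        unfolding g_def by (rule sqrt_variance_on_half_diff)
      also have "\<dots> \<le> (M + M) / 2"
        unfolding variance_on_subcube_uminus [OF SI c]
        using sd [of "(S, c)"] sd [of "(S, \<lambda>i\<in>?I - S. - c i)"] S c uminus_cube [OF c]
        by (intro divide_right_mono add_mono) auto
      finally show "sqrt (variance_on (subcube ?I S c) g) \<le> M" by simp
    qed
    then have "\<sigma> \<le> M" using \<sigma> M by (simp add: ennreal_le_iff)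
    have "(\<Sum>u\<in>cube ?I. f u * ?z u) = (\<Sum>u\<in>cube ?I. (if u = ?one then f u / 2 else 0) - (if u = ?mone then f u / 2 else 0))"
      by (intro sum.cong refl) simp
    also have "\<dots> = (f ?one - f ?mone) / 2"
      unfolding sum_subtractf using one_cube [of ?I] mone by (simp add: diff_divide_distrib)
    also have "\<dots> = g ?one"
    proof -
      have "(\<lambda>i\<in>?I. - ?one i) = ?mone" by auto
      then show ?thesis by (simp only: g_def)
    qed
    also have "\<dots> \<le> L * \<sigma>"
    proof (cases "\<exists>x\<in>cube ?I. g x \<noteq> 0")
      case True
      obtain u where "u \<in> cube ?I" and u: "sup_norm n g = \<bar>g u\<bar>" "\<And>w. w \<in> cube ?I \<Longrightarrow> \<bar>g w\<bar> \<le> \<bar>g u\<bar>"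
        by (rule sup_norm_attained [of n g]) (rule that)
      have "g ?one \<le> sup_norm n g"
        using u(2) [OF one_cube] u(1) by linarith
      also have "\<dots> \<le> L * \<sigma>"
        using L True \<open>odd_on_cube n g\<close> \<sigma> by (subst (asm) val_Q_le_iff [OF Q]) auto
      finally show ?thesis .
    next
      \<comment> \<open>The zero function is excluded from \<open>val_Q\<close>, but then the
        left-hand side is 0.\<close>
      case False
      then show ?thesis using L(2) \<sigma>(1) one_cube [of ?I] by auto
    qed
    also have "\<dots> \<le> L * M"
      using \<open>\<sigma> \<le> M\<close> L(2) by (intro mult_left_mono) auto
    finally show ?thesis .
  qed
  have "\<exists>h. (\<forall>j\<in>?J. \<forall>x\<in>cube ?I - ?C j. h j x = 0) \<and> (\<forall>j\<in>?J. (\<Sum>x\<in>?C j. h j x) = 0) \<and>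
     (\<forall>x\<in>cube ?I. (\<Sum>j\<in>?J. h j x) = ?z x) \<and> (\<Sum>j\<in>?J. sqrt (card (?C j)) * L2_set (h j) (?C j)) \<le> L"
  proof (rule variance_duality)
    show "finite ?J" using finQ by (intro finite_SigmaI) auto
    show "?C j \<noteq> {}" if "j \<in> ?J" for j
    proof -
      have "card (?C j) > 0"
      proof (subst card_subcube)
        have "fst j \<in> Q" and c: "snd j \<in> cube (?I - fst j)" using that by auto
        show "snd j \<in> cube (?I - fst j)" by (fact c)
        show "fst j \<subseteq> ?I" using \<open>fst j \<in> Q\<close> Q by blast
      qed simp_all
      then show ?thesis by (metis card.empty less_irrefl)
    qed
    show "?C j \<subseteq> cube ?I" for j
      unfolding subcube_def by blast
  qed (use L(2) bound in simp_all)
  then obtain h where h: "\<forall>j\<in>?J. \<forall>x\<in>cube ?I - ?C j. h j x = 0" "\<forall>j\<in>?J. (\<Sum>x\<in>?C j. h j x) = 0"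
     "\<forall>x\<in>cube ?I. (\<Sum>j\<in>?J. h j x) = ?z x" "(\<Sum>j\<in>?J. sqrt (card (?C j)) * L2_set (h j) (?C j)) \<le> L"
    by blast
  obtain m v where v: "\<forall>x\<in>cube ?I. query_inner Q m (v x) (v x) \<le> (\<Sum>j\<in>?J. sqrt (card (?C j)) * L2_set (h j) (?C j))"
    and gram: "\<forall>x\<in>cube ?I. \<forall>y\<in>cube ?I. 4 * (\<Sum>q\<in>(SIGMA S:Q. cube S). \<Sum>w<m.
        if restrict x (fst q) = snd q \<and> restrict y (fst q) \<noteq> snd q then v x q w * v y q w else 0)
      = 1 - parity n x * parity n y"
  proof -
    have "\<exists>m v. (\<forall>x\<in>cube ?I. query_inner Q m (v x) (v x) \<le> (\<Sum>j\<in>?J. sqrt (card (?C j)) * L2_set (h j) (?C j))) \<and>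
      (\<forall>x\<in>cube ?I. \<forall>y\<in>cube ?I. 4 * (\<Sum>q\<in>(SIGMA S:Q. cube S). \<Sum>w<m.
        if restrict x (fst q) = snd q \<and> restrict y (fst q) \<noteq> snd q then v x q w * v y q w else 0)
      = 1 - parity n x * parity n y)"
    proof (rule query_vectors [OF Q])
      show "h j u = 0" if "j \<in> ?J" "u \<in> cube ?I" "u \<notin> ?C j" for j u
        using h(1) that by blast
      show "(\<Sum>u\<in>?C j. h j u) = 0" if "j \<in> ?J" for j
        using h(2) that by blast
      show "(\<Sum>j\<in>?J. h j u) = ?z u" if "u \<in> cube ?I" for u
        using h(3) that by blast
    qed
    then show ?thesis using that by blast
  qed
  show ?thesis
  proof (rule adversary_algorithm [OF Q Q_ne K parity_values])
    show "query_inner Q m (v x) (v x) \<le> L" if "x \<in> cube ?I" for x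
      using bspec [OF v that] h(4) by (rule order_trans)
    show "4 * (\<Sum>q\<in>(SIGMA S:Q. cube S). \<Sum>w<m.
        if restrict x (fst q) = snd q \<and> restrict y (fst q) \<noteq> snd q then v x q w * v y q w else 0)
      = 1 - parity n x * parity n y" if "x \<in> cube ?I" "y \<in> cube ?I" for x y
      using gram that by blast
  qed
qed

theorem theorem1p1:
  "\<exists>c1 c2 :: real. c1 > 0 \<and> c2 > 0 \<and>
     (\<forall>(n :: nat) (Q :: nat set set). n \<ge> 1 \<longrightarrow> Q \<subseteq> Pow {1..n} \<longrightarrow>
        ennreal c1 * val_Q n Q \<le> ennreal_of_enat (quantum_query_complexity n Q (parity n)) \<and>
        ennreal_of_enat (quantum_query_complexity n Q (parity n)) \<le> ennreal c2 * val_Q n Q)"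
proof (intro exI conjI allI impI)
  \<comment> \<open>36 comes from the energy argument, 72 from the error budget of the algorithm,
    and one more from rounding up, as \<open>val_Q\<close> is at least 1.\<close>
  show "(1 / 36 :: real) > 0" "(73 :: real) > 0" by simp_all
  fix n :: nat and Q :: "nat set set"
  assume n: "n \<ge> 1" and Q: "Q \<subseteq> Pow {1..n}"
  let ?A = "{T. quantum_computes n Q (parity n) T}"
  let ?q = "quantum_query_complexity n Q (parity n)"
  show "ennreal (1 / 36) * val_Q n Q \<le> ennreal_of_enat ?q"
  proof (cases "?A = {}")
    \<comment> \<open>Without any algorithm the complexity is an infimum over the empty set, hence
      infinite.\<close>
    case True
    then show ?thesis by (simp add: quantum_query_complexity_def top_enat_def)
  next
    case False
    then have "Inf (enat ` ?A) \<in> enat ` ?A"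
      by (metis image_is_empty wellorder_InfI ex_in_conv)
    then obtain T where T: "quantum_computes n Q (parity n) T" "?q = enat T"
      by (auto simp: quantum_query_complexity_def)
    have "ennreal (1 / 36) * val_Q n Q \<le> ennreal (1 / 36) * ennreal (36 * real T)"
      by (intro mult_left_mono val_Q_lower Q T) simp
    also have "\<dots> = ennreal_of_enat ?q"
      by (simp add: T(2) ennreal_of_nat_eq_real_of_nat flip: ennreal_mult)
    finally show ?thesis .
  qed
  show "ennreal_of_enat ?q \<le> ennreal 73 * val_Q n Q"
  proof (cases "val_Q n Q = top")
    case True
    then show ?thesis by (simp add: ennreal_mult_top)
  next
    case False
    define L where "L = enn2real (val_Q n Q)"
    have val: "val_Q n Q = ennreal L"
      using False by (simp add: L_def less_top)
    have L: "1 \<le> L"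
      using val_Q_ge_1 [OF n Q] unfolding val ennreal_1 [symmetric]
      by (subst (asm) ennreal_le_iff) (simp_all add: L_def)
    define K where "K = nat \<lceil>72 * L\<rceil>"
    have K: "K > 0" "72 * L \<le> real K" "real K \<le> 73 * L"
      using L unfolding K_def by linarith+
    have "quantum_computes n Q (parity n) K"
      by (rule val_Q_upper [OF n Q _ _ K(1,2)]) (use val L in auto)
    then have "?q \<le> enat K"
      unfolding quantum_query_complexity_def by (intro Inf_lower) auto
    then have "ennreal_of_enat ?q \<le> ennreal (real K)"
      by (metis ennreal_of_enat_enat ennreal_of_enat_le_iff ennreal_of_nat_eq_real_of_nat)
    also have "\<dots> \<le> ennreal (73 * L)"
      using K(3) by (rule ennreal_leI)
    finally show ?thesis
      using L by (simp add: val ennreal_mult)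
  qed
qed

end
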